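(* The equalities $$\mathrm{End}_{C^*(U)}(\mathcal{Q}_2)=\mathrm{Aut}_{C^*(U)}(\mathcal{Q}_2)=\{\beta^f:\ f\in C(\mathbb{T},\mathbb{T})\}$$ hold. In particular, the semigroup $\mathrm{End}_{C^*(U)}(\mathcal{Q}_2)$ is actually a group isomorphic with $C(\mathbb{T},\mathbb{T})$.
   Context: The $2$-adic ring $C^*$-algebra $\mathcal{Q}_2$ is the universal (unital) $C^*$-algebra generated by a unitary $U$ and an isometry $S_2$ satisfying $S_2U=U^2S_2$ and $S_2S_2^*+US_2S_2^*U^*=1$. All endomorphisms are unital and $*$-preserving. $\mathrm{End}_{C^*(U)}(\mathcal{Q}_2)$ (resp. $\mathrm{Aut}_{C^*(U)}(\mathcal{Q}_2)$) is the set of endomorphisms (resp. automorphisms) $\Lambda$ of $\mathcal{Q}_2$ fixing $C^*(U)$ pointwise, i.e. with $\Lambda(U)=U$, under composition. $\mathbb{T}$ is the set of complex numbers of modulus one and $C(\mathbb{T},\mathbb{T})$ is the group of continuous functions from $\mathbb{T}$ to $\mathbb{T}$ under pointwise multiplication. For $f\in C(\mathbb{T},\mathbb{T})$, $\beta^f$ denotes the automorphism of $\mathcal{Q}_2$ determined by $\beta^f(U)=U$ and $\beta^f(S_2)=f(U)S_2$, with $f(U)$ defined by continuous functional calculus. *)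

theory Defs
  imports "HOL-Analysis.Analysis" "HOL-Algebra.Module"
begin

section \<open>Unital C*-algebras\<close>

definition complex_field :: "complex ring" where
  "complex_field = \<lparr>carrier = UNIV, mult = (*), one = 1, zero = 0, add = (+)\<rparr>"

record 'a cstar_alg = "(complex, 'a) module" +
  star :: "'a \<Rightarrow> 'a"
  nrm :: "'a \<Rightarrow> real"

text \<open>The locale \<^locale>\<open>Metric_space\<close> asks for symmetry and nonnegativity at all elements of
  the type, so the distance is set to \<open>0\<close> outside the carrier.\<close>

definition norm_dist :: "'a cstar_alg \<Rightarrow> 'a \<Rightarrow> 'a \<Rightarrow> real" where
  "norm_dist A x y =
     (if x \<in> carrier A \<and> y \<in> carrier A then nrm A (x \<ominus>\<^bsub>A\<^esub> y) else 0)"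

locale normed_star_algebra = A?: ring A + module complex_field A
  for A :: "'a cstar_alg" (structure) +
  assumes one_neq_zero: "\<one> \<noteq> \<zero>"
    and smult_mult_left:
      "\<lbrakk>x \<in> carrier A; y \<in> carrier A\<rbrakk> \<Longrightarrow> (c \<odot> x) \<otimes> y = c \<odot> (x \<otimes> y)"
    and smult_mult_right:
      "\<lbrakk>x \<in> carrier A; y \<in> carrier A\<rbrakk> \<Longrightarrow> x \<otimes> (c \<odot> y) = c \<odot> (x \<otimes> y)"
    and star_closed: "x \<in> carrier A \<Longrightarrow> star A x \<in> carrier A"
    and star_star: "x \<in> carrier A \<Longrightarrow> star A (star A x) = x"
    and star_add:
      "\<lbrakk>x \<in> carrier A; y \<in> carrier A\<rbrakk> \<Longrightarrow> star A (x \<oplus> y) = star A x \<oplus> star A y"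
    and star_mult:
      "\<lbrakk>x \<in> carrier A; y \<in> carrier A\<rbrakk> \<Longrightarrow> star A (x \<otimes> y) = star A y \<otimes> star A x"
    and star_smult: "x \<in> carrier A \<Longrightarrow> star A (c \<odot> x) = cnj c \<odot> star A x"
    and nrm_nonneg: "x \<in> carrier A \<Longrightarrow> 0 \<le> nrm A x"
    and nrm_eq_zero: "x \<in> carrier A \<Longrightarrow> nrm A x = 0 \<longleftrightarrow> x = \<zero>"
    and nrm_triangle:
      "\<lbrakk>x \<in> carrier A; y \<in> carrier A\<rbrakk> \<Longrightarrow> nrm A (x \<oplus> y) \<le> nrm A x + nrm A y"
    and nrm_smult: "x \<in> carrier A \<Longrightarrow> nrm A (c \<odot> x) = cmod c * nrm A x"
    and nrm_mult:
      "\<lbrakk>x \<in> carrier A; y \<in> carrier A\<rbrakk> \<Longrightarrow> nrm A (x \<otimes> y) \<le> nrm A x * nrm A y"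
begin

lemma nrm_uminus:
  assumes x: "x \<in> carrier A"
  shows "nrm A (\<ominus> x) = nrm A x"
proof -
  have c: "\<And>c. c \<in> carrier complex_field" by (simp add: complex_field_def)
  have one: "1 \<odot> x = x"
    using smult_one[OF x] by (simp add: complex_field_def)
  have zero: "0 \<odot> x = \<zero>"
    using x nrm_smult[OF x, of 0] nrm_eq_zero[OF smult_closed[OF c[of 0] x]] by simp
  have m1: "(-1) \<odot> x \<in> carrier A" by (rule smult_closed[OF c x])
  have "((-1) \<oplus>\<^bsub>complex_field\<^esub> 1) \<odot> x = (-1) \<odot> x \<oplus> 1 \<odot> x"
    by (rule smult_l_distr[OF c c x])
  then have "(-1) \<odot> x \<oplus> x = \<zero>" by (simp add: one zero complex_field_def)
  then have "\<ominus> x = (-1) \<odot> x" using m1 x by (metis A.minus_equality)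
  then show ?thesis using nrm_smult[OF x, of "-1"] by simp
qed

sublocale normed: Metric_space "carrier A" "norm_dist A"
proof
  fix x y z
  show "0 \<le> norm_dist A x y" by (simp add: norm_dist_def nrm_nonneg)
  have swap: "y \<ominus> x = \<ominus> (x \<ominus> y)" if "x \<in> carrier A" "y \<in> carrier A"
    using that by (simp add: a_minus_def A.minus_add A.a_comm)
  show "norm_dist A x y = norm_dist A y x"
    unfolding norm_dist_def using swap nrm_uminus by auto
  show "norm_dist A x y = 0 \<longleftrightarrow> x = y" if "x \<in> carrier A" "y \<in> carrier A"
  proof -
    have "x \<ominus> y = \<zero> \<longleftrightarrow> x = y"
      using that A.minus_equality[of x "\<ominus> y"] by (auto simp: a_minus_def A.r_neg)
    then show ?thesis using that by (simp add: norm_dist_def nrm_eq_zero)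
  qed
  show "norm_dist A x z \<le> norm_dist A x y + norm_dist A y z"
    if "x \<in> carrier A" "y \<in> carrier A" "z \<in> carrier A"
  proof -
    have "x \<ominus> z = (x \<ominus> y) \<oplus> (y \<ominus> z)"
      using that by (simp add: a_minus_def A.a_assoc A.r_neg1)
    then show ?thesis using that nrm_triangle[of "x \<ominus> y" "y \<ominus> z"]
      by (simp add: norm_dist_def)
  qed
qed

end

locale unital_cstar_algebra = normed_star_algebra +
  assumes cstar_identity: "x \<in> carrier A \<Longrightarrow> nrm A (star A x \<otimes> x) = (nrm A x)\<^sup>2"
    and complete: "normed.mcomplete"

definition cstar_subalgebra :: "'a cstar_alg \<Rightarrow> 'a set \<Rightarrow> bool" where
  "cstar_subalgebra A B \<longleftrightarrow>
     B \<subseteq> carrier A \<and> \<one>\<^bsub>A\<^esub> \<in> B \<and>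
     (\<forall>x\<in>B. \<forall>y\<in>B. x \<oplus>\<^bsub>A\<^esub> y \<in> B \<and> x \<otimes>\<^bsub>A\<^esub> y \<in> B) \<and>
     (\<forall>c. \<forall>x\<in>B. c \<odot>\<^bsub>A\<^esub> x \<in> B) \<and>
     (\<forall>x\<in>B. star A x \<in> B) \<and>
     closedin (Metric_space.mtopology (carrier A) (norm_dist A)) B"

definition cstar_generated :: "'a cstar_alg \<Rightarrow> 'a set \<Rightarrow> 'a set" where
  "cstar_generated A X = \<Inter> {B. cstar_subalgebra A B \<and> X \<subseteq> B}"

text \<open>Homomorphisms are unital, and extensional, so that two homomorphisms are equal
  as soon as they agree on the carrier.\<close>

definition star_hom :: "'a cstar_alg \<Rightarrow> 'b cstar_alg \<Rightarrow> ('a \<Rightarrow> 'b) set" where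
  "star_hom A B =
     {\<Phi> \<in> ring_hom A B \<inter> extensional (carrier A).
        (\<forall>c. \<forall>x\<in>carrier A. \<Phi> (c \<odot>\<^bsub>A\<^esub> x) = c \<odot>\<^bsub>B\<^esub> \<Phi> x) \<and>
        (\<forall>x\<in>carrier A. \<Phi> (star A x) = star B (\<Phi> x))}"

definition is_unitary :: "'a cstar_alg \<Rightarrow> 'a \<Rightarrow> bool" where
  "is_unitary A u \<longleftrightarrow>
     u \<in> carrier A \<and> star A u \<otimes>\<^bsub>A\<^esub> u = \<one>\<^bsub>A\<^esub> \<and> u \<otimes>\<^bsub>A\<^esub> star A u = \<one>\<^bsub>A\<^esub>"

definition is_isometry :: "'a cstar_alg \<Rightarrow> 'a \<Rightarrow> bool" where
  "is_isometry A s \<longleftrightarrow> s \<in> carrier A \<and> star A s \<otimes>\<^bsub>A\<^esub> s = \<one>\<^bsub>A\<^esub>"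

section \<open>Continuous functional calculus\<close>

definition spectrum :: "'a cstar_alg \<Rightarrow> 'a \<Rightarrow> complex set" where
  "spectrum A x = {c. c \<odot>\<^bsub>A\<^esub> \<one>\<^bsub>A\<^esub> \<ominus>\<^bsub>A\<^esub> x \<notin> Units A}"

definition continuous_functions :: "complex set \<Rightarrow> (complex \<Rightarrow> complex) cstar_alg" where
  "continuous_functions X =
     \<lparr>carrier = {f \<in> extensional X. continuous_on X f},
      mult = (\<lambda>f g. \<lambda>z\<in>X. f z * g z),
      one = (\<lambda>z\<in>X. 1),
      zero = (\<lambda>z\<in>X. 0),
      add = (\<lambda>f g. \<lambda>z\<in>X. f z + g z),
      smult = (\<lambda>c f. \<lambda>z\<in>X. c * f z),
      star = (\<lambda>f. \<lambda>z\<in>X. cnj (f z)),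
      nrm = (\<lambda>f. SUP z\<in>X. cmod (f z))\<rparr>"

text \<open>For a normal element \<open>x\<close> there is exactly one unital *-homomorphism from the continuous
  functions on the spectrum of \<open>x\<close> that maps the identity function to \<open>x\<close>;
  \<open>f(x)\<close> is the image of \<open>f\<close> under it.\<close>

definition functional_calculus :: "'a cstar_alg \<Rightarrow> 'a \<Rightarrow> (complex \<Rightarrow> complex) \<Rightarrow> 'a" where
  "functional_calculus A x f =
     (THE y. \<exists>\<Phi> \<in> star_hom (continuous_functions (spectrum A x)) A.
        \<Phi> (\<lambda>z\<in>spectrum A x. z) = x \<and> y = \<Phi> (restrict f (spectrum A x)))"

section \<open>The 2-adic ring C*-algebra\<close>

definition two_adic_pair :: "'a cstar_alg \<Rightarrow> 'a \<Rightarrow> 'a \<Rightarrow> bool" where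
  "two_adic_pair A u s \<longleftrightarrow>
     is_unitary A u \<and> is_isometry A s \<and>
     s \<otimes>\<^bsub>A\<^esub> u = (u \<otimes>\<^bsub>A\<^esub> u) \<otimes>\<^bsub>A\<^esub> s \<and>
     s \<otimes>\<^bsub>A\<^esub> star A s \<oplus>\<^bsub>A\<^esub> ((u \<otimes>\<^bsub>A\<^esub> s) \<otimes>\<^bsub>A\<^esub> star A s) \<otimes>\<^bsub>A\<^esub> star A u = \<one>\<^bsub>A\<^esub>"

text \<open>HOL cannot quantify over types inside a formula, so the universal property ranges over
  the C*-algebras \<open>B\<close> whose elements lie in the type of the elements of \<open>A\<close>. This
  is no restriction. As \<open>1 \<noteq> 0\<close> in \<open>A\<close>, the type contains a copy of the complex
  numbers, while a C*-algebra generated by two elements is separable and hence has at most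
  continuum many elements; so each such algebra has an isomorphic copy on this type.
  (The zero algebra, which is not a \<^locale>\<open>unital_cstar_algebra\<close>, is trivially a target.)
  Uniqueness of \<open>\<Phi>\<close> follows from generation.\<close>

definition two_adic_ring_algebra :: "'a cstar_alg \<Rightarrow> 'a \<Rightarrow> 'a \<Rightarrow> bool" where
  "two_adic_ring_algebra A U S \<longleftrightarrow>
     unital_cstar_algebra A \<and> two_adic_pair A U S \<and>
     cstar_generated A {U, S} = carrier A \<and>
     (\<forall>(B :: 'a cstar_alg) V T. unital_cstar_algebra B \<and> two_adic_pair B V T \<longrightarrow>
        (\<exists>\<Phi> \<in> star_hom A B. \<Phi> U = V \<and> \<Phi> S = T))"

section \<open>Endomorphisms and automorphisms fixing a subset pointwise\<close>

definition fixing_End :: "'a cstar_alg \<Rightarrow> 'a set \<Rightarrow> ('a \<Rightarrow> 'a) set" where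
  "fixing_End A B = {\<Lambda> \<in> star_hom A A. \<forall>x\<in>B. \<Lambda> x = x}"

definition fixing_Aut :: "'a cstar_alg \<Rightarrow> 'a set \<Rightarrow> ('a \<Rightarrow> 'a) set" where
  "fixing_Aut A B = {\<Lambda> \<in> fixing_End A B. bij_betw \<Lambda> (carrier A) (carrier A)}"

definition fixing_End_monoid :: "'a cstar_alg \<Rightarrow> 'a set \<Rightarrow> ('a \<Rightarrow> 'a) monoid" where
  "fixing_End_monoid A B =
     \<lparr>carrier = fixing_End A B, mult = compose (carrier A), one = (\<lambda>x\<in>carrier A. x)\<rparr>"

definition circle_maps :: "(complex \<Rightarrow> complex) set" where
  "circle_maps =
     {f \<in> sphere 0 1 \<rightarrow>\<^sub>E sphere 0 1. continuous_on (sphere 0 1) f}"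

definition circle_maps_group :: "(complex \<Rightarrow> complex) monoid" where
  "circle_maps_group =
     \<lparr>carrier = circle_maps, mult = (\<lambda>f g. \<lambda>z\<in>sphere 0 1. f z * g z),
      one = (\<lambda>z\<in>sphere 0 1. 1)\<rparr>"

definition beta :: "'a cstar_alg \<Rightarrow> 'a \<Rightarrow> 'a \<Rightarrow> (complex \<Rightarrow> complex) \<Rightarrow> 'a \<Rightarrow> 'a" where
  "beta A U S f =
     (THE \<Lambda>. \<Lambda> \<in> star_hom A A \<and> bij_betw \<Lambda> (carrier A) (carrier A) \<and>
        \<Lambda> U = U \<and> \<Lambda> S = functional_calculus A U f \<otimes>\<^bsub>A\<^esub> S)"

end

theory Submission
  imports Defs "HOL-Computational_Algebra.Fundamental_Theorem_Algebra"
begin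

text \<open>Let \<open>\<Lambda>\<close> be an endomorphism with \<open>\<Lambda>(U) = U\<close>, and put \<open>W = \<Lambda>(S) S* + U \<Lambda>(S) S* U*\<close>. Since both
  \<open>(U, S)\<close> and \<open>(U, \<Lambda>(S))\<close> satisfy the defining relations, \<open>W\<close> is unitary, commutes with \<open>U\<close>,
  and satisfies \<open>\<Lambda>(S) = W S\<close>. The heart of the matter is that the commutant of \<open>U\<close> is no larger
  than \<open>C*(U)\<close> (\<open>commutant_eq_generated\<close>). Then \<open>W = f(U)\<close> for a continuous \<open>f\<close>, which is
  circle-valued because \<open>W\<close> is unitary, so \<open>\<Lambda> = \<beta>\<^sup>f\<close>. Conversely, every pair \<open>(U, f(U) S)\<close> with
  circle-valued \<open>f\<close> satisfies the relations, so \<open>\<beta>\<^sup>f\<close> exists as an endomorphism by universality;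
  endomorphisms fixing \<open>U\<close> fix \<open>f(U)\<close>, whence \<open>\<beta>\<^sup>f \<beta>\<^sup>g = \<beta>\<^bsup>fg\<^esup>\<close>, and the complex conjugate of \<open>f\<close>
  gives the inverse. The map \<open>f \<mapsto> \<beta>\<^sup>f\<close> is injective because \<open>f(U)\<close> can be recovered from \<open>f(U) S\<close>
  and the spectrum of \<open>U\<close> is the whole circle.

  The commutant. Sums of elements of bidegree \<open>(p, q)\<close>, that is, of combinations of the monomials
  \<open>U\<^sup>a S\<^sup>p S*\<^sup>q U\<^sup>b\<close>, are dense. The gauge automorphisms, which fix \<open>U\<close> and map \<open>S\<close> to \<open>t S\<close>, multiply
  such an element by \<open>t\<close> to the power \<open>p - q\<close>. Averages of gauge automorphisms over roots of unity,
  with Fourier weights, approximately extract the part of degree \<open>m\<close> of an element \<open>w\<close> of the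
  commutant; with Fejer weights, they recover \<open>w\<close> approximately from finitely many of these parts.
  The averages stay inside the commutant, since the gauge automorphisms fix \<open>U\<close>. So two facts about
  an element \<open>e\<close> of the commutant suffice.

  \<^item> If \<open>e\<close> is close to an element \<open>x\<close> of bidegree \<open>(p, p)\<close>, then \<open>e\<close> is close to a Laurent polynomial
    in \<open>U\<close>: averaging \<open>x\<close> with its conjugate by a suitable power of \<open>U\<close> keeps the distance to \<open>e\<close>,
    and lowers the bidegree to \<open>(p-1, p-1)\<close>, as \<open>S S* + U S S* U* = 1\<close>
    (\<open>commutant_near_homog_diag\<close>).
  \<^item> If \<open>e\<close> is close to an element \<open>x\<close> of bidegree \<open>(p, q)\<close> with \<open>p \<noteq> q\<close>, then \<open>e\<close> is small. Conjugating
    \<open>x\<close> by a power of \<open>U\<close> amounts to multiplying it by \<open>U\<^bsup>dj\<^esup>\<close>, with \<open>d \<noteq> 0\<close> fixed and \<open>j\<close> any integer.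
    Conjugation fixes \<open>e\<close>, so \<open>e\<close> is almost invariant under multiplication by every \<open>U\<^bsup>dj\<^esup>\<close>. Hence so
    is a Laurent polynomial \<open>f(U)\<close> close to \<open>e e*\<close>, and \<open>f\<close> is small, because near every point of the
    circle there are \<open>z\<close> and \<open>j\<close> with \<open>z\<^bsup>dj\<^esup> = -1\<close> (\<open>commutant_near_homog_offdiag\<close>).

  The general C*-algebra used here rests on one estimate: the norm of an element whose norm is
  multiplicative along repeated squaring is bounded by its spectral radius
  (\<open>nrm_le_spectral_radius\<close>). It shows that unital *-homomorphisms are contractive, that the norm of
  a Laurent polynomial in \<open>U\<close> is at most its supremum over the circle, and that the spectrum of \<open>U\<close> is
  not empty.\<close>

section \<open>Normed star algebras\<close>

context normed_star_algebra
begin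

lemma smult_cl [simp, intro]: "x \<in> carrier A \<Longrightarrow> c \<odot> x \<in> carrier A"
  using smult_closed[of c x] by (simp add: complex_field_def)

lemma smult_smult: "x \<in> carrier A \<Longrightarrow> c \<odot> (d \<odot> x) = (c * d) \<odot> x"
  using smult_assoc1[of c d x] by (simp add: complex_field_def)

lemma smult_add_left: "x \<in> carrier A \<Longrightarrow> (c + d) \<odot> x = c \<odot> x \<oplus> d \<odot> x"
  using smult_l_distr[of c d x] by (simp add: complex_field_def)

lemma smult_add_right:
  "x \<in> carrier A \<Longrightarrow> y \<in> carrier A \<Longrightarrow> c \<odot> (x \<oplus> y) = c \<odot> x \<oplus> c \<odot> y"
  using smult_r_distr[of c x y] by (simp add: complex_field_def)

lemma smult_1 [simp]: "x \<in> carrier A \<Longrightarrow> 1 \<odot> x = x"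
  using smult_one[of x] by (simp add: complex_field_def)

lemma smult_0 [simp]: "x \<in> carrier A \<Longrightarrow> 0 \<odot> x = \<zero>"
  using smult_l_null[of x] by (simp add: complex_field_def)

lemma smult_zero [simp]: "c \<odot> \<zero> = \<zero>"
  using smult_r_null[of c] by (simp add: complex_field_def)

lemma smult_minus1: "x \<in> carrier A \<Longrightarrow> (-1) \<odot> x = \<ominus> x"
  using smult_add_left[of x "-1" 1] by (simp add: A.minus_equality)

lemma smult_uminus: "x \<in> carrier A \<Longrightarrow> (- c) \<odot> x = \<ominus> (c \<odot> x)"
  using smult_minus1[of "c \<odot> x"] by (simp add: smult_smult)

lemma smult_diff_left: "x \<in> carrier A \<Longrightarrow> (c - d) \<odot> x = c \<odot> x \<ominus> d \<odot> x"
  using smult_add_left[of x c "- d"] by (simp add: smult_uminus A.minus_eq)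

lemma smult_minus_right: "x \<in> carrier A \<Longrightarrow> c \<odot> (\<ominus> x) = \<ominus> (c \<odot> x)"
  using smult_smult[of x c "-1"] by (simp add: smult_uminus)

lemma smult_diff_right:
  "x \<in> carrier A \<Longrightarrow> y \<in> carrier A \<Longrightarrow> c \<odot> (x \<ominus> y) = c \<odot> x \<ominus> c \<odot> y"
  by (simp add: A.minus_eq smult_add_right smult_minus_right)

lemmas star_cl [simp, intro] = star_closed

lemmas smult_mult = smult_mult_left smult_mult_right smult_smult

lemma star_one [simp]: "star A \<one> = \<one>"
  by (metis A.one_closed A.r_one star_closed star_mult star_star)

lemma star_zero [simp]: "star A \<zero> = \<zero>"
  using star_smult[of \<zero> 0] by simp

lemma star_uminus: "x \<in> carrier A \<Longrightarrow> star A (\<ominus> x) = \<ominus> star A x"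
  using star_smult[of x "-1"] by (simp add: smult_minus1)

lemma star_diff: "x \<in> carrier A \<Longrightarrow> y \<in> carrier A \<Longrightarrow> star A (x \<ominus> y) = star A x \<ominus> star A y"
  by (simp add: A.minus_eq star_add star_uminus)

lemma nrm_zero [simp]: "nrm A \<zero> = 0"
  by (simp add: nrm_eq_zero)

lemma diff_self [simp]: "x \<in> carrier A \<Longrightarrow> x \<ominus> x = \<zero>"
  by (simp add: A.minus_eq A.r_neg)

lemma diff_zero [simp]: "x \<in> carrier A \<Longrightarrow> x \<ominus> \<zero> = x"
  by (simp add: A.minus_eq)

lemma diff_eq_zero: "x \<in> carrier A \<Longrightarrow> y \<in> carrier A \<Longrightarrow> x \<ominus> y = \<zero> \<Longrightarrow> x = y"
  using A.minus_equality[of x "\<ominus> y"] by (simp add: A.minus_eq)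

lemma nrm_diff_zero:
  "x \<in> carrier A \<Longrightarrow> y \<in> carrier A \<Longrightarrow> nrm A (x \<ominus> y) \<le> 0 \<Longrightarrow> x = y"
  by (metis A.minus_closed diff_eq_zero nrm_eq_zero nrm_nonneg order_antisym)

lemma nrm_diff_commute:
  assumes "x \<in> carrier A" "y \<in> carrier A"
  shows "nrm A (x \<ominus> y) = nrm A (y \<ominus> x)"
proof -
  have "x \<ominus> y = \<ominus> (y \<ominus> x)"
    using assms by algebra
  then show ?thesis
    using assms by (simp add: nrm_uminus)
qed

lemma nrm_diff_triangle:
  assumes "x \<in> carrier A" "y \<in> carrier A" "z \<in> carrier A"
  shows "nrm A (x \<ominus> z) \<le> nrm A (x \<ominus> y) + nrm A (y \<ominus> z)"
proof -
  have "x \<ominus> z = (x \<ominus> y) \<oplus> (y \<ominus> z)"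
    using assms by algebra
  then show ?thesis
    using assms nrm_triangle[of "x \<ominus> y" "y \<ominus> z"] by simp
qed

lemma nrm_diff_ineq:
  assumes "x \<in> carrier A" "y \<in> carrier A"
  shows "nrm A x \<le> nrm A y + nrm A (x \<ominus> y)"
proof -
  have "x = y \<oplus> (x \<ominus> y)"
    using assms by algebra
  then show ?thesis
    using assms nrm_triangle[of y "x \<ominus> y"] by simp
qed

lemma nrm_add_diff:
  assumes "x \<in> carrier A" "y \<in> carrier A" "x' \<in> carrier A" "y' \<in> carrier A"
  shows "nrm A ((x \<oplus> y) \<ominus> (x' \<oplus> y')) \<le> nrm A (x \<ominus> x') + nrm A (y \<ominus> y')"
proof -
  have "(x \<oplus> y) \<ominus> (x' \<oplus> y') = (x \<ominus> x') \<oplus> (y \<ominus> y')"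
    using assms by algebra
  then show ?thesis
    using assms nrm_triangle[of "x \<ominus> x'" "y \<ominus> y'"] by simp
qed

lemma nrm_mult_diff:
  assumes "x \<in> carrier A" "y \<in> carrier A" "x' \<in> carrier A" "y' \<in> carrier A"
  shows "nrm A (x \<otimes> y \<ominus> x' \<otimes> y') \<le> nrm A (x \<ominus> x') * nrm A y + nrm A x' * nrm A (y \<ominus> y')"
proof -
  have "x \<otimes> y \<ominus> x' \<otimes> y' = (x \<ominus> x') \<otimes> y \<oplus> x' \<otimes> (y \<ominus> y')"
    using assms by algebra
  then show ?thesis
    using assms nrm_triangle[of "(x \<ominus> x') \<otimes> y" "x' \<otimes> (y \<ominus> y')"]
      nrm_mult[of "x \<ominus> x'" y] nrm_mult[of x' "y \<ominus> y'"] by simp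
qed

lemma nrm_smult_diff:
  "x \<in> carrier A \<Longrightarrow> y \<in> carrier A \<Longrightarrow> nrm A (c \<odot> x \<ominus> c \<odot> y) = cmod c * nrm A (x \<ominus> y)"
  by (simp add: smult_diff_right[symmetric] nrm_smult)

definition norm_closure :: "'a set \<Rightarrow> 'a set" where
  "norm_closure X = {y \<in> carrier A. \<forall>e>0. \<exists>x\<in>X. nrm A (y \<ominus> x) < e}"

lemma norm_closureD: "y \<in> norm_closure X \<Longrightarrow> e > 0 \<Longrightarrow> \<exists>x\<in>X. nrm A (y \<ominus> x) < e"
  by (simp add: norm_closure_def)

lemma closedin_iff_norm_closure:
  assumes "X \<subseteq> carrier A"
  shows "closedin normed.mtopology X \<longleftrightarrow> norm_closure X \<subseteq> X"
proof -
  have ball: "x \<in> normed.mball y r \<longleftrightarrow> nrm A (y \<ominus> x) < r"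
    if "y \<in> carrier A" "x \<in> X" for x y r
    using that assms by (auto simp: norm_dist_def)
  show ?thesis
    unfolding normed.closedin_metric disjnt_iff norm_closure_def
    using assms ball by (smt (verit) DiffD1 DiffD2 DiffI mem_Collect_eq subset_iff)
qed

lemma norm_closure_superset: "X \<subseteq> carrier A \<Longrightarrow> X \<subseteq> norm_closure X"
  by (auto simp: norm_closure_def intro!: bexI)

lemma norm_closure_idem:
  assumes X: "X \<subseteq> carrier A"
  shows "norm_closure (norm_closure X) \<subseteq> norm_closure X"
proof
  fix y assume y: "y \<in> norm_closure (norm_closure X)"
  then have yc: "y \<in> carrier A" by (simp add: norm_closure_def)
  have "\<exists>x\<in>X. nrm A (y \<ominus> x) < e" if "e > 0" for e
  proof -
    obtain z where z: "z \<in> norm_closure X" "nrm A (y \<ominus> z) < e / 2"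
      using norm_closureD[OF y, of "e / 2"] \<open>e > 0\<close> by auto
    then obtain x where x: "x \<in> X" "nrm A (z \<ominus> x) < e / 2"
      using norm_closureD[OF z(1), of "e / 2"] \<open>e > 0\<close> by auto
    have "z \<in> carrier A" using z by (simp add: norm_closure_def)
    then have "nrm A (y \<ominus> x) < e"
      using nrm_diff_triangle[OF yc, of z x] x z X by auto
    then show ?thesis using x by blast
  qed
  then show "y \<in> norm_closure X" using yc by (simp add: norm_closure_def)
qed

lemma cstar_subalgebra_iff:
  "cstar_subalgebra A X \<longleftrightarrow>
     X \<subseteq> carrier A \<and> \<one> \<in> X \<and> (\<forall>x\<in>X. \<forall>y\<in>X. x \<oplus> y \<in> X \<and> x \<otimes> y \<in> X) \<and>
     (\<forall>c. \<forall>x\<in>X. c \<odot> x \<in> X) \<and> (\<forall>x\<in>X. star A x \<in> X) \<and> norm_closure X \<subseteq> X"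
  unfolding cstar_subalgebra_def using closedin_iff_norm_closure[of X] by blast

lemma cstar_subalgebra_carrier: "cstar_subalgebra A (carrier A)"
  by (auto simp: cstar_subalgebra_iff norm_closure_def)

lemma cstar_subalgebra_generated:
  assumes "X \<subseteq> carrier A"
  shows "cstar_subalgebra A (cstar_generated A X)" "X \<subseteq> cstar_generated A X"
proof -
  show "X \<subseteq> cstar_generated A X" by (auto simp: cstar_generated_def)
  have "carrier A \<in> {B. cstar_subalgebra A B \<and> X \<subseteq> B}"
    using assms cstar_subalgebra_carrier by simp
  then have ne: "cstar_generated A X \<subseteq> carrier A"
    unfolding cstar_generated_def by blast
  have "y \<in> cstar_generated A X" if y: "y \<in> norm_closure (cstar_generated A X)" for y
    unfolding cstar_generated_def
  proof (rule InterI)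
    fix B assume B: "B \<in> {B. cstar_subalgebra A B \<and> X \<subseteq> B}"
    have "cstar_generated A X \<subseteq> B" unfolding cstar_generated_def using B by blast
    then have "y \<in> norm_closure B" using y unfolding norm_closure_def by blast
    then show "y \<in> B" using B by (auto simp: cstar_subalgebra_iff)
  qed
  then have cl: "norm_closure (cstar_generated A X) \<subseteq> cstar_generated A X" by blast
  show "cstar_subalgebra A (cstar_generated A X)"
    unfolding cstar_subalgebra_iff
    using ne cl by (auto simp: cstar_generated_def cstar_subalgebra_iff)
qed

lemma cstar_generated_least: "cstar_subalgebra A B \<Longrightarrow> X \<subseteq> B \<Longrightarrow> cstar_generated A X \<subseteq> B"
  by (auto simp: cstar_generated_def)

end

context unital_cstar_algebra
begin

lemma nrm_star_ge: "x \<in> carrier A \<Longrightarrow> nrm A x \<le> nrm A (star A x)"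
proof -
  assume x: "x \<in> carrier A"
  have "(nrm A x)\<^sup>2 \<le> nrm A (star A x) * nrm A x"
    using cstar_identity[OF x] nrm_mult[of "star A x" x] x by simp
  then show ?thesis
    using nrm_nonneg[OF x] nrm_nonneg[of "star A x"] x
    by (cases "nrm A x = 0") (auto simp: power2_eq_square)
qed

lemma nrm_star [simp]: "x \<in> carrier A \<Longrightarrow> nrm A (star A x) = nrm A x"
  using nrm_star_ge[of x] nrm_star_ge[of "star A x"] by (simp add: star_star)

lemma nrm_one [simp]: "nrm A \<one> = 1"
proof -
  have "nrm A \<one> = (nrm A \<one>)\<^sup>2" using cstar_identity[of \<one>] by simp
  moreover have "nrm A \<one> \<noteq> 0" using one_neq_zero by (simp add: nrm_eq_zero)
  ultimately show ?thesis by (simp add: power2_eq_square)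
qed

lemma nrm_isometry: "is_isometry A s \<Longrightarrow> nrm A s = 1"
proof -
  assume s: "is_isometry A s"
  then have "(nrm A s)\<^sup>2 = 1" "0 \<le> nrm A s"
    using cstar_identity[of s] by (auto simp: is_isometry_def nrm_nonneg)
  then show ?thesis by (auto simp: power2_eq_1_iff)
qed

lemma nrm_unitary: "is_unitary A u \<Longrightarrow> nrm A u = 1"
  by (simp add: nrm_isometry is_isometry_def is_unitary_def)

lemma nrm_unitary_mult:
  assumes u: "is_unitary A u" and x: "x \<in> carrier A"
  shows "nrm A (u \<otimes> x) = nrm A x"
proof (rule antisym)
  have uc: "u \<in> carrier A" "star A u \<otimes> u = \<one>" using u by (auto simp: is_unitary_def)
  show "nrm A (u \<otimes> x) \<le> nrm A x"
    using nrm_mult[of u x] uc x nrm_unitary[OF u] by simp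
  have "star A u \<otimes> (u \<otimes> x) = x"
    using uc x by (simp add: A.m_assoc[symmetric])
  then show "nrm A x \<le> nrm A (u \<otimes> x)"
    using nrm_mult[of "star A u" "u \<otimes> x"] uc x nrm_unitary[OF u] by simp
qed

lemma nrm_unitary_conj:
  assumes u: "is_unitary A u" and x: "x \<in> carrier A"
  shows "nrm A (u \<otimes> x \<otimes> star A u) \<le> nrm A x"
proof -
  have uc: "u \<in> carrier A" using u by (simp add: is_unitary_def)
  show ?thesis
    using nrm_mult[of "u \<otimes> x" "star A u"] nrm_unitary_mult[OF u x] nrm_unitary[OF u] uc x by simp
qed

lemma cstar_subalgebra_norm_closure:
  assumes X: "X \<subseteq> carrier A" and one: "\<one> \<in> X"
    and add: "\<And>x y. x \<in> X \<Longrightarrow> y \<in> X \<Longrightarrow> x \<oplus> y \<in> X"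
    and mult: "\<And>x y. x \<in> X \<Longrightarrow> y \<in> X \<Longrightarrow> x \<otimes> y \<in> X"
    and smult: "\<And>c x. x \<in> X \<Longrightarrow> c \<odot> x \<in> X"
    and star: "\<And>x. x \<in> X \<Longrightarrow> star A x \<in> X"
  shows "cstar_subalgebra A (norm_closure X)"
  unfolding cstar_subalgebra_iff
proof (intro conjI ballI allI norm_closure_idem X)
  show "norm_closure X \<subseteq> carrier A" by (auto simp: norm_closure_def)
  show "\<one> \<in> norm_closure X" using one norm_closure_superset[OF X] by blast
next
  fix y y' assume y: "y \<in> norm_closure X" "y' \<in> norm_closure X"
  then have c: "y \<in> carrier A" "y' \<in> carrier A" by (auto simp: norm_closure_def)
  have "\<exists>w\<in>X. nrm A ((y \<oplus> y') \<ominus> w) < e" if "e > 0" for e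
  proof -
    obtain x x' where x: "x \<in> X" "x' \<in> X" "nrm A (y \<ominus> x) < e / 2" "nrm A (y' \<ominus> x') < e / 2"
      using norm_closureD[OF y(1), of "e / 2"] norm_closureD[OF y(2), of "e / 2"] \<open>e > 0\<close> by auto
    then have "x \<in> carrier A" "x' \<in> carrier A" using X by auto
    then have "nrm A ((y \<oplus> y') \<ominus> (x \<oplus> x')) < e"
      using nrm_add_diff[of y y' x x'] c x(3,4) by simp
    then show ?thesis using add x by blast
  qed
  then show "y \<oplus> y' \<in> norm_closure X" using c by (simp add: norm_closure_def)
  have "\<exists>w\<in>X. nrm A (y \<otimes> y' \<ominus> w) < e" if "e > 0" for e
  proof -
    \<comment> \<open>The radius \<open>d\<close> is such that the errors from the two factors add up to less than \<open>d K \<le> e\<close>.\<close>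
    define K where "K = nrm A y + nrm A y' + 2"
    define d where "d = min 1 (e / K)"
    have K: "K > 0" using c nrm_nonneg[of y] nrm_nonneg[of y'] by (simp add: K_def)
    have d: "0 < d" "d \<le> 1" "d * K \<le> e" using K that by (auto simp: d_def min_def field_simps)
    obtain x x' where x: "x \<in> X" "x' \<in> X" "nrm A (y \<ominus> x) < d" "nrm A (y' \<ominus> x') < d"
      using norm_closureD[OF y(1) d(1)] norm_closureD[OF y(2) d(1)] by auto
    have xc: "x \<in> carrier A" "x' \<in> carrier A" using x X by auto
    have nx: "nrm A x \<le> nrm A y + 1"
      using nrm_diff_ineq[OF xc(1) c(1)] nrm_diff_commute[OF xc(1) c(1)] x d by simp
    have "nrm A (y \<otimes> y' \<ominus> x \<otimes> x') \<le> nrm A (y \<ominus> x) * nrm A y' + nrm A x * nrm A (y' \<ominus> x')"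
      by (rule nrm_mult_diff) (use c xc in auto)
    also have "\<dots> \<le> d * nrm A y' + (nrm A y + 1) * d"
      using x nx c xc d by (intro add_mono mult_mono) (auto simp: nrm_nonneg)
    also have "\<dots> = d * K - d" by (simp add: K_def algebra_simps)
    also have "\<dots> < e" using d by simp
    finally show ?thesis using mult x by blast
  qed
  then show "y \<otimes> y' \<in> norm_closure X" using c by (simp add: norm_closure_def)
next
  fix c y assume y: "y \<in> norm_closure X"
  then have yc: "y \<in> carrier A" by (auto simp: norm_closure_def)
  have "\<exists>w\<in>X. nrm A (c \<odot> y \<ominus> w) < e" if "e > 0" for e
  proof -
    obtain x where x: "x \<in> X" "nrm A (y \<ominus> x) < e / (cmod c + 1)"
      using norm_closureD[OF y, of "e / (cmod c + 1)"] \<open>e > 0\<close> by (auto simp: add_nonneg_pos)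
    then have xc: "x \<in> carrier A" using X by auto
    have "cmod c * nrm A (y \<ominus> x) \<le> (cmod c + 1) * nrm A (y \<ominus> x)"
      using yc xc by (intro mult_right_mono) (auto simp: nrm_nonneg)
    also have "\<dots> < e" using x(2) by (simp add: pos_less_divide_eq add_nonneg_pos mult.commute)
    finally show ?thesis using smult[OF x(1), of c] nrm_smult_diff[OF yc xc, of c] by force
  qed
  then show "c \<odot> y \<in> norm_closure X" using yc by (simp add: norm_closure_def)
next
  fix y assume y: "y \<in> norm_closure X"
  then have yc: "y \<in> carrier A" by (auto simp: norm_closure_def)
  have "\<exists>w\<in>X. nrm A (star A y \<ominus> w) < e" if e: "e > 0" for e
  proof -
    obtain x where x: "x \<in> X" "nrm A (y \<ominus> x) < e"
      using norm_closureD[OF y e] by auto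
    then have xc: "x \<in> carrier A" using X by auto
    then have "nrm A (star A y \<ominus> star A x) < e"
      using x yc nrm_star[of "y \<ominus> x"] by (simp add: star_diff)
    then show ?thesis using star[OF x(1)] by blast
  qed
  then show "star A y \<in> norm_closure X" using yc by (simp add: norm_closure_def)
qed

section \<open>Invertible elements near the identity\<close>

lemma Cauchy_imp_limit:
  assumes s: "\<And>n::nat. s n \<in> carrier A"
    and c: "\<And>e. e > 0 \<Longrightarrow> \<exists>N. \<forall>m\<ge>N. \<forall>n\<ge>N. nrm A (s m \<ominus> s n) < e"
  shows "\<exists>l\<in>carrier A. \<forall>e>0. \<exists>N. \<forall>n\<ge>N. nrm A (s n \<ominus> l) < e"
proof -
  have "normed.MCauchy s"
    unfolding normed.MCauchy_def using s c by (auto simp: norm_dist_def)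
  then obtain l where "limitin normed.mtopology s l sequentially"
    using complete unfolding normed.mcomplete_def by blast
  then have l: "l \<in> carrier A"
    "\<And>e. e > 0 \<Longrightarrow> \<exists>N. \<forall>n\<ge>N. s n \<in> carrier A \<and> norm_dist A (s n) l < e"
    unfolding normed.limitin_metric eventually_sequentially by blast+
  then show ?thesis using s by (simp add: norm_dist_def) blast
qed

text \<open>Banach's fixed point theorem on the carrier. It replaces the Neumann series: the inverse of
  \<open>1 - x\<close> is the fixed point of \<open>y \<mapsto> 1 + x y\<close> (and of \<open>y \<mapsto> 1 + y x\<close>).\<close>

lemma contraction_fixpoint:
  assumes f: "\<And>y. y \<in> carrier A \<Longrightarrow> f y \<in> carrier A"
    and r: "r < 1"
    and lip: "\<And>y z. y \<in> carrier A \<Longrightarrow> z \<in> carrier A \<Longrightarrow> nrm A (f y \<ominus> f z) \<le> r * nrm A (y \<ominus> z)"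
  shows "\<exists>y\<in>carrier A. f y = y"
proof -
  define s where "s n = (f ^^ n) \<zero>" for n
  have sc: "s n \<in> carrier A" for n by (induction n) (auto simp: s_def f)
  have ssuc: "s (Suc n) = f (s n)" for n by (simp add: s_def)
  \<comment> \<open>The hypotheses allow a negative \<open>r\<close>, for which the powers of \<open>r\<close> would be of no use.\<close>
  define q where "q = max r 0"
  have q: "0 \<le> q" "q < 1" using r by (auto simp: q_def)
  have lip': "nrm A (f y \<ominus> f z) \<le> q * nrm A (y \<ominus> z)"
    if "y \<in> carrier A" "z \<in> carrier A" for y z
    using lip[OF that] mult_right_mono[of r q "nrm A (y \<ominus> z)"] that
    by (auto simp: q_def nrm_nonneg intro: order_trans)
  define D where "D = nrm A (s 1 \<ominus> s 0) / (1 - q)"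
  have D0: "0 \<le> D" using q sc by (simp add: D_def nrm_nonneg)
  have Dq: "nrm A (s 1 \<ominus> s 0) + q * D = D" using q by (simp add: D_def field_simps)
  have k: "nrm A (s k \<ominus> s 0) \<le> D" for k
  proof (induction k)
    case 0 then show ?case using sc D0 by simp
  next
    case (Suc k)
    have "nrm A (s (Suc k) \<ominus> s 0) \<le> nrm A (s (Suc k) \<ominus> s 1) + nrm A (s 1 \<ominus> s 0)"
      by (rule nrm_diff_triangle) (auto simp: sc)
    also have "nrm A (s (Suc k) \<ominus> s 1) \<le> q * nrm A (s k \<ominus> s 0)"
      using lip'[OF sc[of k] sc[of 0]] by (simp add: ssuc)
    also have "\<dots> \<le> q * D" using Suc q by (simp add: mult_left_mono)
    finally show ?case using Dq by simp
  qed
  have nk: "nrm A (s (n + k) \<ominus> s n) \<le> q ^ n * D" for n k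
  proof (induction n)
    case 0 then show ?case using k by simp
  next
    case (Suc n)
    have "nrm A (s (Suc n + k) \<ominus> s (Suc n)) \<le> q * nrm A (s (n + k) \<ominus> s n)"
      using lip'[OF sc[of "n + k"] sc[of n]] by (simp add: ssuc)
    also have "\<dots> \<le> q * (q ^ n * D)" using Suc q by (simp add: mult_left_mono)
    finally show ?case by simp
  qed
  have lim0: "(\<lambda>n. q ^ n * D) \<longlonglongrightarrow> 0"
    using q by (intro tendsto_mult_left_zero LIMSEQ_power_zero) auto
  have "\<exists>N. \<forall>m\<ge>N. \<forall>n\<ge>N. nrm A (s m \<ominus> s n) < e" if "e > 0" for e
  proof -
    obtain N where N: "\<And>n. n \<ge> N \<Longrightarrow> q ^ n * D < e"
      using order_tendstoD(2)[OF lim0 \<open>e > 0\<close>] by (auto simp: eventually_sequentially)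
    have "nrm A (s m \<ominus> s n) < e" if "m \<ge> N" "n \<ge> N" for m n
    proof (cases "n \<le> m")
      case True
      then show ?thesis using nk[of n "m - n"] N[OF that(2)] by simp
    next
      case False
      then show ?thesis using nk[of m "n - m"] N[OF that(1)] nrm_diff_commute[OF sc sc, of m n] by simp
    qed
    then show ?thesis by blast
  qed
  then obtain l where l: "l \<in> carrier A" "\<And>e. e > 0 \<Longrightarrow> \<exists>N. \<forall>n\<ge>N. nrm A (s n \<ominus> l) < e"
    using Cauchy_imp_limit[of s, OF sc] by blast
  have "nrm A (f l \<ominus> l) \<le> 0"
  proof (rule field_le_epsilon)
    fix e :: real assume e: "e > 0"
    then obtain N where N: "\<forall>n\<ge>N. nrm A (s n \<ominus> l) < e / 2"
      using l(2)[of "e / 2"] by auto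
    have "nrm A (f l \<ominus> l) \<le> nrm A (f l \<ominus> s (Suc N)) + nrm A (s (Suc N) \<ominus> l)"
      using l(1) sc f by (intro nrm_diff_triangle) auto
    also have "nrm A (f l \<ominus> s (Suc N)) \<le> q * nrm A (s N \<ominus> l)"
      using lip'[OF l(1) sc[of N]] nrm_diff_commute[OF l(1) sc[of N]] by (simp add: ssuc)
    also have "\<dots> \<le> 1 * nrm A (s N \<ominus> l)"
      using q l(1) sc by (intro mult_right_mono) (auto simp: nrm_nonneg)
    finally show "nrm A (f l \<ominus> l) \<le> 0 + e"
      using N[rule_format, of N] N[rule_format, of "Suc N"] by simp
  qed
  then have "f l = l" using nrm_diff_zero[of "f l" l] f l(1) by blast
  then show ?thesis using l(1) by blast
qed

lemma one_minus_Units: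
  assumes x: "x \<in> carrier A" and n: "nrm A x < 1"
  shows "\<one> \<ominus> x \<in> Units A"
proof -
  obtain y where y: "y \<in> carrier A" "\<one> \<oplus> x \<otimes> y = y"
  proof -
    have "nrm A ((\<one> \<oplus> x \<otimes> y) \<ominus> (\<one> \<oplus> x \<otimes> z)) \<le> nrm A x * nrm A (y \<ominus> z)"
      if "y \<in> carrier A" "z \<in> carrier A" for y z
    proof -
      have "(\<one> \<oplus> x \<otimes> y) \<ominus> (\<one> \<oplus> x \<otimes> z) = x \<otimes> (y \<ominus> z)" using that x by algebra
      then show ?thesis using nrm_mult[of x "y \<ominus> z"] that x by simp
    qed
    then show ?thesis using contraction_fixpoint[of "\<lambda>y. \<one> \<oplus> x \<otimes> y" "nrm A x"] n x that by auto
  qed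
  obtain z where z: "z \<in> carrier A" "\<one> \<oplus> z \<otimes> x = z"
  proof -
    have "nrm A ((\<one> \<oplus> y \<otimes> x) \<ominus> (\<one> \<oplus> z \<otimes> x)) \<le> nrm A x * nrm A (y \<ominus> z)"
      if "y \<in> carrier A" "z \<in> carrier A" for y z
    proof -
      have "(\<one> \<oplus> y \<otimes> x) \<ominus> (\<one> \<oplus> z \<otimes> x) = (y \<ominus> z) \<otimes> x" using that x by algebra
      then show ?thesis using nrm_mult[of "y \<ominus> z" x] that x by (simp add: mult.commute)
    qed
    then show ?thesis using contraction_fixpoint[of "\<lambda>y. \<one> \<oplus> y \<otimes> x" "nrm A x"] n x that by auto
  qed
  have "(\<one> \<ominus> x) \<otimes> y = (\<one> \<oplus> x \<otimes> y) \<ominus> x \<otimes> y" using x y(1,2) by (simp add: A.minus_eq A.l_distr A.l_minus)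
  also have "\<dots> = \<one>" using x y(1) by algebra
  finally have 1: "(\<one> \<ominus> x) \<otimes> y = \<one>" .
  have "z \<otimes> (\<one> \<ominus> x) = (\<one> \<oplus> z \<otimes> x) \<ominus> z \<otimes> x" using x z(1,2) by (simp add: A.minus_eq A.r_distr A.r_minus)
  also have "\<dots> = \<one>" using x z(1) by algebra
  finally have 2: "z \<otimes> (\<one> \<ominus> x) = \<one>" .
  have "z = y" using A.inv_unique[OF 2 1] x y(1) z(1) by simp
  then show ?thesis using 1 2 x y(1) unfolding Units_def by blast
qed

lemma inv_near_one:
  assumes a: "a \<in> Units A" and n: "nrm A (\<one> \<ominus> a) < 1"
  shows "nrm A (\<one> \<ominus> inv a) \<le> nrm A (\<one> \<ominus> a) / (1 - nrm A (\<one> \<ominus> a))"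
proof -
  have c: "a \<in> carrier A" "inv a \<in> carrier A" using a by auto
  have i: "inv a \<otimes> a = \<one>" using a by simp
  have "inv a \<otimes> (a \<ominus> \<one>) = inv a \<otimes> a \<ominus> inv a"
    using c by (simp add: A.minus_eq A.r_distr A.r_minus)
  then have "\<one> \<ominus> inv a = inv a \<otimes> (a \<ominus> \<one>)" by (simp add: i)
  then have 1: "nrm A (\<one> \<ominus> inv a) \<le> nrm A (inv a) * nrm A (\<one> \<ominus> a)"
    using nrm_mult[of "inv a" "a \<ominus> \<one>"] c nrm_diff_commute[of a \<one>] by simp
  have 2: "nrm A (inv a) \<le> 1 + nrm A (\<one> \<ominus> inv a)"
    using nrm_diff_ineq[of "inv a" \<one>] c nrm_diff_commute[of "inv a" \<one>] by simp
  define t where "t = nrm A (\<one> \<ominus> a)"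
  have "0 \<le> t" using c by (simp add: t_def nrm_nonneg)
  then have "nrm A (inv a) * t \<le> (1 + nrm A (\<one> \<ominus> inv a)) * t"
    using 2 by (rule mult_right_mono[rotated])
  then have "nrm A (\<one> \<ominus> inv a) \<le> (1 + nrm A (\<one> \<ominus> inv a)) * t" using 1 by (simp add: t_def)
  then show ?thesis using n unfolding t_def[symmetric] by (simp add: field_simps)
qed

lemma smult_Units:
  assumes "x \<in> Units A" "c \<noteq> 0"
  shows "c \<odot> x \<in> Units A"
proof -
  have "(c \<odot> x) \<otimes> ((1 / c) \<odot> inv x) = \<one>" "((1 / c) \<odot> inv x) \<otimes> (c \<odot> x) = \<one>"
    using assms by (simp_all add: smult_mult A.Units_closed)
  moreover have "c \<odot> x \<in> carrier A" "(1 / c) \<odot> inv x \<in> carrier A" using assms by auto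
  ultimately show ?thesis unfolding Units_def by blast
qed

lemma scalar_minus_Units:
  assumes x: "x \<in> carrier A" and n: "nrm A x < cmod c"
  shows "c \<odot> \<one> \<ominus> x \<in> Units A"
proof -
  have c: "c \<noteq> 0" using n nrm_nonneg[OF x] by auto
  have "\<one> \<ominus> (1 / c) \<odot> x \<in> Units A"
    using x n c by (intro one_minus_Units) (auto simp: nrm_smult norm_divide field_simps)
  then have "c \<odot> (\<one> \<ominus> (1 / c) \<odot> x) \<in> Units A" using c by (rule smult_Units)
  then show ?thesis using x c by (simp add: smult_diff_right smult_smult)
qed

section \<open>A norm bound by the spectral radius\<close>

lemma one_minus_mult_one_plus:
  assumes x: "x \<in> carrier A"
  shows "(\<one> \<ominus> x) \<otimes> (\<one> \<oplus> x) = \<one> \<ominus> x \<otimes> x" "(\<one> \<oplus> x) \<otimes> (\<one> \<ominus> x) = \<one> \<ominus> x \<otimes> x"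
  using x by (simp_all add: A.minus_eq A.l_distr A.r_distr A.l_minus A.r_minus A.minus_add
      A.a_lcomm[of x] A.a_assoc A.r_neg A.r_neg1 A.r_neg2)

text \<open>An elementary form of the spectral radius formula, with no analytic functions involved. Suppose that
  \<open>\<parallel>x\<parallel> > \<rho>\<close> and rescale \<open>x\<close> to \<open>h\<close> of norm one. Then the resolvent \<open>R\<^sub>h(z) = (1 - z h)\<^sup>-\<^sup>1\<close> exists on the
  closed unit disc, is bounded there by compactness, and is therefore Lipschitz. From
  \<open>R\<^bsub>h\<^sup>2\<^esub>(w\<^sup>2) = (R\<^sub>h(w) + R\<^sub>h(-w)) / 2\<close> it follows that a bound for \<open>\<parallel>R\<^sub>h(t z) - R\<^sub>h(z)\<parallel>\<close> which is uniform in \<open>z\<close>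
  passes unchanged to \<open>h\<^sup>2\<close> and \<open>t\<^sup>2\<close>, and so to \<open>h\<^sup>N\<close> and \<open>t\<^sup>N\<close> for every \<open>N = 2\<^sup>n\<close>. Take \<open>t < 1\<close> with
  bound \<open>1/4\<close>, and \<open>N\<close> so large that \<open>t\<^sup>N\<close> is small: then \<open>(1 - t\<^sup>N h\<^sup>N)\<^sup>-\<^sup>1\<close> is near \<open>1\<close>, hence so is
  \<open>(1 - h\<^sup>N)\<^sup>-\<^sup>1\<close>, and \<open>\<parallel>h\<^sup>N\<parallel> < 1\<close>, although \<open>\<parallel>h\<^sup>N\<parallel> = 1\<close>.\<close>

lemma nrm_le_spectral_radius:
  assumes x: "x \<in> carrier A" and rho: "0 \<le> \<rho>"
    and inv: "\<And>c. \<rho> < cmod c \<Longrightarrow> c \<odot> \<one> \<ominus> x \<in> Units A"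
    and pow: "\<And>n. nrm A (x [^] (2 ^ n :: nat)) = nrm A x ^ 2 ^ n"
  shows "nrm A x \<le> \<rho>"
proof (rule ccontr)
  assume "\<not> nrm A x \<le> \<rho>"
  define a where "a = nrm A x"
  have a: "\<rho> < a" "0 < a" using \<open>\<not> nrm A x \<le> \<rho>\<close> rho by (auto simp: a_def)
  define h where "h = complex_of_real (1 / a) \<odot> x"
  have hc: "h \<in> carrier A" using x by (simp add: h_def)
  have hpow: "h [^] n = complex_of_real (1 / a) ^ n \<odot> x [^] n" for n :: nat
    using x by (induction n) (simp_all add: h_def smult_mult mult.commute)
  have hn: "nrm A (h [^] (2 ^ n :: nat)) = 1" for n
    using x pow[of n] a by (simp add: hpow nrm_smult norm_power norm_divide power_divide a_def[symmetric])
  have hn1: "nrm A h = 1" using hn[of 0] hc by simp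
  define R where "R k z = inv (\<one> \<ominus> z \<odot> k)" for k z
  define inverts where "inverts k \<longleftrightarrow> (\<forall>z. cmod z \<le> 1 \<longrightarrow> \<one> \<ominus> z \<odot> k \<in> Units A)" for k
  have ih: "inverts h"
    unfolding inverts_def
  proof (intro allI impI)
    fix z :: complex assume z: "cmod z \<le> 1"
    show "\<one> \<ominus> z \<odot> h \<in> Units A"
    proof (cases "z = 0")
      case True then show ?thesis using hc by simp
    next
      case False
      have "\<rho> * cmod z < a"
        using mult_left_mono[OF z rho] a by simp
      then have "\<rho> < cmod (complex_of_real a / z)"
        using a False by (simp add: norm_divide pos_less_divide_eq)
      then have "(z / complex_of_real a) \<odot> ((complex_of_real a / z) \<odot> \<one> \<ominus> x) \<in> Units A"
        using inv a False by (intro smult_Units) auto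
      then show ?thesis
        using x a False by (simp add: smult_diff_right smult_smult h_def)
    qed
  qed
  have Rc: "R k z \<in> carrier A" if "inverts k" "cmod z \<le> 1" for k z
    using that by (simp add: R_def inverts_def)
  have res: "R h z \<ominus> R h w = (z - w) \<odot> (R h z \<otimes> h \<otimes> R h w)"
    if z: "cmod z \<le> 1" "cmod w \<le> 1" for z w
  proof -
    have u: "\<one> \<ominus> z \<odot> h \<in> Units A" "\<one> \<ominus> w \<odot> h \<in> Units A" using ih z by (auto simp: inverts_def)
    note c = Rc[OF ih z(1)] Rc[OF ih z(2)] hc
    have 1: "R h z \<otimes> (\<one> \<ominus> z \<odot> h) = \<one>" "(\<one> \<ominus> w \<odot> h) \<otimes> R h w = \<one>"
      using u by (simp_all add: R_def)
    have "(z - w) \<odot> (R h z \<otimes> h \<otimes> R h w) = R h z \<otimes> ((\<one> \<ominus> w \<odot> h) \<ominus> (\<one> \<ominus> z \<odot> h)) \<otimes> R h w"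
    proof -
      have "(\<one> \<ominus> w \<odot> h) \<ominus> (\<one> \<ominus> z \<odot> h) = z \<odot> h \<ominus> w \<odot> h"
        using smult_cl[OF c(3), of z] smult_cl[OF c(3), of w] by algebra
      then show ?thesis using c by (simp add: smult_diff_left[symmetric] smult_mult)
    qed
    also have "\<dots> = R h z \<otimes> ((\<one> \<ominus> w \<odot> h) \<otimes> R h w) \<ominus> (R h z \<otimes> (\<one> \<ominus> z \<odot> h)) \<otimes> R h w"
      using c(1,2) smult_cl[OF c(3), of z] smult_cl[OF c(3), of w] by algebra
    also have "\<dots> = R h z \<ominus> R h w" using c by (simp add: 1)
    finally show ?thesis ..
  qed
  have resn: "nrm A (R h z \<ominus> R h w) \<le> cmod (z - w) * nrm A (R h z) * nrm A (R h w)"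
    if z: "cmod z \<le> 1" "cmod w \<le> 1" for z w
  proof -
    note c = Rc[OF ih z(1)] Rc[OF ih z(2)] hc
    have "nrm A (R h z \<otimes> h \<otimes> R h w) \<le> nrm A (R h z \<otimes> h) * nrm A (R h w)"
      using c by (intro nrm_mult) auto
    also have "\<dots> \<le> nrm A (R h z) * nrm A (R h w)"
      using nrm_mult[OF c(1,3)] hn1 c by (intro mult_right_mono) (auto simp: nrm_nonneg)
    finally have "nrm A (R h z \<otimes> h \<otimes> R h w) \<le> nrm A (R h z) * nrm A (R h w)" .
    then show ?thesis
      using c unfolding res[OF z] by (simp add: nrm_smult mult.assoc mult_left_mono)
  qed
  obtain C where C: "\<And>z. cmod z \<le> 1 \<Longrightarrow> nrm A (R h z) \<le> C"
  proof -
    \<comment> \<open>The resolvent identity at most doubles \<open>\<parallel>R\<^sub>h(z)\<parallel>\<close> inside a ball of radius \<open>1 / (2 \<parallel>R\<^sub>h(z)\<parallel>)\<close>; finitely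
      many such balls cover the disc. The summand \<open>1\<close> keeps the denominator positive.\<close>
    define e where "e z = 1 / (2 * (nrm A (R h z) + 1))" for z
    have e0: "0 < e z" if "cmod z \<le> 1" for z
      using nrm_nonneg[OF Rc[OF ih that]] by (simp add: e_def)
    have loc: "nrm A (R h z) \<le> 2 * nrm A (R h w)"
      if z: "cmod z \<le> 1" "cmod w \<le> 1" and d: "z \<in> ball w (e w)" for z w
    proof -
      note c = Rc[OF ih z(1)] Rc[OF ih z(2)]
      have "cmod (z - w) * nrm A (R h w) \<le> e w * nrm A (R h w)"
        using d c by (intro mult_right_mono) (auto simp: dist_norm norm_minus_commute nrm_nonneg)
      also have "\<dots> \<le> 1 / 2" using nrm_nonneg[OF c(2)] by (simp add: e_def field_simps)
      finally have "nrm A (R h z) * (cmod (z - w) * nrm A (R h w)) \<le> nrm A (R h z) * (1 / 2)"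
        using nrm_nonneg[OF c(1)] by (intro mult_left_mono) auto
      then show ?thesis
        using resn[OF z] nrm_diff_ineq[OF c] by (simp add: algebra_simps)
    qed
    have "cball (0::complex) 1 \<subseteq> (\<Union>z\<in>cball 0 1. ball z (e z))" using e0 by force
    then obtain D where D: "D \<subseteq> cball (0::complex) 1" "finite D" "cball 0 1 \<subseteq> (\<Union>z\<in>D. ball z (e z))"
      by (rule compactE_image[OF compact_cball, rotated]) auto
    have "nrm A (R h z) \<le> (\<Sum>w\<in>D. 2 * nrm A (R h w))" if z: "cmod z \<le> 1" for z
    proof -
      obtain w where w: "w \<in> D" "z \<in> ball w (e w)" using D(3) z by force
      then have "cmod w \<le> 1" using D(1) by auto
      then have "nrm A (R h z) \<le> 2 * nrm A (R h w)" using loc z w by blast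
      also have "\<dots> \<le> (\<Sum>w\<in>D. 2 * nrm A (R h w))"
        using D w(1) Rc[OF ih] by (intro member_le_sum) (auto simp: nrm_nonneg)
      finally show ?thesis .
    qed
    then show ?thesis by (rule that)
  qed
  have C0: "1 \<le> C"
  proof -
    have "R h 0 = \<one>" using hc by (simp add: R_def)
    then show ?thesis using C[of 0] by simp
  qed
  \<comment> \<open>Since \<open>h\<close> has norm one, the resolvent has Lipschitz constant \<open>C\<^sup>2\<close>; this \<open>t\<close> makes the bound \<open>1/4\<close>.\<close>
  define t where "t = 1 - 1 / (4 * C\<^sup>2)"
  have "1 < 4 * C\<^sup>2" using one_le_power[OF C0, of 2] by linarith
  then have t: "0 < t" "t < 1" "1 - t = 1 / (4 * C\<^sup>2)"
    using C0 by (auto simp: t_def)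
  \<comment> \<open>\<open>(1 - w k) (1 + w k) = 1 - w\<^sup>2 k\<^sup>2\<close>, and the two factors commute and add up to \<open>2\<close>.\<close>
  have avg: "inverts (k \<otimes> k) \<and>
      (\<forall>w. cmod w \<le> 1 \<longrightarrow> R (k \<otimes> k) (w\<^sup>2) = (1/2) \<odot> (R k w \<oplus> R k (-w)))"
    if k: "inverts k" "k \<in> carrier A" for k
  proof -
    have main: "\<one> \<ominus> w\<^sup>2 \<odot> (k \<otimes> k) \<in> Units A \<and> R (k \<otimes> k) (w\<^sup>2) = (1/2) \<odot> (R k w \<oplus> R k (-w))"
      if w: "cmod w \<le> 1" for w
    proof -
      define p where "p = \<one> \<ominus> w \<odot> k"
      define q where "q = \<one> \<ominus> (-w) \<odot> k"
      have u: "p \<in> Units A" "q \<in> Units A" using k w by (auto simp: inverts_def p_def q_def)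
      have R: "R k w = inv p" "R k (-w) = inv q" by (simp_all add: R_def p_def q_def)
      have c: "p \<in> carrier A" "q \<in> carrier A" "inv p \<in> carrier A" "inv q \<in> carrier A" using u by auto
      have wk: "w \<odot> k \<in> carrier A" using k by simp
      have q': "q = \<one> \<oplus> w \<odot> k" using k by (simp add: q_def smult_uminus A.minus_eq)
      have pq: "p \<otimes> q = \<one> \<ominus> w\<^sup>2 \<odot> (k \<otimes> k)" "q \<otimes> p = \<one> \<ominus> w\<^sup>2 \<odot> (k \<otimes> k)"
      proof -
        have "p \<otimes> q = \<one> \<ominus> (w \<odot> k) \<otimes> (w \<odot> k)" "q \<otimes> p = \<one> \<ominus> (w \<odot> k) \<otimes> (w \<odot> k)"
          unfolding p_def q' using one_minus_mult_one_plus[OF wk] by blast+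
        then show "p \<otimes> q = \<one> \<ominus> w\<^sup>2 \<odot> (k \<otimes> k)" "q \<otimes> p = \<one> \<ominus> w\<^sup>2 \<odot> (k \<otimes> k)"
          using k by (simp_all add: smult_mult power2_eq_square)
      qed
      have sum: "(1/2) \<odot> (p \<oplus> q) = \<one>"
      proof -
        have "p \<oplus> q = \<one> \<oplus> \<one>" unfolding p_def q' using wk by algebra
        also have "\<dots> = 2 \<odot> \<one>" using smult_add_left[of \<one> 1 1] by simp
        finally show ?thesis by (simp add: smult_smult)
      qed
      define y where "y = (1/2) \<odot> (inv p \<oplus> inv q)"
      have yc: "y \<in> carrier A" using c by (simp add: y_def)
      have l: "y \<otimes> (p \<otimes> q) = \<one>"
      proof -
        have "(inv p \<oplus> inv q) \<otimes> (p \<otimes> q) = (inv p \<otimes> p) \<otimes> q \<oplus> (inv q \<otimes> q) \<otimes> p"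
          using A.l_distr[of "inv p" "inv q" "p \<otimes> q"] c trans[OF pq(1) pq(2)[symmetric]]
          by (simp add: A.m_assoc)
        also have "\<dots> = p \<oplus> q" using u c by (simp add: A.a_comm)
        finally show ?thesis using c sum by (simp add: y_def smult_mult)
      qed
      have U: "p \<otimes> q \<in> Units A" using u by simp
      have "y = inv (p \<otimes> q)"
        using A.inv_unique[OF l A.Units_r_inv[OF U]] yc c U by simp
      then show ?thesis
        using U unfolding R y_def[symmetric] R_def[of "k \<otimes> k"] pq(1)[symmetric] by simp
    qed
    show ?thesis
    proof (intro conjI allI impI)
      show "inverts (k \<otimes> k)"
        unfolding inverts_def
      proof (intro allI impI)
        fix z :: complex assume "cmod z \<le> 1"
        then have "cmod (csqrt z) \<le> 1" by (simp add: norm_csqrt)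
        from main[OF this] show "\<one> \<ominus> z \<odot> (k \<otimes> k) \<in> Units A" by simp
      qed
    qed (use main in blast)
  qed
  have sqpow: "h [^] (2 ^ Suc n :: nat) = h [^] (2 ^ n :: nat) \<otimes> h [^] (2 ^ n :: nat)" for n
    using hc by (simp add: A.nat_pow_mult mult_2)
  \<comment> \<open>The averaging formula passes the estimate on from \<open>h\<close> and \<open>t\<close> to their squares without loss.\<close>
  have Q: "inverts (h [^] (2 ^ n :: nat)) \<and>
      (\<forall>z. cmod z \<le> 1 \<longrightarrow> nrm A (R (h [^] (2 ^ n :: nat)) (complex_of_real (t ^ 2 ^ n) * z) \<ominus> R (h [^] (2 ^ n :: nat)) z) \<le> 1 / 4)"
    for n
  proof (induction n)
    case 0
    have "nrm A (R h (complex_of_real t * z) \<ominus> R h z) \<le> 1 / 4" if z: "cmod z \<le> 1" for z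
    proof -
      have tz: "cmod (complex_of_real t * z) \<le> 1"
        using t z by (simp add: norm_mult mult_le_one)
      have "nrm A (R h (complex_of_real t * z) \<ominus> R h z)
          \<le> cmod (complex_of_real t * z - z) * nrm A (R h (complex_of_real t * z)) * nrm A (R h z)"
        by (rule resn[OF tz z])
      also have "\<dots> \<le> (1 - t) * C * C"
      proof (intro mult_mono)
        have "complex_of_real t * z - z = complex_of_real (t - 1) * z" by (simp add: algebra_simps)
        then have "cmod (complex_of_real t * z - z) = (1 - t) * cmod z"
          using t by (simp add: norm_mult del: of_real_diff)
        then show "cmod (complex_of_real t * z - z) \<le> 1 - t"
          using t(2) z mult_left_mono[OF z, of "1 - t"] by simp
      qed (use C tz z t C0 nrm_nonneg Rc[OF ih] in auto)
      also have "\<dots> = 1 / 4" using t(3) C0 by (simp add: power2_eq_square)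
      finally show ?thesis .
    qed
    then show ?case using ih hc by simp
  next
    case (Suc n)
    define k where "k = h [^] (2 ^ n :: nat)"
    have k: "inverts k" "k \<in> carrier A" using Suc hc by (auto simp: k_def)
    define s where "s = complex_of_real (t ^ 2 ^ n)"
    have s: "cmod s \<le> 1" using t by (simp add: s_def norm_power power_le_one)
    have IH: "nrm A (R k (s * z) \<ominus> R k z) \<le> 1 / 4" if "cmod z \<le> 1" for z
      using Suc that by (simp add: k_def s_def)
    note a = avg[OF k]
    have "nrm A (R (k \<otimes> k) (s\<^sup>2 * z) \<ominus> R (k \<otimes> k) z) \<le> 1 / 4" if z: "cmod z \<le> 1" for z
    proof -
      define w where "w = csqrt z"
      have w: "cmod w \<le> 1" "w\<^sup>2 = z" using z by (auto simp: w_def norm_csqrt)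
      have sw: "cmod (s * w) \<le> 1" using s w by (simp add: norm_mult mult_le_one)
      have c: "R k w \<in> carrier A" "R k (-w) \<in> carrier A" "R k (s * w) \<in> carrier A" "R k (- (s * w)) \<in> carrier A"
        using Rc[OF k(1)] w sw by auto
      have "R (k \<otimes> k) (s\<^sup>2 * z) = (1/2) \<odot> (R k (s * w) \<oplus> R k (- (s * w)))"
        using a sw w(2) by (metis power_mult_distrib)
      moreover have "R (k \<otimes> k) z = (1/2) \<odot> (R k w \<oplus> R k (- w))"
        using a w by metis
      moreover have "nrm A ((R k (s * w) \<oplus> R k (- (s * w))) \<ominus> (R k w \<oplus> R k (- w))) \<le> 1 / 4 + 1 / 4"
        using nrm_add_diff[OF c(3,4,1,2)] IH[of w] IH[of "- w"] w by simp
      ultimately show ?thesis using c by (simp add: nrm_smult_diff)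
    qed
    moreover have "s\<^sup>2 = complex_of_real (t ^ 2 ^ Suc n)"
      by (simp add: s_def power_mult[symmetric] mult.commute)
    ultimately show ?case using a k unfolding sqpow k_def[symmetric] by simp
  qed
  obtain n where n: "t ^ 2 ^ n < 1 / 8"
  proof -
    obtain m where m: "t ^ m < 1 / 8" using real_arch_pow_inv[of "1/8" t] t by auto
    have "t ^ 2 ^ m \<le> t ^ m" using t by (intro power_decreasing) auto
    then show ?thesis using m that[of m] by simp
  qed
  define k where "k = h [^] (2 ^ n :: nat)"
  define s where "s = t ^ 2 ^ n"
  have s: "0 < s" "s < 1 / 8" using n t by (auto simp: s_def)
  have k: "inverts k" "k \<in> carrier A" "nrm A k = 1" using Q[of n] hc hn by (auto simp: k_def)
  have u: "\<one> \<ominus> complex_of_real s \<odot> k \<in> Units A" "\<one> \<ominus> k \<in> Units A"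
    using k(1)[unfolded inverts_def, rule_format, of "complex_of_real s"]
      k(1)[unfolded inverts_def, rule_format, of 1] k(2) s by simp_all
  define y where "y = R k 1"
  have y: "y = inv (\<one> \<ominus> k)" using k by (simp add: y_def R_def)
  have yU: "y \<in> Units A" "inv y = \<one> \<ominus> k" "y \<in> carrier A" using u by (auto simp: y)
  have sc: "R k (complex_of_real s) \<in> carrier A" using u by (simp add: R_def)
  have d1: "nrm A (R k (complex_of_real s) \<ominus> y) \<le> 1 / 4"
    using conjunct2[OF Q[of n], rule_format, of 1] unfolding k_def[symmetric] s_def[symmetric] y_def
    by simp
  have sk: "nrm A (\<one> \<ominus> (\<one> \<ominus> complex_of_real s \<odot> k)) = s"
  proof -
    have "\<one> \<ominus> (\<one> \<ominus> complex_of_real s \<odot> k) = complex_of_real s \<odot> k"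
      using smult_cl[OF k(2), of "complex_of_real s"] by algebra
    then show ?thesis using k s by (simp add: nrm_smult)
  qed
  have "nrm A (\<one> \<ominus> R k (complex_of_real s)) \<le> s / (1 - s)"
    using inv_near_one[OF u(1)] sk s unfolding R_def by simp
  also have "\<dots> < 1 / 4" using s by (simp add: field_simps)
  finally have d2: "nrm A (\<one> \<ominus> y) < 1 / 2"
    using nrm_diff_triangle[OF A.one_closed sc yU(3)] d1 by simp
  have "nrm A (\<one> \<ominus> inv y) \<le> nrm A (\<one> \<ominus> y) / (1 - nrm A (\<one> \<ominus> y))"
    using d2 by (intro inv_near_one yU) simp
  also have "\<dots> < 1" using d2 by (simp add: field_simps)
  finally have "nrm A (\<one> \<ominus> inv y) < 1" .
  moreover have "\<one> \<ominus> inv y = k" unfolding yU(2) using k(2) by algebra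
  ultimately show False using k(3) by simp
qed

text \<open>For the self-adjoint element \<open>x* x\<close>, the C*-identity makes the norm multiplicative along repeated
  squaring.\<close>

lemma nrm_le_of_spectral_bound:
  assumes x: "x \<in> carrier A" and b: "0 \<le> b"
    and inv: "\<And>c. b\<^sup>2 < cmod c \<Longrightarrow> c \<odot> \<one> \<ominus> star A x \<otimes> x \<in> Units A"
  shows "nrm A x \<le> b"
proof -
  define h where "h = star A x \<otimes> x"
  have h: "h \<in> carrier A" "star A h = h" using x by (auto simp: h_def star_mult star_star)
  have sa: "star A (h [^] n) = h [^] n" for n :: nat
  proof (induction n)
    case (Suc n)
    then show ?case using h A.nat_pow_Suc2[OF h(1)] by (simp add: star_mult)
  qed simp
  have "nrm A (h [^] (2 ^ n :: nat)) = nrm A h ^ 2 ^ n" for n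
  proof (induction n)
    case (Suc n)
    have "h [^] (2 ^ Suc n :: nat) = star A (h [^] (2 ^ n :: nat)) \<otimes> h [^] (2 ^ n :: nat)"
      using h by (simp add: sa A.nat_pow_mult mult_2)
    then have "nrm A (h [^] (2 ^ Suc n :: nat)) = (nrm A (h [^] (2 ^ n :: nat)))\<^sup>2"
      using cstar_identity[of "h [^] (2 ^ n :: nat)"] h by simp
    then show ?case using Suc by (simp add: power_mult[symmetric] mult.commute)
  qed (use h in simp)
  then have "nrm A h \<le> b\<^sup>2"
    using nrm_le_spectral_radius[OF h(1), of "b\<^sup>2"] inv by (simp add: h_def)
  then have "(nrm A x)\<^sup>2 \<le> b\<^sup>2" using cstar_identity[OF x] by (simp add: h_def)
  then show ?thesis using b by (rule power2_le_imp_le)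
qed

end

section \<open>Unital *-homomorphisms\<close>

lemma star_hom_simps:
  assumes "\<Phi> \<in> star_hom A B"
  shows "x \<in> carrier A \<Longrightarrow> \<Phi> x \<in> carrier B"
    "x \<in> carrier A \<Longrightarrow> y \<in> carrier A \<Longrightarrow> \<Phi> (x \<otimes>\<^bsub>A\<^esub> y) = \<Phi> x \<otimes>\<^bsub>B\<^esub> \<Phi> y"
    "x \<in> carrier A \<Longrightarrow> y \<in> carrier A \<Longrightarrow> \<Phi> (x \<oplus>\<^bsub>A\<^esub> y) = \<Phi> x \<oplus>\<^bsub>B\<^esub> \<Phi> y"
    "\<Phi> \<one>\<^bsub>A\<^esub> = \<one>\<^bsub>B\<^esub>"
    "x \<in> carrier A \<Longrightarrow> \<Phi> (c \<odot>\<^bsub>A\<^esub> x) = c \<odot>\<^bsub>B\<^esub> \<Phi> x"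
    "x \<in> carrier A \<Longrightarrow> \<Phi> (star A x) = star B (\<Phi> x)"
    "\<Phi> \<in> extensional (carrier A)"
  using assms by (auto simp: star_hom_def ring_hom_def)

lemma star_hom_diff:
  assumes A: "normed_star_algebra A" and B: "normed_star_algebra B" and \<Phi>: "\<Phi> \<in> star_hom A B"
    and x: "x \<in> carrier A" "y \<in> carrier A"
  shows "\<Phi> (x \<ominus>\<^bsub>A\<^esub> y) = \<Phi> x \<ominus>\<^bsub>B\<^esub> \<Phi> y"
proof -
  interpret A: normed_star_algebra A by fact
  interpret B: normed_star_algebra B by fact
  show ?thesis
    using x star_hom_simps[OF \<Phi>] by (simp add: a_minus_def A.smult_minus1[symmetric] B.smult_minus1[symmetric])
qed

text \<open>Homomorphisms preserve invertibility, so the spectrum of \<open>\<Phi>(x* x)\<close> lies in the disc of radius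
  \<open>\<parallel>x* x\<parallel>\<close>, and the norm of \<open>\<Phi>(x* x)\<close> is bounded by its spectral radius.\<close>

lemma star_hom_contractive:
  assumes A: "unital_cstar_algebra A" and B: "unital_cstar_algebra B" and \<Phi>: "\<Phi> \<in> star_hom A B"
    and x: "x \<in> carrier A"
  shows "nrm B (\<Phi> x) \<le> nrm A x"
proof -
  interpret A: unital_cstar_algebra A by fact
  interpret B: unital_cstar_algebra B by fact
  note h = star_hom_simps[OF \<Phi>]
  show ?thesis
  proof (rule B.nrm_le_of_spectral_bound)
    fix c :: complex assume c: "(nrm A x)\<^sup>2 < cmod c"
    let ?k = "star A x \<otimes>\<^bsub>A\<^esub> x"
    have "c \<odot>\<^bsub>A\<^esub> \<one>\<^bsub>A\<^esub> \<ominus>\<^bsub>A\<^esub> ?k \<in> Units A"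
      using c x by (intro A.scalar_minus_Units) (auto simp: A.cstar_identity)
    then obtain y where y: "y \<in> carrier A" "y \<otimes>\<^bsub>A\<^esub> (c \<odot>\<^bsub>A\<^esub> \<one>\<^bsub>A\<^esub> \<ominus>\<^bsub>A\<^esub> ?k) = \<one>\<^bsub>A\<^esub>"
      "(c \<odot>\<^bsub>A\<^esub> \<one>\<^bsub>A\<^esub> \<ominus>\<^bsub>A\<^esub> ?k) \<otimes>\<^bsub>A\<^esub> y = \<one>\<^bsub>A\<^esub>"
      unfolding Units_def by blast
    have im: "\<Phi> (c \<odot>\<^bsub>A\<^esub> \<one>\<^bsub>A\<^esub> \<ominus>\<^bsub>A\<^esub> ?k) = c \<odot>\<^bsub>B\<^esub> \<one>\<^bsub>B\<^esub> \<ominus>\<^bsub>B\<^esub> star B (\<Phi> x) \<otimes>\<^bsub>B\<^esub> \<Phi> x"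
      using x h star_hom_diff[OF A.normed_star_algebra_axioms B.normed_star_algebra_axioms \<Phi>] by simp
    have kc: "c \<odot>\<^bsub>A\<^esub> \<one>\<^bsub>A\<^esub> \<ominus>\<^bsub>A\<^esub> ?k \<in> carrier A" using x by simp
    have "\<Phi> y \<in> carrier B" "\<Phi> y \<otimes>\<^bsub>B\<^esub> \<Phi> (c \<odot>\<^bsub>A\<^esub> \<one>\<^bsub>A\<^esub> \<ominus>\<^bsub>A\<^esub> ?k) = \<one>\<^bsub>B\<^esub>"
      "\<Phi> (c \<odot>\<^bsub>A\<^esub> \<one>\<^bsub>A\<^esub> \<ominus>\<^bsub>A\<^esub> ?k) \<otimes>\<^bsub>B\<^esub> \<Phi> y = \<one>\<^bsub>B\<^esub>"
      using y kc h by (metis, metis, metis)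
    then show "c \<odot>\<^bsub>B\<^esub> \<one>\<^bsub>B\<^esub> \<ominus>\<^bsub>B\<^esub> star B (\<Phi> x) \<otimes>\<^bsub>B\<^esub> \<Phi> x \<in> Units B"
      using h(1)[OF kc] unfolding Units_def im by blast
  qed (use x h A.nrm_nonneg in auto)
qed

lemma cstar_subalgebra_equalizer:
  assumes A: "unital_cstar_algebra A" and B: "unital_cstar_algebra B"
    and \<Phi>: "\<Phi> \<in> star_hom A B" and \<Psi>: "\<Psi> \<in> star_hom A B"
  shows "cstar_subalgebra A {x \<in> carrier A. \<Phi> x = \<Psi> x}"
proof -
  interpret A: unital_cstar_algebra A by fact
  interpret B: unital_cstar_algebra B by fact
  note h = star_hom_simps[OF \<Phi>] star_hom_simps[OF \<Psi>]
  have "\<Phi> y = \<Psi> y" if y: "y \<in> A.norm_closure {x \<in> carrier A. \<Phi> x = \<Psi> x}" for y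
  proof -
    have yc: "y \<in> carrier A" using y by (simp add: A.norm_closure_def)
    have "nrm B (\<Phi> y \<ominus>\<^bsub>B\<^esub> \<Psi> y) \<le> 0 + e" if "e > 0" for e
    proof -
      obtain x where x: "x \<in> carrier A" "\<Phi> x = \<Psi> x" "nrm A (y \<ominus>\<^bsub>A\<^esub> x) < e / 2"
        using A.norm_closureD[OF y, of "e / 2"] \<open>e > 0\<close> by auto
      have "nrm B (\<Phi> y \<ominus>\<^bsub>B\<^esub> \<Psi> y) \<le> nrm B (\<Phi> y \<ominus>\<^bsub>B\<^esub> \<Phi> x) + nrm B (\<Psi> x \<ominus>\<^bsub>B\<^esub> \<Psi> y)"
        using B.nrm_diff_triangle[of "\<Phi> y" "\<Phi> x" "\<Psi> y"] h x yc by simp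
      also have "nrm B (\<Phi> y \<ominus>\<^bsub>B\<^esub> \<Phi> x) \<le> nrm A (y \<ominus>\<^bsub>A\<^esub> x)"
        using star_hom_contractive[OF A B \<Phi>, of "y \<ominus>\<^bsub>A\<^esub> x"] x yc
          star_hom_diff[OF A.normed_star_algebra_axioms B.normed_star_algebra_axioms \<Phi>] by simp
      also have "nrm B (\<Psi> x \<ominus>\<^bsub>B\<^esub> \<Psi> y) \<le> nrm A (y \<ominus>\<^bsub>A\<^esub> x)"
        using star_hom_contractive[OF A B \<Psi>, of "x \<ominus>\<^bsub>A\<^esub> y"] x yc A.nrm_diff_commute[of x y]
          star_hom_diff[OF A.normed_star_algebra_axioms B.normed_star_algebra_axioms \<Psi>] by simp
      finally show ?thesis using x by simp
    qed
    then have "nrm B (\<Phi> y \<ominus>\<^bsub>B\<^esub> \<Psi> y) \<le> 0" by (rule field_le_epsilon)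
    then show ?thesis by (rule B.nrm_diff_zero[OF h(1)[OF yc] h(8)[OF yc]])
  qed
  then have "A.norm_closure {x \<in> carrier A. \<Phi> x = \<Psi> x} \<subseteq> {x \<in> carrier A. \<Phi> x = \<Psi> x}"
    by (auto simp: A.norm_closure_def)
  then show ?thesis
    unfolding A.cstar_subalgebra_iff
    by (intro conjI ballI allI) (simp_all only: mem_Collect_eq, auto simp: h(2-6) h(9-13))
qed

lemma star_hom_eq_on_generated:
  assumes A: "unital_cstar_algebra A" and B: "unital_cstar_algebra B"
    and \<Phi>: "\<Phi> \<in> star_hom A B" and \<Psi>: "\<Psi> \<in> star_hom A B"
    and X: "X \<subseteq> carrier A" and eq: "\<And>x. x \<in> X \<Longrightarrow> \<Phi> x = \<Psi> x"
    and y: "y \<in> cstar_generated A X"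
  shows "\<Phi> y = \<Psi> y"
proof -
  interpret A: unital_cstar_algebra A by fact
  have "cstar_generated A X \<subseteq> {x \<in> carrier A. \<Phi> x = \<Psi> x}"
    by (rule A.cstar_generated_least[OF cstar_subalgebra_equalizer[OF A B \<Phi> \<Psi>]]) (use X eq in auto)
  then show ?thesis using y by blast
qed

section \<open>Laurent polynomials in a unitary\<close>

text \<open>The \<open>K\<close>-th roots of a point of the circle are spaced by the angle \<open>2 \<pi> / K\<close>. This is used twice:
  for the density of the spectrum of \<open>U\<close> in the circle, and for finding points near a given one at
  which a high power equals \<open>-1\<close>.\<close>

lemma circle_root_near:
  assumes z0: "cmod z0 = 1" and \<mu>: "cmod \<mu> = 1" and K: "(K::nat) > 0"
  shows "\<exists>z. cmod z = 1 \<and> z ^ K = \<mu> \<and> cmod (z - z0) \<le> 2 * pi / K"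
proof -
  obtain a where a: "z0 = cis a" using z0 complex_norm_eq_1_exp[of z0] by (metis cis_conv_exp)
  obtain b where b: "\<mu> = cis b" using \<mu> complex_norm_eq_1_exp[of \<mu>] by (metis cis_conv_exp)
  define l where "l = \<lfloor>(a * K - b) / (2 * pi)\<rfloor>"
  define t where "t = (b + 2 * pi * of_int l) / K"
  have l: "2 * pi * of_int l \<le> a * K - b" "a * K - b < 2 * pi * of_int l + 2 * pi"
    using floor_divide_lower[of "2 * pi" "a * K - b"] floor_divide_upper[of "2 * pi" "a * K - b"]
    by (simp_all add: l_def algebra_simps)
  have "\<bar>a - t\<bar> \<le> 2 * pi / K"
  proof -
    have "(a - t) * K = a * K - b - 2 * pi * of_int l" using K by (simp add: t_def field_simps)
    then have "0 \<le> (a - t) * K" "(a - t) * K \<le> 2 * pi" using l by auto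
    then show ?thesis using K by (simp add: zero_le_mult_iff field_simps)
  qed
  moreover have "cmod (cis t - cis a) \<le> \<bar>a - t\<bar>"
  proof -
    have "cis t - cis a = cis a * (cis (t - a) - 1)" by (simp add: cis_mult algebra_simps)
    then have "cmod (cis t - cis a) = cmod (cis (t - a) - 1)" by (simp add: norm_mult)
    also have "\<dots> = 2 * \<bar>sin ((t - a) / 2)\<bar>" unfolding cis_conv_exp by (rule dist_exp_i_1)
    also have "\<dots> \<le> 2 * \<bar>(t - a) / 2\<bar>" by (intro mult_left_mono abs_sin_x_le_abs_x) auto
    finally show ?thesis by simp
  qed
  moreover have "cis t ^ K = \<mu>"
  proof -
    have "real K * t = b + 2 * pi * of_int l" using K by (simp add: t_def)
    then have "cis t ^ K = cis (b + 2 * pi * of_int l)" using Complex.DeMoivre[of t K] by simp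
    also have "\<dots> = \<mu>" by (simp add: b cis_mult[symmetric] cis_multiple_2pi)
    finally show ?thesis .
  qed
  ultimately show ?thesis unfolding a by (intro exI[of _ "cis t"]) auto
qed

locale unitary_element = unital_cstar_algebra A for A :: "'a cstar_alg" (structure) +
  fixes U :: 'a
  assumes unitary: "is_unitary A U"
begin

lemma U_closed [simp, intro]: "U \<in> carrier A"
  and starU_U [simp]: "star A U \<otimes> U = \<one>"
  and U_starU [simp]: "U \<otimes> star A U = \<one>"
  using unitary by (auto simp: is_unitary_def)

definition upow :: "int \<Rightarrow> 'a" where
  "upow k = (if 0 \<le> k then U [^] nat k else star A U [^] nat (- k))"

lemma upow_closed [simp, intro]: "upow k \<in> carrier A"
  by (simp add: upow_def del: pow_nat)

lemma upow_0 [simp]: "upow 0 = \<one>" and upow_1 [simp]: "upow 1 = U"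
  and upow_minus_1 [simp]: "upow (-1) = star A U"
  by (simp_all add: upow_def)

lemma upow_plus_1: "upow (k + 1) = upow k \<otimes> U"
proof (cases "0 \<le> k")
  case True then show ?thesis by (simp add: upow_def nat_add_distrib del: pow_nat)
next
  case False
  define m where "m = nat (- (k + 1))"
  have "nat (- k) = Suc m" "- k - 1 = int m" using False by (auto simp: m_def)
  moreover have "upow (k + 1) = star A U [^] m"
    using False by (auto simp: upow_def m_def simp del: pow_nat)
  ultimately show ?thesis using False by (simp add: upow_def A.m_assoc del: pow_nat)
qed

lemma upow_minus1: "upow (k - 1) = upow k \<otimes> star A U"
  using upow_plus_1[of "k - 1"] by (simp add: A.m_assoc)

lemma upow_add: "upow (j + k) = upow j \<otimes> upow k"
proof (induction k rule: int_induct[of _ 0])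
  case (step1 i)
  have "upow (j + (i + 1)) = upow (j + i) \<otimes> U" using upow_plus_1[of "j + i"] by (simp add: add.assoc)
  then show ?case using step1 by (simp add: upow_plus_1 A.m_assoc)
next
  case (step2 i)
  have "upow (j + (i - 1)) = upow (j + i) \<otimes> star A U" using upow_minus1[of "j + i"] by (simp add: add_diff_eq)
  then show ?case using step2 by (simp add: upow_minus1 A.m_assoc)
qed simp

lemma upow_commute: "upow j \<otimes> upow k = upow k \<otimes> upow j"
  by (metis upow_add add.commute)

lemma upow_inverse [simp]: "upow k \<otimes> upow (- k) = \<one>" "upow (- k) \<otimes> upow k = \<one>"
  by (simp_all add: upow_add[symmetric])

lemma star_upow: "star A (upow k) = upow (- k)"
proof (induction k rule: int_induct[of _ 0])
  case (step1 i)
  have "star A (upow (i + 1)) = upow (-1) \<otimes> upow (- i)" using step1 by (simp add: upow_plus_1 star_mult)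
  moreover have "- (i + 1) = -1 + - i" by simp
  ultimately show ?case by (simp only: upow_add)
next
  case (step2 i)
  then have "star A (upow (i - 1)) = upow 1 \<otimes> upow (- i)" by (simp add: upow_minus1 star_mult star_star)
  then show ?case using upow_add[of 1 "- i"] by simp
qed simp

lemma unitary_upow: "is_unitary A (upow k)"
  by (simp add: is_unitary_def star_upow)

lemma upow_Units: "upow k \<in> Units A"
  using upow_inverse[of k] upow_closed[of k] upow_closed[of "- k"] unfolding Units_def by blast

text \<open>Since \<open>\<parallel>U\<parallel> = \<parallel>U*\<parallel> = 1\<close>, both \<open>c - U\<close> for \<open>|c| > 1\<close> and \<open>1 - c U*\<close> for \<open>|c| < 1\<close> are invertible.\<close>

lemma off_circle_Units:
  assumes "cmod c \<noteq> 1" shows "c \<odot> \<one> \<ominus> U \<in> Units A"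
proof (cases "cmod c > 1")
  case True
  then show ?thesis by (intro scalar_minus_Units) (auto simp: nrm_unitary[OF unitary])
next
  case False
  then have c: "cmod c < 1" using assms by simp
  have 1: "\<one> \<ominus> c \<odot> star A U \<in> Units A"
    using c by (intro one_minus_Units) (auto simp: nrm_smult nrm_unitary[OF unitary])
  have 2: "(-1) \<odot> U \<in> Units A" using smult_Units[of U "-1"] upow_Units[of 1] by simp
  have "((-1) \<odot> U) \<otimes> (\<one> \<ominus> c \<odot> star A U) = c \<odot> \<one> \<ominus> U"
    by (simp add: A.minus_eq A.r_distr smult_mult smult_minus_right smult_minus1 smult_uminus A.r_minus A.l_minus A.a_comm)
  then show ?thesis using A.Units_m_closed[OF 2 1] by simp
qed

text \<open>\<open>laurent f x\<close>: on the circle \<open>f\<close> is a Laurent polynomial, and \<open>x\<close> is its value at \<open>U\<close>. Only the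
  values of \<open>f\<close> on the circle matter, so that complex conjugation corresponds to the adjoint.\<close>

inductive laurent :: "(complex \<Rightarrow> complex) \<Rightarrow> 'a \<Rightarrow> bool" where
  mono: "(\<And>z. cmod z = 1 \<Longrightarrow> f z = c * z powi k) \<Longrightarrow> laurent f (c \<odot> upow k)"
| add: "laurent f x \<Longrightarrow> laurent g y \<Longrightarrow> (\<And>z. cmod z = 1 \<Longrightarrow> h z = f z + g z) \<Longrightarrow> laurent h (x \<oplus> y)"

lemma laurent_closed: "laurent f x \<Longrightarrow> x \<in> carrier A"
  by (induction rule: laurent.induct) auto

lemma laurent_cong: "laurent f x \<Longrightarrow> (\<And>z. cmod z = 1 \<Longrightarrow> f z = g z) \<Longrightarrow> laurent g x"
proof (induction rule: laurent.induct)
  case (mono f c k) then show ?case by (intro laurent.mono) auto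
next
  case (add f x g' y h) then show ?case using laurent.add[OF add(1,2), of g] by simp
qed

lemma laurent_const: "laurent (\<lambda>z. c) (c \<odot> \<one>)"
  using laurent.mono[of "\<lambda>z. c" c 0] by simp

lemma laurent_upow: "laurent (\<lambda>z. z powi k) (upow k)"
  using laurent.mono[of "\<lambda>z. z powi k" 1 k] by simp

lemma laurent_add: "laurent f x \<Longrightarrow> laurent g y \<Longrightarrow> laurent (\<lambda>z. f z + g z) (x \<oplus> y)"
  by (rule laurent.add) auto

lemma laurent_smult: "laurent f x \<Longrightarrow> laurent (\<lambda>z. c * f z) (c \<odot> x)"
proof (induction rule: laurent.induct)
  case (mono f a k)
  then show ?case using laurent.mono[of "\<lambda>z. c * f z" "c * a" k] by (simp add: smult_smult)
next
  case (add f x g y h)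
  then show ?case
    using laurent.add[OF add(4,5), of "\<lambda>z. c * h z"] laurent_closed by (simp add: smult_add_right algebra_simps)
qed

lemma laurent_diff: "laurent f x \<Longrightarrow> laurent g y \<Longrightarrow> laurent (\<lambda>z. f z - g z) (x \<ominus> y)"
  using laurent_add[of f x "\<lambda>z. (-1) * g z" "(-1) \<odot> y"] laurent_smult[of g y "-1"] laurent_closed[of g y]
  by (simp add: smult_minus1 A.minus_eq)

lemma laurent_star: "laurent f x \<Longrightarrow> laurent (\<lambda>z. cnj (f z)) (star A x)"
proof (induction rule: laurent.induct)
  case (mono f a k)
  have "cnj (f z) = cnj a * z powi (- k)" if z: "cmod z = 1" for z
  proof -
    have "z * cnj z = 1" using z by (simp add: complex_norm_square[symmetric])
    then have "cnj z = inverse z" using inverse_unique by metis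
    then show ?thesis using mono[OF z] by (simp add: power_int_minus power_int_inverse)
  qed
  then show ?case using laurent.mono[of "\<lambda>z. cnj (f z)" "cnj a" "- k"] by (simp add: star_smult star_upow)
next
  case (add f x g y h)
  then show ?case
    using laurent.add[OF add(4,5), of "\<lambda>z. cnj (h z)"] laurent_closed by (simp add: star_add)
qed

lemma laurent_mult_upow: "laurent g y \<Longrightarrow> laurent (\<lambda>z. z powi k * g z) (upow k \<otimes> y)"
proof (induction rule: laurent.induct)
  case (mono g b j)
  have "z powi k * g z = b * z powi (k + j)" if z: "cmod z = 1" for z
    using mono[OF z] z by (subst power_int_add) auto
  then show ?case using laurent.mono[of "\<lambda>z. z powi k * g z" b "k + j"] by (simp add: smult_mult upow_add)
next
  case (add f x g y h)
  then show ?case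
    using laurent.add[OF add(4,5), of "\<lambda>z. z powi k * h z"] laurent_closed by (simp add: A.r_distr algebra_simps)
qed

lemma laurent_mult:
  assumes f: "laurent f x" and g: "laurent g y"
  shows "laurent (\<lambda>z. f z * g z) (x \<otimes> y)"
  using f
proof (induction rule: laurent.induct)
  case (mono f a k)
  have "laurent (\<lambda>z. a * (z powi k * g z)) (a \<odot> (upow k \<otimes> y))"
    by (intro laurent_smult laurent_mult_upow g)
  then have "laurent (\<lambda>z. f z * g z) (a \<odot> (upow k \<otimes> y))"
    by (rule laurent_cong) (simp add: mono)
  then show ?case using laurent_closed[OF g] by (simp add: smult_mult)
next
  case (add f x g' y' h)
  then show ?case
    using laurent.add[OF add(4,5), of "\<lambda>z. h z * g z"] laurent_closed laurent_closed[OF g]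
    by (simp add: A.l_distr algebra_simps)
qed

lemma laurent_continuous: "laurent f x \<Longrightarrow> continuous_on (sphere 0 1) f"
proof (induction rule: laurent.induct)
  case (mono f c k)
  have "continuous_on (sphere 0 1) (\<lambda>z::complex. c * z powi k)"
    by (intro continuous_intros) auto
  then show ?case by (rule continuous_on_cong[THEN iffD1, rotated -1]) (auto simp: mono)
next
  case (add f x g y h)
  have "continuous_on (sphere 0 1) (\<lambda>z. f z + g z)"
    using add by (intro continuous_intros) auto
  then show ?case by (rule continuous_on_cong[THEN iffD1, rotated -1]) (auto simp: add)
qed

section \<open>Norms of Laurent polynomials in a unitary\<close>

definition peval :: "complex poly \<Rightarrow> 'a" where
  "peval p = fold_coeffs (\<lambda>a x. a \<odot> \<one> \<oplus> U \<otimes> x) p \<zero>"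

lemma peval_0 [simp]: "peval 0 = \<zero>"
  by (simp add: peval_def)

lemma peval_pCons: "peval (pCons a p) = a \<odot> \<one> \<oplus> U \<otimes> peval p"
  by (cases "a = 0 \<and> p = 0") (auto simp: peval_def)

lemma peval_closed [simp, intro]: "peval p \<in> carrier A"
  by (induction p) (auto simp: peval_pCons)

lemma peval_add: "peval (p + q) = peval p \<oplus> peval q"
proof (induction p q rule: poly_induct2)
  case (pCons a p b q)
  then show ?case by (simp add: peval_pCons smult_add_left A.r_distr A.a_ac)
qed simp

lemma peval_smult: "peval (Polynomial.smult c p) = c \<odot> peval p"
  by (induction p) (auto simp: peval_pCons smult_add_right smult_mult)

lemma peval_mult: "peval (p * q) = peval p \<otimes> peval q"
proof (induction p)
  case (pCons a p)
  have "peval (pCons a p * q) = a \<odot> peval q \<oplus> U \<otimes> (peval p \<otimes> peval q)"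
    using pCons by (simp add: peval_add peval_smult peval_pCons)
  then show ?case by (simp add: peval_pCons A.l_distr smult_mult A.m_assoc)
qed simp

lemma peval_monom: "peval (monom c n) = c \<odot> upow (int n)"
proof (induction n)
  case 0 then show ?case by (simp add: monom_0 peval_pCons)
next
  case (Suc n)
  have "upow (int (Suc n)) = U \<otimes> upow (int n)" using upow_add[of 1 "int n"] by simp
  then show ?case using Suc by (simp add: monom_Suc peval_pCons smult_mult)
qed

text \<open>The polynomial splits into linear factors \<open>z - a\<close> with \<open>a\<close> off the circle, and \<open>U - a\<close> is invertible for
  each of them.\<close>

lemma peval_Units:
  assumes "\<And>z. cmod z = 1 \<Longrightarrow> poly p z \<noteq> 0"
  shows "peval p \<in> Units A"
  using assms
proof (induction "degree p" arbitrary: p)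
  case 0
  then obtain c where p: "p = [:c:]" by (metis degree_eq_zeroE)
  then have "c \<noteq> 0" using 0(2)[of 1] by simp
  then show ?case using smult_Units[of \<one> c] by (simp add: p peval_pCons)
next
  case (Suc n)
  have "\<not> constant (poly p)" using Suc(2) constant_degree[of p] by simp
  then obtain a where a: "poly p a = 0" using fundamental_theorem_of_algebra by blast
  then obtain q where q: "p = [:-a, 1:] * q" by (metis dvdE poly_eq_0_iff_dvd)
  have "q \<noteq> 0" using Suc(2) q by auto
  then have d: "degree p = Suc (degree q)" unfolding q by (subst degree_mult_eq) auto
  have qz: "poly q z \<noteq> 0" if "cmod z = 1" for z using Suc(3)[OF that] q by auto
  have "cmod a \<noteq> 1" using Suc(3) a by blast
  then have "(-1) \<odot> (a \<odot> \<one> \<ominus> U) \<in> Units A" by (intro smult_Units off_circle_Units) auto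
  moreover have "(-1) \<odot> (a \<odot> \<one> \<ominus> U) = peval [:-a, 1:]"
    by (simp add: peval_pCons smult_diff_right smult_smult smult_minus1 smult_uminus A.minus_eq A.minus_add)
  moreover have "peval q \<in> Units A" using Suc(1)[OF _ qz] Suc(2) d by simp
  moreover have "peval p = peval [:-a, 1:] \<otimes> peval q" unfolding q by (rule peval_mult)
  ultimately show ?case by (metis A.Units_m_closed)
qed

lemma laurent_poly:
  "laurent f x \<Longrightarrow> \<exists>n p. upow (int n) \<otimes> x = peval p \<and> (\<forall>z. cmod z = 1 \<longrightarrow> poly p z = z ^ n * f z)"
proof (induction rule: laurent.induct)
  case (mono f c k)
  define n m where "n = nat (- k)" and "m = nat k"
  have nm: "int n + k = int m" by (simp add: n_def m_def)
  have "z ^ m = z ^ n * z powi k" if "cmod z = 1" for z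
  proof -
    have "z \<noteq> 0" using that by auto
    then have "z powi (int n + k) = z powi int n * z powi k" by (simp add: power_int_add)
    then show ?thesis by (simp add: nm)
  qed
  then have "\<forall>z. cmod z = 1 \<longrightarrow> poly (monom c m) z = z ^ n * f z" by (simp add: mono poly_monom)
  moreover have "upow (int n) \<otimes> (c \<odot> upow k) = peval (monom c m)"
    by (simp add: smult_mult peval_monom upow_add[symmetric] nm)
  ultimately show ?case by blast
next
  case (add f x g y h)
  obtain n p where p: "upow (int n) \<otimes> x = peval p" "\<And>z. cmod z = 1 \<Longrightarrow> poly p z = z ^ n * f z" using add by blast
  obtain m q where q: "upow (int m) \<otimes> y = peval q" "\<And>z. cmod z = 1 \<Longrightarrow> poly q z = z ^ m * g z" using add by blast
  note c = laurent_closed[OF add(1)] laurent_closed[OF add(2)]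
  define r where "r = monom 1 m * p + monom 1 n * q"
  have "upow (int (n + m)) \<otimes> (x \<oplus> y) = upow (int m) \<otimes> (upow (int n) \<otimes> x) \<oplus> upow (int n) \<otimes> (upow (int m) \<otimes> y)"
    using c upow_add[of "int n" "int m"] upow_add[of "int m" "int n"]
    by (simp add: A.r_distr A.m_assoc[symmetric] upow_commute)
  also have "\<dots> = peval r" by (simp add: p q r_def peval_add peval_mult peval_monom)
  finally have "upow (int (n + m)) \<otimes> (x \<oplus> y) = peval r" .
  moreover have "\<forall>z. cmod z = 1 \<longrightarrow> poly r z = z ^ (n + m) * h z"
    by (simp add: r_def poly_monom p q add power_add algebra_simps)
  ultimately show ?case by blast
qed

lemma laurent_Units:
  assumes f: "laurent f x" and nz: "\<And>z. cmod z = 1 \<Longrightarrow> f z \<noteq> 0"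
  shows "x \<in> Units A"
proof -
  obtain n p where p: "upow (int n) \<otimes> x = peval p" "\<And>z. cmod z = 1 \<Longrightarrow> poly p z = z ^ n * f z"
    using laurent_poly[OF f] by blast
  have "poly p z \<noteq> 0" if "cmod z = 1" for z using nz[OF that] p(2)[OF that] that by auto
  then have "upow (- int n) \<otimes> peval p \<in> Units A" by (intro A.Units_m_closed upow_Units peval_Units)
  then show ?thesis using laurent_closed[OF f] by (simp add: p(1)[symmetric] A.m_assoc[symmetric])
qed

text \<open>The norm of \<open>f(U)\<close> is bounded through the spectrum of \<open>f(U)* f(U)\<close>: for \<open>|c| > b\<^sup>2\<close> the Laurent
  polynomial \<open>c - |f|\<^sup>2\<close> has no zero on the circle, so its value at \<open>U\<close> is invertible.\<close>

lemma laurent_nrm_le: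
  assumes f: "laurent f x" and b: "\<And>z. cmod z = 1 \<Longrightarrow> cmod (f z) \<le> b"
  shows "nrm A x \<le> b"
proof (rule nrm_le_of_spectral_bound)
  show "x \<in> carrier A" by (rule laurent_closed[OF f])
  show "0 \<le> b" using order_trans[OF norm_ge_zero b[of 1]] by simp
  fix c :: complex assume c: "b\<^sup>2 < cmod c"
  have l: "laurent (\<lambda>z. c - cnj (f z) * f z) (c \<odot> \<one> \<ominus> star A x \<otimes> x)"
    by (intro laurent_diff laurent_const laurent_mult laurent_star f)
  show "c \<odot> \<one> \<ominus> star A x \<otimes> x \<in> Units A"
  proof (rule laurent_Units[OF l])
    fix z assume z: "cmod z = 1"
    have "cmod (cnj (f z) * f z) \<le> b\<^sup>2"
      using power_mono[OF b[OF z], of 2] by (simp add: norm_mult power2_eq_square)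
    then show "c - cnj (f z) * f z \<noteq> 0" using c by auto
  qed
qed

text \<open>On the circle \<open>Re z\<close> and \<open>Im z\<close> are combinations of \<open>z\<close> and \<open>1/z\<close>. This turns the polynomial
  approximations given by the Stone--Weierstrass theorem into Laurent polynomials.\<close>

lemma laurent_real_polynomial:
  "real_polynomial_function h \<Longrightarrow> \<exists>x. laurent (\<lambda>z. complex_of_real (h z)) x"
proof (induction rule: real_polynomial_function.induct)
  case (linear h)
  define a where "a = (complex_of_real (h 1) - \<i> * complex_of_real (h \<i>)) / 2"
  have "laurent (\<lambda>z. a * z powi 1 + cnj a * z powi (-1)) (a \<odot> upow 1 \<oplus> cnj a \<odot> upow (-1))"
    by (intro laurent_add laurent.mono) auto
  moreover have "a * z powi 1 + cnj a * z powi (-1) = complex_of_real (h z)" if z: "cmod z = 1" for z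
  proof -
    interpret bounded_linear h by fact
    have "z * cnj z = 1" using z by (simp add: complex_norm_square[symmetric])
    then have iz: "inverse z = cnj z" using inverse_unique by metis
    have hz: "h z = Re z * h 1 + Im z * h \<i>"
    proof -
      have "z = Re z *\<^sub>R 1 + Im z *\<^sub>R \<i>" by (simp add: complex_eq_iff)
      then have "h z = h (Re z *\<^sub>R 1 + Im z *\<^sub>R \<i>)" by simp
      then show ?thesis by (simp only: add scale real_scaleR_def)
    qed
    have "a * z powi 1 + cnj a * z powi (-1) = a * z + cnj a * cnj z"
      by (simp add: power_int_minus iz)
    also have "\<dots> = complex_of_real (h z)"
      by (simp add: a_def complex_eq_iff hz algebra_simps diff_divide_distrib)
    finally show ?thesis .
  qed
  ultimately have "laurent (\<lambda>z. complex_of_real (h z)) (a \<odot> upow 1 \<oplus> cnj a \<odot> upow (-1))" by (rule laurent_cong)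
  then show ?case by blast
next
  case (const c) then show ?case using laurent_const by blast
next
  case (add f g) then show ?case using laurent_add by fastforce
next
  case (mult f g) then show ?case using laurent_mult by fastforce
qed

lemma laurent_dense:
  assumes f: "continuous_on (sphere 0 1) f" and e: "e > 0"
  shows "\<exists>g x. laurent g x \<and> (\<forall>z. cmod z = 1 \<longrightarrow> cmod (f z - g z) < e)"
proof -
  obtain g :: "complex \<Rightarrow> complex" where g: "polynomial_function g" "\<forall>z\<in>sphere 0 1. norm (f z - g z) < e"
    using Stone_Weierstrass_polynomial_function[OF compact_sphere f e] by blast
  have "real_polynomial_function (Re \<circ> g)" "real_polynomial_function (Im \<circ> g)"
    using g(1) bounded_linear_Re bounded_linear_Im by (auto simp: polynomial_function_def)
  then obtain x y where x: "laurent (\<lambda>z. complex_of_real ((Re \<circ> g) z)) x" "laurent (\<lambda>z. complex_of_real ((Im \<circ> g) z)) y"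
    using laurent_real_polynomial by meson
  have "laurent (\<lambda>z. complex_of_real ((Re \<circ> g) z) + \<i> * complex_of_real ((Im \<circ> g) z)) (x \<oplus> \<i> \<odot> y)"
    by (intro laurent_add laurent_smult x)
  then have "laurent g (x \<oplus> \<i> \<odot> y)" by (rule laurent_cong) (simp add: complex_eq[symmetric])
  then show ?thesis using g(2) by auto
qed

section \<open>Continuous functions of a unitary\<close>

text \<open>\<open>symbol f y\<close> says that \<open>y = f(U)\<close>, for \<open>f\<close> continuous on the circle: \<open>(f, y)\<close> is a limit of pairs
  \<open>(g, g(U))\<close> with Laurent polynomials \<open>g\<close>. The relation is the closure of the graph of the functional
  calculus on Laurent polynomials, so algebraic properties pass to it from there.\<close>

definition symbol :: "(complex \<Rightarrow> complex) \<Rightarrow> 'a \<Rightarrow> bool" where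
  "symbol f y \<longleftrightarrow> y \<in> carrier A \<and>
     (\<forall>e>0. \<exists>g x. laurent g x \<and> (\<forall>z. cmod z = 1 \<longrightarrow> cmod (f z - g z) < e) \<and> nrm A (y \<ominus> x) < e)"

lemma symbol_closed: "symbol f y \<Longrightarrow> y \<in> carrier A"
  by (simp add: symbol_def)

lemma symbolE:
  assumes "symbol f y" "e > 0"
  obtains g x where "laurent g x" "\<And>z. cmod z = 1 \<Longrightarrow> cmod (f z - g z) < e" "nrm A (y \<ominus> x) < e" "x \<in> carrier A"
  using assms laurent_closed unfolding symbol_def by meson

lemma symbol_laurent: "laurent f x \<Longrightarrow> symbol f x"
  unfolding symbol_def using laurent_closed[of f x] by (auto intro!: exI[of _ f] exI[of _ x])

lemma symbol_cong: "symbol f y \<Longrightarrow> (\<And>z. cmod z = 1 \<Longrightarrow> f z = g z) \<Longrightarrow> symbol g y"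
  unfolding symbol_def by simp

text \<open>In particular, with \<open>b = 0\<close>, the function determines the element.\<close>

lemma symbol_nrm_le:
  assumes f: "symbol f y" and g: "symbol g w" and b: "\<And>z. cmod z = 1 \<Longrightarrow> cmod (f z - g z) \<le> b"
  shows "nrm A (y \<ominus> w) \<le> b"
proof (rule field_le_epsilon)
  fix e :: real assume e: "e > 0"
  then have e4: "e / 4 > 0" by simp
  obtain f' x where x: "laurent f' x" "\<And>z. cmod z = 1 \<Longrightarrow> cmod (f z - f' z) < e / 4" "nrm A (y \<ominus> x) < e / 4" "x \<in> carrier A"
    using symbolE[OF f e4] by auto
  obtain g' v where v: "laurent g' v" "\<And>z. cmod z = 1 \<Longrightarrow> cmod (g z - g' z) < e / 4" "nrm A (w \<ominus> v) < e / 4" "v \<in> carrier A"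
    using symbolE[OF g e4] by auto
  note c = symbol_closed[OF f] symbol_closed[OF g] x(4) v(4)
  have "nrm A (x \<ominus> v) \<le> b + e / 2"
  proof (rule laurent_nrm_le[OF laurent_diff[OF x(1) v(1)]])
    fix z :: complex assume z: "cmod z = 1"
    have "cmod (f' z - g' z) \<le> cmod (f z - g z) + (cmod (f z - f' z) + cmod (g z - g' z))"
      by norm
    then show "cmod (f' z - g' z) \<le> b + e / 2" using x(2)[OF z] v(2)[OF z] b[OF z] by linarith
  qed
  then show "nrm A (y \<ominus> w) \<le> b + e"
    using nrm_diff_triangle[OF c(1,3,2)] nrm_diff_triangle[OF c(3,4,2)] nrm_diff_commute[OF c(2,4)] x(3) v(3)
    by linarith
qed

lemma symbol_unique: "symbol f y \<Longrightarrow> symbol f w \<Longrightarrow> y = w"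
  using symbol_nrm_le[of f y f w 0] symbol_closed nrm_diff_zero by force

lemma symbol_continuous:
  assumes f: "symbol f y" shows "continuous_on (sphere 0 1) f"
proof -
  have "1 / real (Suc n) > 0" for n by simp
  then have "\<exists>g x. laurent g x \<and> (\<forall>z. cmod z = 1 \<longrightarrow> cmod (f z - g z) < 1 / real (Suc n))" for n
    using f unfolding symbol_def by blast
  then obtain g x where g: "\<And>n::nat. laurent (g n) (x n)"
    "\<And>n z. cmod z = 1 \<Longrightarrow> cmod (f z - g n z) < 1 / real (Suc n)" by metis
  have ev: "\<forall>\<^sub>F n in sequentially. continuous_on (sphere 0 1) (g n)"
    using laurent_continuous[OF g(1)] by simp
  have lim: "uniform_limit (sphere 0 1) g f sequentially"
  proof (rule uniform_limitI)
    fix e :: real assume e: "e > 0"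
    obtain N where N: "1 / real (Suc N) < e" using nat_approx_posE[OF e] by blast
    have "dist (g n z) (f z) < e" if "n \<ge> N" "cmod z = 1" for n z
    proof -
      have "1 / real (Suc n) \<le> 1 / real (Suc N)" using that by (simp add: frac_le)
      then show ?thesis using g(2)[OF that(2), of n] N by (simp add: dist_norm norm_minus_commute)
    qed
    then show "\<forall>\<^sub>F n in sequentially. \<forall>z\<in>sphere 0 1. dist (g n z) (f z) < e"
      unfolding eventually_sequentially by (intro exI[of _ N] allI impI ballI) simp
  qed
  show ?thesis by (rule uniform_limit_theorem[OF ev lim]) simp
qed

lemma symbol_bounded:
  assumes f: "symbol f y" shows "\<exists>B>0. \<forall>z. cmod z = 1 \<longrightarrow> cmod (f z) \<le> B"
proof -
  have "compact (f ` sphere 0 1)"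
    by (intro compact_continuous_image symbol_continuous[OF f] compact_sphere)
  then obtain B where "B > 0" "\<forall>w\<in>f ` sphere 0 1. norm w \<le> B"
    using compact_imp_bounded bounded_pos by metis
  then show ?thesis by auto
qed

text \<open>Laurent polynomials that approximate \<open>f\<close> uniformly have values at \<open>U\<close> that form a Cauchy sequence.\<close>

lemma symbol_exists:
  assumes f: "continuous_on (sphere 0 1) f" shows "\<exists>y. symbol f y"
proof -
  have "\<exists>g x. laurent g x \<and> (\<forall>z. cmod z = 1 \<longrightarrow> cmod (f z - g z) < 1 / real (Suc n))" for n
    by (rule laurent_dense[OF f]) simp
  then obtain g x where g: "\<And>n::nat. laurent (g n) (x n)"
    "\<And>n z. cmod z = 1 \<Longrightarrow> cmod (f z - g n z) < 1 / real (Suc n)" by metis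
  have c: "x n \<in> carrier A" for n by (rule laurent_closed[OF g(1)])
  have close: "nrm A (x m \<ominus> x n) \<le> 1 / real (Suc m) + 1 / real (Suc n)" for m n
  proof (rule laurent_nrm_le[OF laurent_diff[OF g(1) g(1)]])
    fix z :: complex assume z: "cmod z = 1"
    have "cmod (g m z - g n z) \<le> cmod (f z - g m z) + cmod (f z - g n z)" by norm
    then show "cmod (g m z - g n z) \<le> 1 / real (Suc m) + 1 / real (Suc n)"
      using g(2)[OF z, of m] g(2)[OF z, of n] by linarith
  qed
  have small: "\<exists>N. \<forall>n\<ge>N. 1 / real (Suc n) < e" if e: "e > 0" for e
  proof -
    obtain N where N: "1 / real (Suc N) < e" using nat_approx_posE[OF e] by blast
    have "1 / real (Suc n) \<le> 1 / real (Suc N)" if "n \<ge> N" for n using that by (simp add: frac_le)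
    then show ?thesis using N by (meson le_less_trans)
  qed
  have "\<exists>N. \<forall>m\<ge>N. \<forall>n\<ge>N. nrm A (x m \<ominus> x n) < e" if e: "e > 0" for e
  proof -
    obtain N where N: "\<forall>n\<ge>N. 1 / real (Suc n) < e / 2" using small[of "e / 2"] e by auto
    have "nrm A (x m \<ominus> x n) < e" if "m \<ge> N" "n \<ge> N" for m n
      using close[of m n] N[rule_format, OF that(1)] N[rule_format, OF that(2)] by linarith
    then show ?thesis by blast
  qed
  then obtain y where y: "y \<in> carrier A" "\<And>e. e > 0 \<Longrightarrow> \<exists>N. \<forall>n\<ge>N. nrm A (x n \<ominus> y) < e"
    using Cauchy_imp_limit[of x, OF c] by blast
  have "\<exists>h w. laurent h w \<and> (\<forall>z. cmod z = 1 \<longrightarrow> cmod (f z - h z) < e) \<and> nrm A (y \<ominus> w) < e"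
    if e: "e > 0" for e
  proof -
    obtain N where N: "\<forall>n\<ge>N. nrm A (x n \<ominus> y) < e" using y(2)[OF e] by blast
    obtain M where M: "\<forall>n\<ge>M. 1 / real (Suc n) < e" using small[OF e] by blast
    define n where "n = max N M"
    have "nrm A (y \<ominus> x n) < e" using N nrm_diff_commute[OF y(1) c, of n] by (simp add: n_def)
    moreover have "cmod (f z - g n z) < e" if "cmod z = 1" for z
    proof -
      have "1 / real (Suc n) < e" using M by (simp add: n_def)
      then show ?thesis using g(2)[OF that, of n] by linarith
    qed
    ultimately show ?thesis using g(1) by blast
  qed
  then show ?thesis using y(1) unfolding symbol_def by blast
qed

lemma symbol_add:
  assumes f: "symbol f y" and g: "symbol g w" shows "symbol (\<lambda>z. f z + g z) (y \<oplus> w)"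
  unfolding symbol_def
proof (intro conjI allI impI)
  note c = symbol_closed[OF f] symbol_closed[OF g]
  show "y \<oplus> w \<in> carrier A" using c by simp
  fix e :: real assume e: "e > 0"
  obtain f' x where x: "laurent f' x" "\<And>z. cmod z = 1 \<Longrightarrow> cmod (f z - f' z) < e / 2" "nrm A (y \<ominus> x) < e / 2" "x \<in> carrier A"
    using symbolE[OF f, of "e / 2"] e by auto
  obtain g' v where v: "laurent g' v" "\<And>z. cmod z = 1 \<Longrightarrow> cmod (g z - g' z) < e / 2" "nrm A (w \<ominus> v) < e / 2" "v \<in> carrier A"
    using symbolE[OF g, of "e / 2"] e by auto
  have "cmod (f z + g z - (f' z + g' z)) < e" if z: "cmod z = 1" for z
  proof -
    have "cmod (f z + g z - (f' z + g' z)) \<le> cmod (f z - f' z) + cmod (g z - g' z)" by norm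
    then show ?thesis using x(2)[OF z] v(2)[OF z] by linarith
  qed
  moreover have "nrm A ((y \<oplus> w) \<ominus> (x \<oplus> v)) < e"
    using nrm_add_diff[OF c x(4) v(4)] x(3) v(3) by linarith
  ultimately show "\<exists>h u. laurent h u \<and> (\<forall>z. cmod z = 1 \<longrightarrow> cmod (f z + g z - h z) < e) \<and> nrm A ((y \<oplus> w) \<ominus> u) < e"
    using laurent_add[OF x(1) v(1)] by blast
qed

lemma symbol_mult:
  assumes f: "symbol f y" and g: "symbol g w" shows "symbol (\<lambda>z. f z * g z) (y \<otimes> w)"
  unfolding symbol_def
proof (intro conjI allI impI)
  note c = symbol_closed[OF f] symbol_closed[OF g]
  show "y \<otimes> w \<in> carrier A" using c by simp
  fix e :: real assume e: "e > 0"
  obtain B where B: "B > 0" "\<And>z. cmod z = 1 \<Longrightarrow> cmod (f z) \<le> B" using symbol_bounded[OF f] by auto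
  obtain B' where B': "B' > 0" "\<And>z. cmod z = 1 \<Longrightarrow> cmod (g z) \<le> B'" using symbol_bounded[OF g] by auto
  \<comment> \<open>One radius \<open>d\<close> serves for the functions, bounded by \<open>B\<close> and \<open>B'\<close>, and for the elements.\<close>
  define K where "K = B + B' + nrm A y + nrm A w + 2"
  define d where "d = min 1 (e / K)"
  have n0: "0 \<le> nrm A y" "0 \<le> nrm A w" using c by (auto simp: nrm_nonneg)
  have K: "K > 0" using B(1) B'(1) n0 by (simp add: K_def)
  have d: "0 < d" "d \<le> 1" "d * K \<le> e" using K e by (auto simp: d_def min_def field_simps)
  obtain f' x where x: "laurent f' x" "\<And>z. cmod z = 1 \<Longrightarrow> cmod (f z - f' z) < d" "nrm A (y \<ominus> x) < d" "x \<in> carrier A"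
    using symbolE[OF f d(1)] by auto
  obtain g' v where v: "laurent g' v" "\<And>z. cmod z = 1 \<Longrightarrow> cmod (g z - g' z) < d" "nrm A (w \<ominus> v) < d" "v \<in> carrier A"
    using symbolE[OF g d(1)] by auto
  have "cmod (f z * g z - f' z * g' z) < e" if z: "cmod z = 1" for z
  proof -
    have f'b: "cmod (f' z) \<le> B + 1"
    proof -
      have "cmod (f' z) \<le> cmod (f z) + cmod (f z - f' z)" by norm
      then show ?thesis using x(2)[OF z] B(2)[OF z] d by linarith
    qed
    have "f z * g z - f' z * g' z = (f z - f' z) * g z + f' z * (g z - g' z)" by (simp add: algebra_simps)
    then have "cmod (f z * g z - f' z * g' z) \<le> cmod (f z - f' z) * cmod (g z) + cmod (f' z) * cmod (g z - g' z)"
      by (metis norm_triangle_ineq norm_mult)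
    also have "\<dots> \<le> d * B' + (B + 1) * d"
      using f'b x(2)[OF z] v(2)[OF z] B'(2)[OF z] d B(1) by (intro add_mono mult_mono) auto
    also have "\<dots> < d * K"
    proof -
      have "d * B' + (B + 1) * d = d * (B + B' + 1)" by (simp add: algebra_simps)
      also have "\<dots> < d * K" using d(1) n0 by (intro mult_strict_left_mono) (auto simp: K_def)
      finally show ?thesis .
    qed
    finally show ?thesis using d by linarith
  qed
  moreover have "nrm A (y \<otimes> w \<ominus> x \<otimes> v) < e"
  proof -
    have nx: "nrm A x \<le> nrm A y + 1"
      using nrm_diff_ineq[OF x(4) c(1)] nrm_diff_commute[OF x(4) c(1)] x(3) d by simp
    have "nrm A (y \<otimes> w \<ominus> x \<otimes> v) \<le> nrm A (y \<ominus> x) * nrm A w + nrm A x * nrm A (w \<ominus> v)"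
      by (rule nrm_mult_diff) (use c x v in auto)
    also have "\<dots> \<le> d * nrm A w + (nrm A y + 1) * d"
      using x v nx c d n0 by (intro add_mono mult_mono) (auto simp: nrm_nonneg)
    also have "\<dots> < d * K"
    proof -
      have "d * nrm A w + (nrm A y + 1) * d = d * (nrm A y + nrm A w + 1)" by (simp add: algebra_simps)
      also have "\<dots> < d * K" using d(1) B(1) B'(1) by (intro mult_strict_left_mono) (auto simp: K_def)
      finally show ?thesis .
    qed
    finally show ?thesis using d by linarith
  qed
  ultimately show "\<exists>h u. laurent h u \<and> (\<forall>z. cmod z = 1 \<longrightarrow> cmod (f z * g z - h z) < e) \<and> nrm A (y \<otimes> w \<ominus> u) < e"
    using laurent_mult[OF x(1) v(1)] by blast
qed

lemma symbol_star:
  assumes f: "symbol f y" shows "symbol (\<lambda>z. cnj (f z)) (star A y)"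
  unfolding symbol_def
proof (intro conjI allI impI)
  note c = symbol_closed[OF f]
  show "star A y \<in> carrier A" using c by simp
  fix e :: real assume e: "e > 0"
  obtain f' x where x: "laurent f' x" "\<And>z. cmod z = 1 \<Longrightarrow> cmod (f z - f' z) < e" "nrm A (y \<ominus> x) < e" "x \<in> carrier A"
    using symbolE[OF f e] by auto
  have "cmod (cnj (f z) - cnj (f' z)) < e" if z: "cmod z = 1" for z
    using x(2)[OF z] by (metis complex_cnj_diff complex_mod_cnj)
  moreover have "nrm A (star A y \<ominus> star A x) < e"
    using nrm_star[of "y \<ominus> x"] c x by (simp add: star_diff)
  ultimately show "\<exists>h u. laurent h u \<and> (\<forall>z. cmod z = 1 \<longrightarrow> cmod (cnj (f z) - h z) < e) \<and> nrm A (star A y \<ominus> u) < e"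
    using laurent_star[OF x(1)] by blast
qed

lemma symbol_one: "symbol (\<lambda>z. 1) \<one>"
  using symbol_laurent[OF laurent_const[of 1]] by simp

lemma symbol_smult: "symbol f y \<Longrightarrow> symbol (\<lambda>z. c * f z) (c \<odot> y)"
  using symbol_mult[OF symbol_laurent[OF laurent_const[of c]], of f y] symbol_closed[of f y] by (simp add: smult_mult)

lemma symbol_commute: 
  assumes f: "symbol f y" and g: "symbol g w" shows "y \<otimes> w = w \<otimes> y"
  using symbol_unique[OF symbol_mult[OF f g] symbol_cong[OF symbol_mult[OF g f]]] by (simp add: mult.commute)

lemma symbol_U: "symbol (\<lambda>z. z) U"
  using symbol_laurent[OF laurent_upow[of 1]] by simp

lemma laurent_generated:
  assumes "laurent f x" shows "x \<in> cstar_generated A {U}"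
proof -
  have sub: "cstar_subalgebra A (cstar_generated A {U})" "U \<in> cstar_generated A {U}"
    using cstar_subalgebra_generated[of "{U}"] by auto
  have "upow k \<in> cstar_generated A {U}" for k
  proof (induction k rule: int_induct[of _ 0])
    case base then show ?case using sub by (simp add: cstar_subalgebra_iff)
  next
    case (step1 i) then show ?case using sub by (simp add: cstar_subalgebra_iff upow_plus_1)
  next
    case (step2 i) then show ?case using sub by (simp add: cstar_subalgebra_iff upow_minus1)
  qed
  with assms show ?thesis
    by (induction rule: laurent.induct) (use sub in \<open>simp_all add: cstar_subalgebra_iff\<close>)
qed

lemma symbol_generated:
  assumes f: "symbol f y" shows "y \<in> cstar_generated A {U}"
proof -
  have sub: "cstar_subalgebra A (cstar_generated A {U})"
    using cstar_subalgebra_generated[of "{U}"] by auto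
  have "\<exists>x\<in>cstar_generated A {U}. nrm A (y \<ominus> x) < e" if "e > 0" for e
    using symbolE[OF f that] laurent_generated by metis
  then have "y \<in> norm_closure (cstar_generated A {U})" using symbol_closed[OF f] by (simp add: norm_closure_def)
  then show ?thesis using sub by (auto simp: cstar_subalgebra_iff)
qed

lemma generated_subset_laurent_closure: "cstar_generated A {U} \<subseteq> norm_closure {x. \<exists>f. laurent f x}"
proof (rule cstar_generated_least)
  show "cstar_subalgebra A (norm_closure {x. \<exists>f. laurent f x})"
  proof (rule cstar_subalgebra_norm_closure)
    show "\<one> \<in> {x. \<exists>f. laurent f x}" using laurent_const[of 1] by auto
  qed (auto intro: laurent_closed laurent_add laurent_mult laurent_smult laurent_star)
  have "{x. \<exists>f. laurent f x} \<subseteq> norm_closure {x. \<exists>f. laurent f x}"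
    by (rule norm_closure_superset) (auto intro: laurent_closed)
  then show "{U} \<subseteq> norm_closure {x. \<exists>f. laurent f x}" using laurent_upow[of 1] by auto
qed

end

section \<open>The functional calculus of a unitary with full spectrum\<close>

locale full_spectrum_unitary = unitary_element +
  assumes spectrum_U: "spectrum A U = sphere 0 1"
begin

text \<open>If \<open>\<parallel>x\<parallel> < |f(z\<^sub>0)|\<close>, then \<open>f(z\<^sub>0) - x\<close> is invertible; but \<open>U - z\<^sub>0\<close> is a factor of it, and \<open>z\<^sub>0\<close> lies in
  the spectrum of \<open>U\<close>. Together with \<open>laurent_nrm_le\<close>, the calculus is isometric for the supremum norm.\<close>

lemma laurent_le_nrm:
  assumes f: "laurent f x" and z0: "cmod z0 = 1"
  shows "cmod (f z0) \<le> nrm A x"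
proof (rule ccontr)
  assume "\<not> cmod (f z0) \<le> nrm A x"
  then have "f z0 \<odot> \<one> \<ominus> x \<in> Units A" (is "?d \<in> _")
    using laurent_closed[OF f] by (intro scalar_minus_Units) auto
  moreover have "laurent (\<lambda>z. f z0 - f z) ?d" by (intro laurent_diff laurent_const f)
  then obtain n p where p: "upow (int n) \<otimes> ?d = peval p" "\<And>z. cmod z = 1 \<Longrightarrow> poly p z = z ^ n * (f z0 - f z)"
    using laurent_poly by blast
  ultimately have pu: "peval p \<in> Units A" using A.Units_m_closed[OF upow_Units, of ?d "int n"] by simp
  have "poly p z0 = 0" using p(2)[OF z0] by simp
  then obtain q where q: "p = [:-z0, 1:] * q" by (metis dvdE poly_eq_0_iff_dvd)
  define w where "w = peval [:-z0, 1:]"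
  have 1: "peval p = w \<otimes> peval q" unfolding q w_def by (rule peval_mult)
  have 2: "peval p = peval q \<otimes> w" unfolding q w_def using peval_mult[of q "[:-z0, 1:]"] by (simp add: mult.commute)
  have "w \<otimes> (peval q \<otimes> inv (peval p)) = \<one>" using pu 1 by (simp add: A.m_assoc[symmetric] w_def)
  moreover have "(inv (peval p) \<otimes> peval q) \<otimes> w = \<one>" using pu 2 by (simp add: A.m_assoc w_def)
  moreover have c: "w \<in> carrier A" "peval q \<otimes> inv (peval p) \<in> carrier A" "inv (peval p) \<otimes> peval q \<in> carrier A"
    using pu by (auto simp: w_def)
  ultimately have "inv (peval p) \<otimes> peval q = peval q \<otimes> inv (peval p)" using A.inv_unique by metis
  then have "w \<in> Units A" using \<open>w \<otimes> _ = \<one>\<close> \<open>_ \<otimes> w = \<one>\<close> c unfolding Units_def by auto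
  then have "(-1) \<odot> w \<in> Units A" by (rule smult_Units) simp
  moreover have "(-1) \<odot> w = z0 \<odot> \<one> \<ominus> U"
    by (simp add: w_def peval_pCons smult_add_right smult_smult smult_minus1 A.minus_eq)
  moreover have "z0 \<in> spectrum A U" using spectrum_U z0 by simp
  ultimately show False by (simp add: spectrum_def)
qed

lemma symbol_le_nrm:
  assumes f: "symbol f y" and g: "symbol g w" and z0: "cmod z0 = 1"
  shows "cmod (f z0 - g z0) \<le> nrm A (y \<ominus> w)"
proof (rule field_le_epsilon)
  fix e :: real assume e: "e > 0"
  then have e4: "e / 4 > 0" by simp
  obtain f' x where x: "laurent f' x" "\<And>z. cmod z = 1 \<Longrightarrow> cmod (f z - f' z) < e / 4" "nrm A (y \<ominus> x) < e / 4" "x \<in> carrier A"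
    using symbolE[OF f e4] by auto
  obtain g' v where v: "laurent g' v" "\<And>z. cmod z = 1 \<Longrightarrow> cmod (g z - g' z) < e / 4" "nrm A (w \<ominus> v) < e / 4" "v \<in> carrier A"
    using symbolE[OF g e4] by auto
  note c = symbol_closed[OF f] symbol_closed[OF g] x(4) v(4)
  have 1: "cmod (f' z0 - g' z0) \<le> nrm A (x \<ominus> v)"
    using laurent_le_nrm[OF laurent_diff[OF x(1) v(1)] z0] .
  have 2: "cmod (f z0 - g z0) \<le> cmod (f' z0 - g' z0) + (cmod (f z0 - f' z0) + cmod (g z0 - g' z0))"
    by norm
  show "cmod (f z0 - g z0) \<le> nrm A (y \<ominus> w) + e"
    using 1 2 nrm_diff_triangle[OF c(3,1,4)] nrm_diff_triangle[OF c(1,2,4)] nrm_diff_commute[OF c(1,3)]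
      x(2)[OF z0] v(2)[OF z0] x(3) v(3) by linarith
qed

text \<open>The calculus is isometric, so the functions of a convergent sequence of Laurent polynomials in \<open>U\<close>
  converge uniformly on the circle.\<close>

lemma closure_imp_symbol:
  assumes y: "y \<in> norm_closure {x. \<exists>f. laurent f x}" shows "\<exists>f. symbol f y"
proof -
  have yc: "y \<in> carrier A" using y by (simp add: norm_closure_def)
  have "\<exists>g x. laurent g x \<and> nrm A (y \<ominus> x) < 1 / real (Suc n)" for n
    using norm_closureD[OF y, of "1 / real (Suc n)"] by auto
  then obtain g x where g: "\<And>n::nat. laurent (g n) (x n)" "\<And>n. nrm A (y \<ominus> x n) < 1 / real (Suc n)" by metis
  have c: "x n \<in> carrier A" for n by (rule laurent_closed[OF g(1)])
  have close: "cmod (g m z - g n z) \<le> 1 / real (Suc m) + 1 / real (Suc n)" if "cmod z = 1" for m n z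
    using laurent_le_nrm[OF laurent_diff[OF g(1)[of m] g(1)[of n]] that] nrm_diff_triangle[OF c yc c, of m n]
      nrm_diff_commute[OF c yc, of m] g(2)[of m] g(2)[of n] by linarith
  define f where "f z = lim (\<lambda>n. g n z)" for z
  have lim: "(\<lambda>n. g n z) \<longlonglongrightarrow> f z" if z: "cmod z = 1" for z
  proof -
    have "Cauchy (\<lambda>n. g n z)"
    proof (rule CauchyI)
      fix e :: real assume e: "e > 0"
      then obtain N where N: "1 / real (Suc N) < e / 2" using nat_approx_posE[of "e / 2"] by auto
      have "cmod (g m z - g n z) < e" if "m \<ge> N" "n \<ge> N" for m n
      proof -
        have "1 / real (Suc m) \<le> 1 / real (Suc N)" "1 / real (Suc n) \<le> 1 / real (Suc N)"
          using that by (simp_all add: frac_le)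
        then show ?thesis using close[OF z, of m n] N by linarith
      qed
      then show "\<exists>M. \<forall>m\<ge>M. \<forall>n\<ge>M. norm (g m z - g n z) < e" by blast
    qed
    then show ?thesis unfolding f_def using Cauchy_convergent convergent_LIMSEQ_iff by blast
  qed
  have dist: "cmod (f z - g n z) \<le> 1 / real (Suc n) + 1 / real (Suc n)" if z: "cmod z = 1" for z n
  proof (rule LIMSEQ_le_const2)
    show "(\<lambda>m. cmod (g m z - g n z)) \<longlonglongrightarrow> cmod (f z - g n z)"
      by (intro tendsto_intros lim z)
    have "cmod (g m z - g n z) \<le> 1 / real (Suc n) + 1 / real (Suc n)" if "m \<ge> n" for m
    proof -
      have "1 / real (Suc m) \<le> 1 / real (Suc n)" using that by (simp add: frac_le)
      then show ?thesis using close[OF z, of m n] by linarith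
    qed
    then show "\<exists>N. \<forall>m\<ge>N. cmod (g m z - g n z) \<le> 1 / real (Suc n) + 1 / real (Suc n)" by blast
  qed
  have "\<exists>h w. laurent h w \<and> (\<forall>z. cmod z = 1 \<longrightarrow> cmod (f z - h z) < e) \<and> nrm A (y \<ominus> w) < e"
    if e: "e > 0" for e
  proof -
    obtain n where n: "1 / real (Suc n) < e / 2" using nat_approx_posE[of "e / 2"] e by auto
    have "cmod (f z - g n z) < e" if "cmod z = 1" for z using dist[OF that, of n] n by linarith
    moreover have "nrm A (y \<ominus> x n) < e" using g(2)[of n] n e by linarith
    ultimately show ?thesis using g(1) by blast
  qed
  then show ?thesis using yc unfolding symbol_def by blast
qed

lemma generated_iff_symbol: "y \<in> cstar_generated A {U} \<longleftrightarrow> (\<exists>f. symbol f y)"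
  using generated_subset_laurent_closure closure_imp_symbol symbol_generated by blast

lemma symbol_functions_unique: "symbol f y \<Longrightarrow> symbol g y \<Longrightarrow> cmod z = 1 \<Longrightarrow> f z = g z"
  using symbol_le_nrm[of f y g y z] symbol_closed[of f y] by simp

abbreviation CT :: "(complex \<Rightarrow> complex) cstar_alg" where
  "CT \<equiv> continuous_functions (sphere 0 1)"

definition calculus_hom :: "(complex \<Rightarrow> complex) \<Rightarrow> 'a" where
  "calculus_hom = restrict (\<lambda>f. THE y. symbol f y) (carrier CT)"

lemma calculus_hom: 
  assumes "f \<in> carrier CT" shows "symbol f (calculus_hom f)"
proof -
  have "continuous_on (sphere 0 1) f" using assms by (simp add: continuous_functions_def)
  then obtain y where y: "symbol f y" using symbol_exists by blast
  then have "(THE y. symbol f y) = y" using symbol_unique by blast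
  then show ?thesis using y assms by (simp add: calculus_hom_def)
qed

lemma restrict_CT:
  assumes "continuous_on (sphere 0 1) g" shows "restrict g (sphere 0 1) \<in> carrier CT"
proof -
  have "continuous_on (sphere 0 1) (restrict g (sphere 0 1)) \<longleftrightarrow> continuous_on (sphere 0 1) g"
    by (rule continuous_on_cong) auto
  then show ?thesis using assms by (simp add: continuous_functions_def)
qed

lemma CT_closed:
  assumes f: "f \<in> carrier CT" and g: "g \<in> carrier CT"
  shows "f \<otimes>\<^bsub>CT\<^esub> g \<in> carrier CT" "f \<oplus>\<^bsub>CT\<^esub> g \<in> carrier CT" "c \<odot>\<^bsub>CT\<^esub> f \<in> carrier CT"
    "star CT f \<in> carrier CT" "\<one>\<^bsub>CT\<^esub> \<in> carrier CT"
proof -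
  have c: "continuous_on (sphere 0 1) f" "continuous_on (sphere 0 1) g"
    using f g by (auto simp: continuous_functions_def)
  have ops: "f \<otimes>\<^bsub>CT\<^esub> g = restrict (\<lambda>z. f z * g z) (sphere 0 1)" "f \<oplus>\<^bsub>CT\<^esub> g = restrict (\<lambda>z. f z + g z) (sphere 0 1)"
    "c \<odot>\<^bsub>CT\<^esub> f = restrict (\<lambda>z. c * f z) (sphere 0 1)" "star CT f = restrict (\<lambda>z. cnj (f z)) (sphere 0 1)"
    "\<one>\<^bsub>CT\<^esub> = restrict (\<lambda>z. 1) (sphere 0 1)"
    by (simp_all add: continuous_functions_def)
  show "f \<otimes>\<^bsub>CT\<^esub> g \<in> carrier CT" "f \<oplus>\<^bsub>CT\<^esub> g \<in> carrier CT" "c \<odot>\<^bsub>CT\<^esub> f \<in> carrier CT"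
    "star CT f \<in> carrier CT" "\<one>\<^bsub>CT\<^esub> \<in> carrier CT"
    unfolding ops by (intro restrict_CT continuous_intros c)+
qed

lemma calculus_hom_eq: "f \<in> carrier CT \<Longrightarrow> symbol f y \<Longrightarrow> calculus_hom f = y"
  using calculus_hom symbol_unique by blast

lemma calculus_hom_star_hom: "calculus_hom \<in> star_hom CT A"
proof -
  have app: "\<And>z f g. cmod z = 1 \<Longrightarrow> (f \<otimes>\<^bsub>CT\<^esub> g) z = f z * g z"
    "\<And>z f g. cmod z = 1 \<Longrightarrow> (f \<oplus>\<^bsub>CT\<^esub> g) z = f z + g z"
    "\<And>z c f. cmod z = 1 \<Longrightarrow> (c \<odot>\<^bsub>CT\<^esub> f) z = c * f z"
    "\<And>z f. cmod z = 1 \<Longrightarrow> star CT f z = cnj (f z)"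
    "\<And>z. cmod z = 1 \<Longrightarrow> \<one>\<^bsub>CT\<^esub> z = 1"
    by (simp_all add: continuous_functions_def)
  have "calculus_hom (f \<otimes>\<^bsub>CT\<^esub> g) = calculus_hom f \<otimes> calculus_hom g" "calculus_hom (f \<oplus>\<^bsub>CT\<^esub> g) = calculus_hom f \<oplus> calculus_hom g"
    if "f \<in> carrier CT" "g \<in> carrier CT" for f g
    using that by (auto intro!: calculus_hom_eq CT_closed symbol_cong[OF symbol_mult[OF calculus_hom calculus_hom]]
        symbol_cong[OF symbol_add[OF calculus_hom calculus_hom]] simp: app)
  moreover have "calculus_hom (c \<odot>\<^bsub>CT\<^esub> f) = c \<odot> calculus_hom f" "calculus_hom (star CT f) = star A (calculus_hom f)"
    if "f \<in> carrier CT" for c f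
    using that by (auto intro!: calculus_hom_eq CT_closed symbol_cong[OF symbol_smult[OF calculus_hom]]
        symbol_cong[OF symbol_star[OF calculus_hom]] simp: app)
  moreover have "calculus_hom \<one>\<^bsub>CT\<^esub> = \<one>"
  proof (rule calculus_hom_eq)
    have "restrict (\<lambda>z. 1) (sphere 0 1) \<in> carrier CT" by (intro restrict_CT continuous_intros)
    then show "\<one>\<^bsub>CT\<^esub> \<in> carrier CT" by (simp add: continuous_functions_def)
    show "symbol \<one>\<^bsub>CT\<^esub> \<one>" by (rule symbol_cong[OF symbol_one]) (simp add: app)
  qed
  moreover have "calculus_hom f \<in> carrier A" if "f \<in> carrier CT" for f using calculus_hom[OF that] symbol_closed by blast
  ultimately show ?thesis
    by (simp add: star_hom_def ring_hom_def calculus_hom_def)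
qed

text \<open>A homomorphism that maps the identity function to \<open>U\<close> is determined on Laurent polynomials. It is
  also contractive for the supremum norm, by the same argument as for \<open>laurent_nrm_le\<close>, with the inverse
  of \<open>c - |g|\<^sup>2\<close> now taken among the continuous functions.\<close>

lemma calculus_hom_unique:
  assumes \<Psi>: "\<Psi> \<in> star_hom CT A" and U: "\<Psi> (\<lambda>z\<in>sphere 0 1. z) = U" and f: "f \<in> carrier CT"
  shows "symbol f (\<Psi> f)"
proof -
  note h = star_hom_simps[OF \<Psi>]
  note cr = restrict_CT
  have ops: "restrict g (sphere 0 1) \<otimes>\<^bsub>CT\<^esub> restrict k (sphere 0 1) = restrict (\<lambda>z. g z * k z) (sphere 0 1)"
    "restrict g (sphere 0 1) \<oplus>\<^bsub>CT\<^esub> restrict k (sphere 0 1) = restrict (\<lambda>z. g z + k z) (sphere 0 1)"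
    "c \<odot>\<^bsub>CT\<^esub> restrict g (sphere 0 1) = restrict (\<lambda>z. c * g z) (sphere 0 1)"
    "star CT (restrict g (sphere 0 1)) = restrict (\<lambda>z. cnj (g z)) (sphere 0 1)"
    "\<one>\<^bsub>CT\<^esub> = restrict (\<lambda>z. 1) (sphere 0 1)" for g k c
    by (auto simp: continuous_functions_def)
  define \<psi> where "\<psi> g = \<Psi> (restrict g (sphere 0 1))" for g
  have \<psi>c: "\<psi> g \<in> carrier A" if "continuous_on (sphere 0 1) g" for g
    using h(1)[OF cr[OF that]] by (simp add: \<psi>_def)
  have \<psi>m: "\<psi> (\<lambda>z. g z * k z) = \<psi> g \<otimes> \<psi> k" "\<psi> (\<lambda>z. g z + k z) = \<psi> g \<oplus> \<psi> k"
    if "continuous_on (sphere 0 1) g" "continuous_on (sphere 0 1) k" for g k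
    using h(2,3)[OF cr[OF that(1)] cr[OF that(2)]] by (simp_all add: \<psi>_def ops)
  have \<psi>s: "\<psi> (\<lambda>z. c * g z) = c \<odot> \<psi> g" "\<psi> (\<lambda>z. cnj (g z)) = star A (\<psi> g)"
    if "continuous_on (sphere 0 1) g" for g c
    using h(5,6)[OF cr[OF that]] by (simp_all add: \<psi>_def ops)
  have \<psi>1: "\<psi> (\<lambda>z. 1) = \<one>" using h(4) by (simp add: \<psi>_def ops)
  have \<psi>U: "\<psi> (\<lambda>z. z) = U" using U by (simp add: \<psi>_def)
  have \<psi>_cong: "\<psi> g = \<psi> k" if "\<And>z. cmod z = 1 \<Longrightarrow> g z = k z" for g k
    unfolding \<psi>_def using that by (intro arg_cong[of _ _ \<Psi>] restrict_ext) simp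
  have \<psi>d: "\<psi> (\<lambda>z. g z - k z) = \<psi> g \<ominus> \<psi> k"
    if g: "continuous_on (sphere 0 1) g" and k: "continuous_on (sphere 0 1) k" for g k
  proof -
    have "\<psi> (\<lambda>z. g z + (-1) * k z) = \<psi> g \<oplus> (-1) \<odot> \<psi> k"
      using \<psi>m(2)[OF g, of "\<lambda>z. (-1) * k z"] \<psi>s(1)[OF k, of "-1"] k by (simp add: continuous_on_minus)
    then show ?thesis using \<psi>c[OF k] by (simp add: smult_minus1 A.minus_eq)
  qed
  have contr: "nrm A (\<psi> g) \<le> b" if g: "continuous_on (sphere 0 1) g" and b: "\<And>z. cmod z = 1 \<Longrightarrow> cmod (g z) \<le> b" for g b
  proof (rule nrm_le_of_spectral_bound)
    show "\<psi> g \<in> carrier A" by (rule \<psi>c[OF g])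
    show "0 \<le> b" using order_trans[OF norm_ge_zero b[of 1]] by simp
    fix c :: complex assume c: "b\<^sup>2 < cmod c"
    have nz: "c - cnj (g z) * g z \<noteq> 0" if z: "cmod z = 1" for z
    proof -
      have "cmod (cnj (g z) * g z) \<le> b\<^sup>2"
        using power_mono[OF b[OF z], of 2] by (simp add: norm_mult power2_eq_square)
      then show ?thesis using c by auto
    qed
    have k1: "continuous_on (sphere 0 1) (\<lambda>z. cnj (g z) * g z)" using g by (intro continuous_intros)
    have k2: "continuous_on (sphere 0 1) (\<lambda>z. c - cnj (g z) * g z)" using g by (intro continuous_intros)
    have k3: "continuous_on (sphere 0 1) (\<lambda>z. 1 / (c - cnj (g z) * g z))"
      using g nz by (intro continuous_intros) auto
    have cc: "\<psi> (\<lambda>z. c) = c \<odot> \<one>" using \<psi>s(1)[of "\<lambda>z. 1" c] \<psi>1 by simp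
    have cg: "continuous_on (sphere 0 1) (\<lambda>z. cnj (g z))" using g by (intro continuous_intros)
    have e: "\<psi> (\<lambda>z. c - cnj (g z) * g z) = c \<odot> \<one> \<ominus> star A (\<psi> g) \<otimes> \<psi> g"
      using \<psi>d[OF continuous_on_const k1, of c] cc \<psi>m(1)[OF cg g] \<psi>s(2)[OF g] by simp
    have "\<psi> (\<lambda>z. c - cnj (g z) * g z) \<otimes> \<psi> (\<lambda>z. 1 / (c - cnj (g z) * g z)) = \<one>"
      using \<psi>m(1)[OF k2 k3] \<psi>_cong[of "\<lambda>z. (c - cnj (g z) * g z) * (1 / (c - cnj (g z) * g z))" "\<lambda>z. 1"] nz \<psi>1 by simp
    moreover have "\<psi> (\<lambda>z. 1 / (c - cnj (g z) * g z)) \<otimes> \<psi> (\<lambda>z. c - cnj (g z) * g z) = \<one>"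
      using \<psi>m(1)[OF k3 k2] \<psi>_cong[of "\<lambda>z. (1 / (c - cnj (g z) * g z)) * (c - cnj (g z) * g z)" "\<lambda>z. 1"] nz \<psi>1 by simp
    ultimately show "c \<odot> \<one> \<ominus> star A (\<psi> g) \<otimes> \<psi> g \<in> Units A"
      using \<psi>c[OF k2] \<psi>c[OF k3] unfolding Units_def e by blast
  qed
  have pc: "continuous_on (sphere 0 1) (\<lambda>z::complex. z powi k)" for k by (intro continuous_intros) auto
  have Uinv: "\<psi> (\<lambda>z. cnj z) = star A U" using \<psi>s(2)[of "\<lambda>z. z"] \<psi>U by simp
  have pw: "\<psi> (\<lambda>z. z powi k) = upow k" for k
  proof (induction k rule: int_induct[of _ 0])
    case base then show ?case using \<psi>1 by simp
  next
    case (step1 i)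
    have "\<psi> (\<lambda>z. z powi (i + 1)) = \<psi> (\<lambda>z. z powi i * z)"
      by (rule \<psi>_cong) (subst power_int_add, auto)
    then show ?case using step1 \<psi>m(1)[OF pc continuous_on_id] \<psi>U by (simp add: upow_plus_1)
  next
    case (step2 i)
    have "z powi (i - 1) = z powi i * cnj z" if z: "cmod z = 1" for z
    proof -
      have "z * cnj z = 1" using z by (simp add: complex_norm_square[symmetric])
      then have "cnj z = inverse z" using inverse_unique by metis
      then show ?thesis using z by (subst power_int_diff) (auto simp: divide_inverse)
    qed
    then have "\<psi> (\<lambda>z. z powi (i - 1)) = \<psi> (\<lambda>z. z powi i * cnj z)" by (rule \<psi>_cong)
    moreover have "continuous_on (sphere 0 1) cnj" by (intro continuous_intros)
    ultimately show ?case using step2 \<psi>m(1)[OF pc, of cnj] Uinv by (simp add: upow_minus1)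
  qed
  have laurent: "laurent g x \<Longrightarrow> \<psi> g = x" for g x
  proof (induction rule: laurent.induct)
    case (mono g c k)
    have "\<psi> g = \<psi> (\<lambda>z. c * z powi k)" by (rule \<psi>_cong) (rule mono)
    then show ?case using \<psi>s(1)[OF pc] pw by simp
  next
    case (add g x g' y k)
    have "\<psi> k = \<psi> (\<lambda>z. g z + g' z)" by (rule \<psi>_cong) (rule add)
    then show ?case using \<psi>m(2) add laurent_continuous by simp
  qed
  have fc: "continuous_on (sphere 0 1) f" and fe: "\<psi> f = \<Psi> f"
    using f by (auto simp: continuous_functions_def \<psi>_def extensional_restrict)
  show ?thesis
    unfolding symbol_def
  proof (intro conjI allI impI)
    show "\<Psi> f \<in> carrier A" using \<psi>c[OF fc] fe by simp
    fix e :: real assume e: "e > 0"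
    then obtain g x where g: "laurent g x" "\<And>z. cmod z = 1 \<Longrightarrow> cmod (f z - g z) < e / 2"
      using laurent_dense[OF fc, of "e / 2"] by auto
    have gc: "continuous_on (sphere 0 1) g" by (rule laurent_continuous[OF g(1)])
    have "nrm A (\<psi> (\<lambda>z. f z - g z)) \<le> e / 2"
      using fc gc g(2) by (intro contr continuous_intros) (auto intro: less_imp_le)
    then have "nrm A (\<Psi> f \<ominus> x) < e" using \<psi>d[OF fc gc] laurent[OF g(1)] fe e by simp
    moreover have "cmod (f z - g z) < e" if "cmod z = 1" for z using g(2)[OF that] e by linarith
    ultimately show "\<exists>g x. laurent g x \<and> (\<forall>z. cmod z = 1 \<longrightarrow> cmod (f z - g z) < e) \<and> nrm A (\<Psi> f \<ominus> x) < e"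
      using g(1) by blast
  qed
qed

lemma functional_calculus_eq:
  assumes f: "f \<in> carrier CT" and y: "symbol f y"
  shows "functional_calculus A U f = y"
proof -
  have r: "restrict f (sphere 0 1) = f" using f by (simp add: continuous_functions_def extensional_restrict)
  have idc: "(\<lambda>z\<in>sphere 0 1. z) \<in> carrier CT" by (intro restrict_CT continuous_intros)
  have id: "calculus_hom (\<lambda>z\<in>sphere 0 1. z) = U"
    by (rule calculus_hom_eq[OF idc symbol_cong[OF symbol_U]]) simp
  show ?thesis
    unfolding functional_calculus_def spectrum_U r
  proof (rule the_equality)
    show "\<exists>\<Phi>\<in>star_hom CT A. \<Phi> (\<lambda>z\<in>sphere 0 1. z) = U \<and> y = \<Phi> f"
      using calculus_hom_star_hom calculus_hom_eq[OF f y] id by metis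
  next
    fix y' assume "\<exists>\<Phi>\<in>star_hom CT A. \<Phi> (\<lambda>z\<in>sphere 0 1. z) = U \<and> y' = \<Phi> f"
    then have "symbol f y'" using calculus_hom_unique[OF _ _ f] by blast
    then show "y' = y" using symbol_unique[OF y] by simp
  qed
qed

end

section \<open>Consequences of the defining relations\<close>

locale two_adic = unital_cstar_algebra A for A :: "'a cstar_alg" (structure) +
  fixes U S :: 'a
  assumes pair: "two_adic_pair A U S"

sublocale two_adic \<subseteq> unitary_element A U
  using pair by unfold_locales (simp add: two_adic_pair_def)

context two_adic
begin

abbreviation "T \<equiv> star A S"

lemma S_closed [simp, intro]: "S \<in> carrier A"
  and TS [simp]: "T \<otimes> S = \<one>"
  and SU: "S \<otimes> U = U \<otimes> U \<otimes> S"
  and range_sum: "S \<otimes> T \<oplus> U \<otimes> S \<otimes> T \<otimes> star A U = \<one>"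
  using pair by (auto simp: two_adic_pair_def is_isometry_def)

lemma TS_assoc [simp]: "x \<in> carrier A \<Longrightarrow> T \<otimes> (S \<otimes> x) = x"
  by (simp add: A.m_assoc[symmetric])

text \<open>The ranges of \<open>S\<close> and \<open>U S\<close> are orthogonal, because their range projections add up to \<open>1\<close>.\<close>

lemma TstarUS: "T \<otimes> (star A U \<otimes> S) = \<zero>"
proof -
  have "S = (S \<otimes> T \<oplus> U \<otimes> S \<otimes> T \<otimes> star A U) \<otimes> S" by (simp add: range_sum)
  also have "\<dots> = S \<oplus> U \<otimes> (S \<otimes> (T \<otimes> (star A U \<otimes> S)))" by (simp add: A.l_distr A.m_assoc)
  finally have "U \<otimes> (S \<otimes> (T \<otimes> (star A U \<otimes> S))) = \<zero>"
    using A.add.r_cancel_one[of S "U \<otimes> (S \<otimes> (T \<otimes> (star A U \<otimes> S)))"] by simp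
  then have "T \<otimes> (star A U \<otimes> (U \<otimes> (S \<otimes> (T \<otimes> (star A U \<otimes> S))))) = \<zero>" by simp
  moreover have "star A U \<otimes> (U \<otimes> x) = x" if "x \<in> carrier A" for x
    using that by (simp add: A.m_assoc[symmetric])
  ultimately show ?thesis by simp
qed

lemma TUS: "T \<otimes> (U \<otimes> S) = \<zero>"
proof -
  have "star A (T \<otimes> (star A U \<otimes> S)) = T \<otimes> (U \<otimes> S)" by (simp add: star_mult star_star A.m_assoc)
  then show ?thesis by (simp add: TstarUS)
qed

lemma S_upow: "S \<otimes> upow k = upow (2 * k) \<otimes> S"
proof (induction k rule: int_induct[of _ 0])
  case (step1 i)
  have "S \<otimes> upow (i + 1) = upow (2 * i) \<otimes> (S \<otimes> U)"
    using step1 by (simp add: upow_plus_1 A.m_assoc[symmetric])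
  also have "\<dots> = upow (2 * i) \<otimes> upow 1 \<otimes> upow 1 \<otimes> S" by (simp add: SU A.m_assoc)
  also have "upow (2 * i) \<otimes> upow 1 \<otimes> upow 1 = upow (2 * (i + 1))"
    unfolding upow_add[symmetric] by (simp add: distrib_left add.commute)
  finally show ?case .
next
  case (step2 i)
  have "S \<otimes> star A U = upow (-2) \<otimes> S"
  proof -
    have "upow (-2) \<otimes> (S \<otimes> U) \<otimes> star A U = S \<otimes> star A U"
    proof -
      have "upow (-2) \<otimes> (U \<otimes> U) = \<one>"
        using upow_inverse(2)[of 2] upow_add[of 1 1] by (metis one_add_one upow_1)
      then show ?thesis by (simp add: SU A.m_assoc[symmetric])
    qed
    then show ?thesis by (simp add: A.m_assoc)
  qed
  then have Sm: "S \<otimes> star A U = upow (-2) \<otimes> S" .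
  have "S \<otimes> upow (i - 1) = (S \<otimes> upow i) \<otimes> star A U" by (simp add: upow_minus1 A.m_assoc)
  also have "\<dots> = upow (2 * i) \<otimes> (S \<otimes> star A U)" unfolding step2(2) by (simp add: A.m_assoc)
  also have "\<dots> = upow (2 * i) \<otimes> (upow (-2) \<otimes> S)" unfolding Sm ..
  also have "\<dots> = upow (2 * i + -2) \<otimes> S" unfolding upow_add by (simp add: A.m_assoc)
  finally show ?case by (simp add: right_diff_distrib)
qed simp

lemma T_upow: "T \<otimes> upow (2 * k) = upow k \<otimes> T"
proof -
  have "star A (S \<otimes> upow (- k)) = star A (upow (2 * - k) \<otimes> S)" by (simp only: S_upow)
  then show ?thesis by (simp add: star_mult star_upow)
qed

lemma T_upow_S: "T \<otimes> (upow k \<otimes> S) = (if even k then upow (k div 2) else \<zero>)"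
proof (cases "even k")
  case True
  then have "T \<otimes> (upow k \<otimes> S) = T \<otimes> upow (2 * (k div 2)) \<otimes> S" by (simp add: A.m_assoc)
  also have "\<dots> = upow (k div 2)" by (simp only: T_upow) (simp add: A.m_assoc)
  finally show ?thesis using True by simp
next
  case False
  then have k: "k = 2 * (k div 2) + 1" by simp
  have "T \<otimes> (upow k \<otimes> S) = T \<otimes> upow (2 * (k div 2)) \<otimes> (U \<otimes> S)"
    by (subst k) (simp add: upow_add A.m_assoc del: odd_two_times_div_two_succ)
  also have "\<dots> = \<zero>" by (simp only: T_upow) (simp add: A.m_assoc TUS)
  finally show ?thesis using False by simp
qed

section \<open>The spectrum of the generating unitary\<close>

text \<open>The symmetry \<open>V = S S* - U S S* U*\<close> anticommutes with \<open>U\<close>, as \<open>U\<close> exchanges the two range projections.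
  So the spectrum of \<open>U\<close> is symmetric.\<close>

lemma not_spectrum_uminus:
  assumes z: "z \<odot> \<one> \<ominus> U \<in> Units A" shows "z \<odot> \<one> \<oplus> U \<in> Units A"
proof -
  define P where "P = S \<otimes> T"
  define Q where "Q = U \<otimes> S \<otimes> T \<otimes> star A U"
  define V where "V = P \<ominus> Q"
  have c [simp, intro]: "P \<in> carrier A" "Q \<in> carrier A" "V \<in> carrier A" by (auto simp: P_def Q_def V_def)
  have PQ1: "P \<oplus> Q = \<one>" using range_sum by (simp add: P_def Q_def)
  have PP: "P \<otimes> P = P" by (simp add: P_def A.m_assoc)
  have PQ: "P \<otimes> Q = \<zero>"
  proof -
    have "P \<otimes> Q = S \<otimes> (T \<otimes> (U \<otimes> S)) \<otimes> T \<otimes> star A U" by (simp add: P_def Q_def A.m_assoc)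
    then show ?thesis by (simp add: TUS)
  qed
  have QP: "Q \<otimes> P = \<zero>"
  proof -
    have "Q \<otimes> P = U \<otimes> S \<otimes> (T \<otimes> (star A U \<otimes> S)) \<otimes> T" by (simp add: P_def Q_def A.m_assoc)
    then show ?thesis by (simp add: TstarUS)
  qed
  have QQ: "Q \<otimes> Q = Q"
  proof -
    have "Q \<otimes> (P \<oplus> Q) = Q" by (simp add: PQ1)
    then show ?thesis by (simp add: A.r_distr QP)
  qed
  have VV: "V \<otimes> V = \<one>"
    using PQ1 by (simp add: V_def A.minus_eq A.l_distr A.r_distr A.l_minus A.r_minus PP PQ QP QQ A.minus_add)
  have UP: "U \<otimes> P = Q \<otimes> U" by (simp add: P_def Q_def A.m_assoc)
  have UQ: "U \<otimes> Q = P \<otimes> U"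
  proof -
    have "U \<otimes> Q = (U \<otimes> U \<otimes> S) \<otimes> T \<otimes> star A U" by (simp add: Q_def A.m_assoc)
    also have "\<dots> = S \<otimes> (upow 1 \<otimes> T) \<otimes> star A U" by (simp add: SU[symmetric] A.m_assoc)
    also have "\<dots> = S \<otimes> (T \<otimes> upow 2) \<otimes> upow (-1)" using T_upow[of 1] by simp
    also have "\<dots> = S \<otimes> T \<otimes> (upow 2 \<otimes> upow (-1))" by (simp add: A.m_assoc)
    also have "\<dots> = P \<otimes> U" using upow_add[of 2 "-1"] by (simp add: P_def)
    finally show ?thesis .
  qed
  have UV: "V \<otimes> U = \<ominus> (U \<otimes> V)"
    by (simp add: V_def A.minus_eq A.l_distr A.r_distr A.l_minus A.r_minus UP UQ A.minus_add A.a_comm)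
  define y where "y = inv (z \<odot> \<one> \<ominus> U)"
  have y: "y \<in> carrier A" "y \<otimes> (z \<odot> \<one> \<ominus> U) = \<one>" "(z \<odot> \<one> \<ominus> U) \<otimes> y = \<one>"
    using z by (auto simp: y_def)
  have zc: "z \<odot> \<one> \<ominus> U \<in> carrier A" "z \<odot> \<one> \<oplus> U \<in> carrier A" by auto
  have 1: "V \<otimes> (z \<odot> \<one> \<ominus> U) = (z \<odot> \<one> \<oplus> U) \<otimes> V"
    by (simp add: A.minus_eq A.l_distr A.r_distr A.r_minus UV smult_mult)
  have 2: "V \<otimes> (z \<odot> \<one> \<oplus> U) = (z \<odot> \<one> \<ominus> U) \<otimes> V"
    by (simp add: A.minus_eq A.l_distr A.r_distr A.l_minus UV smult_mult)
  have "(z \<odot> \<one> \<oplus> U) \<otimes> (V \<otimes> y \<otimes> V) = V \<otimes> ((z \<odot> \<one> \<ominus> U) \<otimes> y) \<otimes> V"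
    using y(1) zc by (simp add: A.m_assoc[symmetric] 1)
  also have "\<dots> = \<one>" by (simp add: y VV)
  finally have a: "(z \<odot> \<one> \<oplus> U) \<otimes> (V \<otimes> y \<otimes> V) = \<one>" .
  have "(V \<otimes> y \<otimes> V) \<otimes> (z \<odot> \<one> \<oplus> U) = V \<otimes> (y \<otimes> (z \<odot> \<one> \<ominus> U)) \<otimes> V"
    using y(1) zc by (simp add: A.m_assoc 2)
  also have "\<dots> = \<one>" by (simp add: y VV)
  finally have b: "(V \<otimes> y \<otimes> V) \<otimes> (z \<odot> \<one> \<oplus> U) = \<one>" .
  have "V \<otimes> y \<otimes> V \<in> carrier A" using y(1) by simp
  then show ?thesis using a b zc(2) unfolding Units_def by blast
qed

text \<open>By symmetry of the spectrum \<open>z\<^sup>2 - U\<^sup>2 = (z - U) (z + U)\<close> is invertible. If \<open>y\<close> is its inverse, then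
  \<open>S* y S\<close> is the inverse of \<open>z\<^sup>2 - U\<close>, since \<open>U\<^sup>2 S = S U\<close>.\<close>

lemma not_spectrum_square:
  assumes z: "z \<notin> spectrum A U" shows "z\<^sup>2 \<notin> spectrum A U"
proof -
  have u: "z \<odot> \<one> \<ominus> U \<in> Units A" using z by (simp add: spectrum_def)
  have "(z \<odot> \<one> \<ominus> U) \<otimes> (z \<odot> \<one> \<oplus> U) \<in> Units A"
    using u not_spectrum_uminus[OF u] by simp
  also have "(z \<odot> \<one> \<ominus> U) \<otimes> (z \<odot> \<one> \<oplus> U) = z\<^sup>2 \<odot> \<one> \<ominus> upow 2"
  proof -
    have "(z \<odot> \<one> \<ominus> U) \<otimes> (z \<odot> \<one> \<oplus> U) = (z \<odot> \<one>) \<otimes> (z \<odot> \<one>) \<oplus> ((z \<odot> \<one>) \<otimes> U \<ominus> U \<otimes> (z \<odot> \<one>)) \<ominus> U \<otimes> U"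
      by (simp add: A.minus_eq A.l_distr A.r_distr A.l_minus A.a_ac)
    also have "\<dots> = z\<^sup>2 \<odot> \<one> \<ominus> upow 2"
      using upow_add[of 1 1] by (simp add: smult_mult power2_eq_square)
    finally show ?thesis .
  qed
  finally obtain y where y: "y \<in> carrier A" "y \<otimes> (z\<^sup>2 \<odot> \<one> \<ominus> upow 2) = \<one>" "(z\<^sup>2 \<odot> \<one> \<ominus> upow 2) \<otimes> y = \<one>"
    unfolding Units_def by blast
  have 1: "(z\<^sup>2 \<odot> \<one> \<ominus> U) \<otimes> T = T \<otimes> (z\<^sup>2 \<odot> \<one> \<ominus> upow 2)"
    using T_upow[of 1] by (simp add: A.minus_eq A.l_distr A.r_distr A.l_minus A.r_minus smult_mult)
  have 2: "S \<otimes> (z\<^sup>2 \<odot> \<one> \<ominus> U) = (z\<^sup>2 \<odot> \<one> \<ominus> upow 2) \<otimes> S"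
    using S_upow[of 1] by (simp add: A.minus_eq A.l_distr A.r_distr A.l_minus A.r_minus smult_mult)
  have c: "z\<^sup>2 \<odot> \<one> \<ominus> U \<in> carrier A" "z\<^sup>2 \<odot> \<one> \<ominus> upow 2 \<in> carrier A" by auto
  have "(z\<^sup>2 \<odot> \<one> \<ominus> U) \<otimes> (T \<otimes> y \<otimes> S) = T \<otimes> ((z\<^sup>2 \<odot> \<one> \<ominus> upow 2) \<otimes> y) \<otimes> S"
    using y(1) c by (simp add: A.m_assoc[symmetric] 1)
  then have a: "(z\<^sup>2 \<odot> \<one> \<ominus> U) \<otimes> (T \<otimes> y \<otimes> S) = \<one>" by (simp add: y)
  have "(T \<otimes> y \<otimes> S) \<otimes> (z\<^sup>2 \<odot> \<one> \<ominus> U) = T \<otimes> (y \<otimes> (z\<^sup>2 \<odot> \<one> \<ominus> upow 2)) \<otimes> S"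
    using y(1) c by (simp add: A.m_assoc 2)
  then have b: "(T \<otimes> y \<otimes> S) \<otimes> (z\<^sup>2 \<odot> \<one> \<ominus> U) = \<one>" by (simp add: y)
  have "T \<otimes> y \<otimes> S \<in> carrier A" using y(1) by simp
  then have "z\<^sup>2 \<odot> \<one> \<ominus> U \<in> Units A" using a b c(1) unfolding Units_def by blast
  then show ?thesis by (simp add: spectrum_def)
qed

lemma spectrum_root: "z ^ 2 ^ n \<in> spectrum A U \<Longrightarrow> z \<in> spectrum A U"
proof (induction n arbitrary: z)
  case (Suc n)
  have "(z\<^sup>2) ^ 2 ^ n = z ^ 2 ^ Suc n" by (simp add: power_mult[symmetric])
  then have "z\<^sup>2 \<in> spectrum A U" using Suc by metis
  then show ?case using not_spectrum_square by blast
qed simp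

lemma spectrum_nonempty: "spectrum A U \<noteq> {}"
proof
  assume "spectrum A U = {}"
  then have u: "c \<odot> \<one> \<ominus> U \<in> Units A" for c by (auto simp: spectrum_def)
  have "U [^] n = upow (int n)" for n :: nat by (simp add: upow_def del: pow_nat)
  then have p: "nrm A (U [^] n) = 1" for n :: nat using nrm_unitary[OF unitary_upow] by simp
  have "nrm A U \<le> 0"
    by (rule nrm_le_spectral_radius) (use u p nrm_unitary[OF unitary] in auto)
  then show False using nrm_unitary[OF unitary] by simp
qed

lemma spectrum_open_complement:
  assumes z0: "z0 \<notin> spectrum A U"
  shows "\<exists>r>0. \<forall>z. cmod (z - z0) < r \<longrightarrow> z \<notin> spectrum A U"
proof -
  define x where "x = z0 \<odot> \<one> \<ominus> U"
  have x: "x \<in> Units A" using z0 by (simp add: spectrum_def x_def)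
  define r where "r = 1 / (nrm A (inv x) + 1)"
  have n0: "0 \<le> nrm A (inv x)" using x by (intro nrm_nonneg) auto
  then have r: "r > 0" by (simp add: r_def)
  have "z \<odot> \<one> \<ominus> U \<in> Units A" if z: "cmod (z - z0) < r" for z
  proof -
    have "cmod (z - z0) * nrm A (inv x) \<le> r * nrm A (inv x)"
      using z n0 by (intro mult_right_mono) auto
    also have "\<dots> < 1" using n0 by (simp add: r_def)
    finally have "\<one> \<ominus> (z0 - z) \<odot> inv x \<in> Units A"
      using x by (intro one_minus_Units) (auto simp: nrm_smult norm_minus_commute)
    then have "x \<otimes> (\<one> \<ominus> (z0 - z) \<odot> inv x) \<in> Units A" using x by simp
    also have "x \<otimes> (\<one> \<ominus> (z0 - z) \<odot> inv x) = x \<ominus> (z0 - z) \<odot> \<one>"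
      using x A.Units_closed[OF x] by (simp add: A.minus_eq A.r_distr A.r_minus smult_mult)
    also have "\<dots> = z \<odot> \<one> \<ominus> U"
    proof -
      have "(z0 - z) \<odot> \<one> = z0 \<odot> \<one> \<ominus> z \<odot> \<one>" by (simp add: smult_diff_left)
      moreover have "z0 \<odot> \<one> \<in> carrier A" "z \<odot> \<one> \<in> carrier A" by auto
      ultimately show ?thesis unfolding x_def using U_closed by algebra
    qed
    finally show ?thesis .
  qed
  then show ?thesis using r by (auto simp: spectrum_def)
qed

text \<open>The spectrum is a nonempty closed subset of the circle. It is closed under taking square roots, and the
  iterated square roots of any point are dense.\<close>

lemma spectrum_circle: "spectrum A U = sphere 0 1"
proof
  show "spectrum A U \<subseteq> sphere 0 1"
    by (rule subsetI, rule ccontr) (auto simp: spectrum_def off_circle_Units)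
  obtain \<mu> where \<mu>: "\<mu> \<in> spectrum A U" using spectrum_nonempty by blast
  then have \<mu>1: "cmod \<mu> = 1" using off_circle_Units by (auto simp: spectrum_def)
  show "sphere 0 1 \<subseteq> spectrum A U"
  proof (rule subsetI, rule ccontr)
    fix z0 :: complex assume z0: "z0 \<in> sphere 0 1" "z0 \<notin> spectrum A U"
    then obtain r where r: "r > 0" "\<And>z. cmod (z - z0) < r \<Longrightarrow> z \<notin> spectrum A U"
      using spectrum_open_complement by blast
    obtain n :: nat where n: "2 * pi / r < n" using reals_Archimedean2 by blast
    have "real n < 2 ^ n" by (rule of_nat_less_two_power)
    then have "2 * pi / r < 2 ^ n" using n by linarith
    then have nr: "2 * pi / real (2 ^ n) < r" using r(1) by (simp add: field_simps)
    obtain z where z: "z ^ 2 ^ n = \<mu>" "cmod (z - z0) \<le> 2 * pi / real (2 ^ n)"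
      using circle_root_near[of z0 \<mu> "2 ^ n"] z0 \<mu>1 by auto
    have "z \<in> spectrum A U" using spectrum_root[of z n] z(1) \<mu> by simp
    then show False using r(2)[of z] z(2) nr by linarith
  qed
qed

end

sublocale two_adic \<subseteq> full_spectrum_unitary A U
  by unfold_locales (rule spectrum_circle)

context two_adic
begin

section \<open>Homogeneous elements\<close>

definition monomial :: "int \<Rightarrow> nat \<Rightarrow> nat \<Rightarrow> int \<Rightarrow> 'a" where
  "monomial a p q b = upow a \<otimes> S [^] p \<otimes> T [^] q \<otimes> upow b"

lemma monomial_closed [simp, intro]: "monomial a p q b \<in> carrier A"
  by (simp add: monomial_def)

lemma Spow_upow: "S [^] p \<otimes> upow k = upow (2 ^ p * k) \<otimes> S [^] p" for p :: nat
proof (induction p arbitrary: k)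
  case (Suc p)
  have "S [^] Suc p \<otimes> upow k = S [^] p \<otimes> (S \<otimes> upow k)" by (simp add: A.m_assoc)
  also have "\<dots> = (S [^] p \<otimes> upow (2 * k)) \<otimes> S" by (simp add: S_upow A.m_assoc)
  also have "\<dots> = upow (2 ^ p * (2 * k)) \<otimes> S [^] Suc p" by (simp only: Suc) (simp add: A.m_assoc)
  finally show ?case by (simp add: ac_simps)
qed simp

lemma star_Spow: "star A (S [^] p) = T [^] p" for p :: nat
proof (induction p)
  case (Suc p)
  then show ?case using A.nat_pow_Suc2[of T p] by (simp add: star_mult)
qed simp

lemma Tpow_upow: "T [^] q \<otimes> upow (2 ^ q * k) = upow k \<otimes> T [^] q" for q :: nat
proof -
  have "star A (S [^] q \<otimes> upow (- k)) = star A (upow (2 ^ q * - k) \<otimes> S [^] q)" by (simp only: Spow_upow)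
  then show ?thesis by (simp add: star_mult star_upow star_Spow)
qed

lemma Tpow_upow_Spow: "\<exists>c k'. T [^] q \<otimes> upow k \<otimes> S [^] q = c \<odot> upow k'" for q :: nat
proof (induction q arbitrary: k)
  case 0
  have "T [^] (0::nat) \<otimes> upow k \<otimes> S [^] (0::nat) = 1 \<odot> upow k" by simp
  then show ?case by blast
next
  case (Suc q)
  have eq: "T [^] Suc q \<otimes> upow k \<otimes> S [^] Suc q = T [^] q \<otimes> (T \<otimes> (upow k \<otimes> S)) \<otimes> S [^] q"
    using A.nat_pow_Suc2[of S q] by (simp add: A.m_assoc)
  show ?case
  proof (cases "even k")
    case True
    then have "T [^] Suc q \<otimes> upow k \<otimes> S [^] Suc q = T [^] q \<otimes> upow (k div 2) \<otimes> S [^] q"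
      by (simp only: eq T_upow_S if_True)
    then show ?thesis using Suc[of "k div 2"] by metis
  next
    case False
    then have "T [^] Suc q \<otimes> upow k \<otimes> S [^] Suc q = 0 \<odot> upow 0"
      by (simp only: eq T_upow_S if_False) simp
    then show ?thesis by blast
  qed
qed

text \<open>Insert \<open>1 = S S* + U S S* U*\<close> between \<open>S\<^sup>p\<close> and \<open>S*\<^sup>q\<close>.\<close>

lemma monomial_split: "monomial a p q b = monomial a (Suc p) (Suc q) b \<oplus> monomial (a + 2 ^ p) (Suc p) (Suc q) (b - 2 ^ q)"
proof -
  define X where "X = S [^] Suc p \<otimes> T [^] Suc q"
  have Xc: "X \<in> carrier A" by (simp add: X_def)
  have 1: "S [^] p \<otimes> T [^] q = S [^] p \<otimes> (S \<otimes> T \<oplus> U \<otimes> S \<otimes> T \<otimes> star A U) \<otimes> T [^] q"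
    by (simp add: range_sum)
  also have "\<dots> = S [^] p \<otimes> (S \<otimes> T) \<otimes> T [^] q \<oplus> S [^] p \<otimes> (U \<otimes> S \<otimes> T \<otimes> star A U) \<otimes> T [^] q"
    by (simp add: A.l_distr A.r_distr)
  also have "S [^] p \<otimes> (S \<otimes> T) \<otimes> T [^] q = X"
    using A.nat_pow_Suc2[of T q] by (simp add: X_def A.m_assoc)
  also have "S [^] p \<otimes> (U \<otimes> S \<otimes> T \<otimes> star A U) \<otimes> T [^] q = upow (2 ^ p) \<otimes> X \<otimes> upow (- (2 ^ q))"
  proof -
    have u1: "S [^] p \<otimes> U = upow (2 ^ p) \<otimes> S [^] p" using Spow_upow[of p 1] by simp
    have u2: "star A U \<otimes> T [^] q = T [^] q \<otimes> upow (- (2 ^ q))" using Tpow_upow[of q "-1"] by simp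
    have "S [^] p \<otimes> (U \<otimes> S \<otimes> T \<otimes> star A U) \<otimes> T [^] q = (S [^] p \<otimes> U) \<otimes> (S \<otimes> T) \<otimes> (star A U \<otimes> T [^] q)"
      by (simp add: A.m_assoc)
    also have "\<dots> = upow (2 ^ p) \<otimes> (S [^] p \<otimes> S \<otimes> (T \<otimes> T [^] q)) \<otimes> upow (- (2 ^ q))"
      unfolding u1 u2 by (simp add: A.m_assoc)
    finally show ?thesis using A.nat_pow_Suc2[of T q] by (simp add: X_def)
  qed
  finally have 2: "S [^] p \<otimes> T [^] q = X \<oplus> upow (2 ^ p) \<otimes> X \<otimes> upow (- (2 ^ q))" .
  have "monomial a p q b = upow a \<otimes> (S [^] p \<otimes> T [^] q) \<otimes> upow b" by (simp add: monomial_def A.m_assoc)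
  also have "\<dots> = upow a \<otimes> X \<otimes> upow b \<oplus> upow a \<otimes> upow (2 ^ p) \<otimes> X \<otimes> (upow (- (2 ^ q)) \<otimes> upow b)"
    unfolding 2 using Xc by (simp add: A.l_distr A.r_distr A.m_assoc)
  also have "upow a \<otimes> X \<otimes> upow b = monomial a (Suc p) (Suc q) b"
    by (simp add: monomial_def X_def A.m_assoc del: A.nat_pow_Suc)
  also have "upow a \<otimes> upow (2 ^ p) \<otimes> X \<otimes> (upow (- (2 ^ q)) \<otimes> upow b) = monomial (a + 2 ^ p) (Suc p) (Suc q) (b - 2 ^ q)"
    by (simp add: monomial_def X_def A.m_assoc upow_add[symmetric] del: A.nat_pow_Suc)
  finally show ?thesis .
qed

text \<open>\<open>homog p q x\<close>: \<open>x\<close> is homogeneous of bidegree \<open>(p, q)\<close>. Its degree for the gauge automorphisms is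
  \<open>p - q\<close>; larger \<open>p\<close> with the same degree gives a larger space.\<close>

inductive homog :: "nat \<Rightarrow> nat \<Rightarrow> 'a \<Rightarrow> bool" for p q where
  mono: "homog p q (c \<odot> monomial a p q b)"
| add: "homog p q x \<Longrightarrow> homog p q y \<Longrightarrow> homog p q (x \<oplus> y)"

lemma homog_closed: "homog p q x \<Longrightarrow> x \<in> carrier A"
  by (induction rule: homog.induct) auto

lemma homog_monomial: "homog p q (monomial a p q b)"
  using homog.mono[of p q 1 a b] by simp

lemma homog_zero: "homog p q \<zero>"
  using homog.mono[of p q 0 0 0] by simp

lemma homog_smult: "homog p q x \<Longrightarrow> homog p q (d \<odot> x)"
proof (induction rule: homog.induct)
  case (mono c a b) then show ?case using homog.mono[of p q "d * c" a b] by (simp add: smult_smult)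
next
  case (add x y) then show ?case using homog.add by (simp add: smult_add_right homog_closed)
qed

lemma homog_raise: "homog p q x \<Longrightarrow> homog (p + k) (q + k) x"
proof (induction k)
  case (Suc k)
  have "homog (Suc m) (Suc n) y" if "homog m n y" for m n y
    using that
  proof (induction rule: homog.induct)
    case (mono c a b)
    show ?case
      unfolding monomial_split[of a m n b] by (auto simp: smult_add_right intro!: homog.intros)
  qed (rule homog.add)
  then show ?case using Suc by simp
qed simp

lemma homog_star: "homog p q x \<Longrightarrow> homog q p (star A x)"
proof (induction rule: homog.induct)
  case (mono c a b)
  have "star A T = S" by (simp add: star_star)
  have "star A (T [^] q) = S [^] q" by (metis star_Spow star_star S_closed A.nat_pow_closed)
  then have "star A (monomial a p q b) = monomial (- b) q p (- a)"
    by (simp add: monomial_def star_mult star_upow star_Spow A.m_assoc)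
  then show ?case by (simp add: star_smult homog.mono)
next
  case (add x y) then show ?case by (simp add: star_add homog_closed homog.add)
qed

lemma homog_mult:
  assumes x: "homog p q x" and y: "homog q r y" shows "homog p r (x \<otimes> y)"
proof -
  have mm: "homog p r (monomial a p q b \<otimes> monomial a' q r b')" for a b a' b'
  proof -
    obtain c k where ck: "T [^] q \<otimes> upow (b + a') \<otimes> S [^] q = c \<odot> upow k" using Tpow_upow_Spow by blast
    have "monomial a p q b \<otimes> monomial a' q r b'
        = upow a \<otimes> S [^] p \<otimes> (T [^] q \<otimes> upow (b + a') \<otimes> S [^] q) \<otimes> T [^] r \<otimes> upow b'"
      by (simp add: monomial_def A.m_assoc upow_add)
    also have "\<dots> = c \<odot> (upow a \<otimes> (S [^] p \<otimes> upow k) \<otimes> T [^] r \<otimes> upow b')"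
      unfolding ck by (simp add: smult_mult A.m_assoc)
    also have "\<dots> = c \<odot> monomial (a + 2 ^ p * k) p r b'"
      unfolding Spow_upow by (simp add: monomial_def A.m_assoc upow_add)
    finally show ?thesis by (simp add: homog.mono)
  qed
  have 1: "homog p r (monomial a p q b \<otimes> y)" for a b
    using y
  proof (induction rule: homog.induct)
    case (mono c a' b') then show ?case using homog_smult[OF mm] by (simp add: smult_mult)
  next
    case (add x y) then show ?case by (simp add: A.r_distr homog_closed homog.add)
  qed
  show ?thesis
    using x
  proof (induction rule: homog.induct)
    case (mono c a b) then show ?case using homog_smult[OF 1] homog_closed[OF y] by (simp add: smult_mult)
  next
    case (add x' y') then show ?case using homog_closed[OF y] by (simp add: A.l_distr homog_closed homog.add)
  qed
qed

text \<open>This commutation rule makes conjugation by powers of \<open>U\<close> visible on off-diagonal elements: for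
  \<open>p \<noteq> q\<close> it multiplies \<open>x\<close> by nontrivial powers of \<open>U\<close>.\<close>

lemma homog_shift: "homog p q x \<Longrightarrow> x \<otimes> upow (2 ^ q * j) = upow (2 ^ p * j) \<otimes> x"
proof (induction rule: homog.induct)
  case (mono c a b)
  have "monomial a p q b \<otimes> upow (2 ^ q * j) = upow a \<otimes> S [^] p \<otimes> (T [^] q \<otimes> upow (2 ^ q * j)) \<otimes> upow b"
    using upow_commute[of b "2 ^ q * j"] by (simp add: monomial_def A.m_assoc)
  also have "\<dots> = upow a \<otimes> (S [^] p \<otimes> upow j) \<otimes> T [^] q \<otimes> upow b"
    unfolding Tpow_upow by (simp add: A.m_assoc)
  also have "\<dots> = (upow a \<otimes> upow (2 ^ p * j)) \<otimes> S [^] p \<otimes> T [^] q \<otimes> upow b"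
    unfolding Spow_upow by (simp add: A.m_assoc)
  also have "\<dots> = upow (2 ^ p * j) \<otimes> monomial a p q b"
    unfolding upow_commute[of a] by (simp add: monomial_def A.m_assoc)
  finally show ?case by (simp add: smult_mult)
next
  case (add x y) then show ?case by (simp add: A.l_distr A.r_distr homog_closed)
qed

text \<open>The two halves of \<open>monomial_split\<close> are conjugate under the power \<open>2\<^sup>p\<close> of \<open>U\<close>.\<close>

lemma homog_average:
  "homog (Suc p) (Suc p) x \<Longrightarrow> homog p p ((1/2) \<odot> (x \<oplus> upow (2 ^ p) \<otimes> x \<otimes> upow (- (2 ^ p))))"
proof (induction rule: homog.induct)
  case (mono c a b)
  have "upow (2 ^ p) \<otimes> monomial a (Suc p) (Suc p) b \<otimes> upow (- (2 ^ p)) = monomial (a + 2 ^ p) (Suc p) (Suc p) (b - 2 ^ p)"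
  proof -
    have "upow (a + 2 ^ p) = upow (2 ^ p) \<otimes> upow a" "upow (b - 2 ^ p) = upow b \<otimes> upow (- (2 ^ p))"
      using upow_add[of "2 ^ p" a] upow_add[of b "- (2 ^ p)"] by (simp_all add: add.commute)
    then show ?thesis by (simp add: monomial_def A.m_assoc del: A.nat_pow_Suc)
  qed
  then have "c \<odot> monomial a (Suc p) (Suc p) b \<oplus> upow (2 ^ p) \<otimes> (c \<odot> monomial a (Suc p) (Suc p) b) \<otimes> upow (- (2 ^ p)) = c \<odot> monomial a p p b"
    unfolding monomial_split[of a p p b] by (simp add: smult_mult smult_add_right)
  then show ?case using homog_smult[OF homog_monomial] by (simp add: smult_smult)
next
  case (add x y)
  have "(1/2) \<odot> ((x \<oplus> y) \<oplus> upow (2 ^ p) \<otimes> (x \<oplus> y) \<otimes> upow (- (2 ^ p)))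
      = (1/2) \<odot> (x \<oplus> upow (2 ^ p) \<otimes> x \<otimes> upow (- (2 ^ p))) \<oplus> (1/2) \<odot> (y \<oplus> upow (2 ^ p) \<otimes> y \<otimes> upow (- (2 ^ p)))"
    using homog_closed[OF add(1)] homog_closed[OF add(2)] by (simp add: A.l_distr A.r_distr smult_add_right A.a_ac)
  then show ?case using homog.add[OF add(3,4)] by simp
qed

lemma homog_0_laurent: "homog 0 0 x \<Longrightarrow> \<exists>f. laurent f x"
proof (induction rule: homog.induct)
  case (mono c a b)
  have "monomial a 0 0 b = upow (a + b)" by (simp add: monomial_def upow_add)
  then show ?case using laurent_smult[OF laurent_upow, of c "a + b"] by auto
next
  case (add x y) then show ?case using laurent_add by blast
qed

inductive homog_sum :: "'a \<Rightarrow> bool" where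
  single: "homog p q x \<Longrightarrow> homog_sum x"
| add: "homog_sum x \<Longrightarrow> homog_sum y \<Longrightarrow> homog_sum (x \<oplus> y)"

lemma homog_sum_closed: "homog_sum x \<Longrightarrow> x \<in> carrier A"
  by (induction rule: homog_sum.induct) (auto dest: homog_closed)

lemma homog_sum_smult: "homog_sum x \<Longrightarrow> homog_sum (c \<odot> x)"
  by (induction rule: homog_sum.induct) (auto intro: homog_sum.intros homog_smult simp: smult_add_right homog_sum_closed)

lemma homog_sum_star: "homog_sum x \<Longrightarrow> homog_sum (star A x)"
  by (induction rule: homog_sum.induct) (auto intro: homog_sum.intros homog_star simp: star_add homog_sum_closed)

text \<open>The factors are first raised to bidegrees for which the inner powers of \<open>S*\<close> and \<open>S\<close> agree.\<close>

lemma homog_sum_mult: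
  assumes x: "homog_sum x" and y: "homog_sum y" shows "homog_sum (x \<otimes> y)"
  using x
proof (induction rule: homog_sum.induct)
  case (single p q x)
  show ?case
    using y
  proof (induction rule: homog_sum.induct)
    case (single r s y)
    have "homog (p + r) (q + r) x" "homog (q + r) (s + q) y"
      using homog_raise[OF \<open>homog p q x\<close>, of r] homog_raise[OF single, of q] by (simp_all add: add.commute)
    then show ?case using homog_mult homog_sum.single by blast
  next
    case (add y y')
    then show ?case using homog_closed[OF single] by (simp add: A.r_distr homog_sum_closed homog_sum.add)
  qed
next
  case (add x x')
  then show ?case using homog_sum_closed[OF y] by (simp add: A.l_distr homog_sum_closed homog_sum.add)
qed

lemma generated_subset_homog_sum_closure: "cstar_generated A {U, S} \<subseteq> norm_closure {x. homog_sum x}"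
proof (rule cstar_generated_least)
  have one: "homog_sum \<one>" using homog_sum.single[OF homog_monomial[of 0 0 0 0]] by (simp add: monomial_def)
  have "homog_sum U" using homog_sum.single[OF homog_monomial[of 0 0 1 0]] by (simp add: monomial_def)
  moreover have "homog_sum S" using homog_sum.single[OF homog_monomial[of 1 0 0 0]] by (simp add: monomial_def)
  moreover have "{x. homog_sum x} \<subseteq> norm_closure {x. homog_sum x}"
    by (rule norm_closure_superset) (auto intro: homog_sum_closed)
  ultimately show "{U, S} \<subseteq> norm_closure {x. homog_sum x}" by auto
  show "cstar_subalgebra A (norm_closure {x. homog_sum x})"
    by (rule cstar_subalgebra_norm_closure) (auto intro: one homog_sum_closed homog_sum.add homog_sum_mult homog_sum_smult homog_sum_star)
qed

end

section \<open>Fourier and Fejer weights on roots of unity\<close>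

definition root_of_unity :: "nat \<Rightarrow> nat \<Rightarrow> complex" where
  "root_of_unity R r = cis (2 * pi * r / R)"

text \<open>These weights turn an average over the \<open>R\<close>-th roots of unity into the projection to the degree \<open>m\<close>
  part, as long as no two degrees that occur differ by a multiple of \<open>R\<close>.\<close>

definition fourier_weight :: "nat \<Rightarrow> int \<Rightarrow> nat \<Rightarrow> complex" where
  "fourier_weight R m r = root_of_unity R r powi (- m) / R"

lemma norm_root_of_unity [simp]: "cmod (root_of_unity R r) = 1"
  by (simp add: root_of_unity_def)

lemma root_of_unity_nonzero [simp]: "root_of_unity R r \<noteq> 0"
  by (metis norm_root_of_unity norm_zero zero_neq_one)

lemma sum_root_of_unity_powi:
  assumes R: "\<bar>d\<bar> < int R"
  shows "(\<Sum>r<R. root_of_unity R r powi d) = (if d = 0 then of_nat R else 0)"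
proof (cases "d = 0")
  case False
  have R0: "R > 0" using R by linarith
  define z where "z = root_of_unity R 1 powi d"
  have rp: "root_of_unity R r = root_of_unity R 1 ^ r" for r
    by (simp add: root_of_unity_def Complex.DeMoivre mult.commute)
  have eq: "root_of_unity R r powi d = z ^ r" for r
  proof -
    have "(root_of_unity R 1 ^ r) powi d = (root_of_unity R 1 powi d) ^ r"
      by (simp add: power_int_power power_int_power' mult.commute)
    then show ?thesis by (simp add: rp[of r] z_def)
  qed
  have "z ^ R = (root_of_unity R 1 ^ R) powi d"
    by (simp add: z_def power_int_power power_int_power' mult.commute)
  also have "root_of_unity R 1 ^ R = 1" using R0 by (simp add: root_of_unity_def Complex.DeMoivre)
  finally have zR: "z ^ R = 1" by simp
  have z1: "z \<noteq> 1"
  proof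
    assume "z = 1"
    have "z = cis (of_int d * (2 * pi / R))"
      by (simp add: z_def root_of_unity_def cis_power_int)
    then have "cos (of_int d * (2 * pi / R)) = 1" using \<open>z = 1\<close> by (simp add: complex_eq_iff)
    then obtain n :: int where "of_int d * (2 * pi / R) = of_int n * 2 * pi" by (auto simp: cos_one_2pi_int)
    then have "2 * pi * of_int d = 2 * pi * (real_of_int n * real R)" using R0 by (simp add: field_simps)
    then have "real_of_int d = real_of_int n * real R" by simp
    then have "d = n * int R" by (metis of_int_eq_iff of_int_mult of_int_of_nat_eq)
    then have "\<bar>d\<bar> = \<bar>n\<bar> * int R" by (simp add: abs_mult)
    moreover have "\<bar>n\<bar> \<ge> 1" using False \<open>d = n * int R\<close> by (cases "n = 0") auto
    ultimately have "\<bar>d\<bar> \<ge> int R" using mult_right_mono[of 1 "\<bar>n\<bar>" "int R"] by simp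
    then show False using R by simp
  qed
  have "(\<Sum>r<R. root_of_unity R r powi d) = (\<Sum>r<R. z ^ r)" by (simp add: eq)
  also have "\<dots> = 0" using z1 zR by (simp add: geometric_sum)
  finally show ?thesis using False by simp
qed simp

lemma fourier_weight_sum:
  assumes R: "\<bar>d - m\<bar> < int R"
  shows "(\<Sum>r<R. fourier_weight R m r * root_of_unity R r powi d) = (if d = m then 1 else 0)"
proof -
  have "fourier_weight R m r * root_of_unity R r powi d = root_of_unity R r powi (d - m) / R" for r
  proof -
    have "root_of_unity R r powi (d - m) = root_of_unity R r powi d * root_of_unity R r powi (- m)"
      using power_int_add[of "root_of_unity R r" d "- m"] by simp
    then show ?thesis by (simp add: fourier_weight_def mult.commute)
  qed
  then have "(\<Sum>r<R. fourier_weight R m r * root_of_unity R r powi d) = (\<Sum>r<R. root_of_unity R r powi (d - m)) / R"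
    by (simp add: sum_divide_distrib)
  also have "\<dots> = (if d = m then 1 else 0)"
    using R by (auto simp: sum_root_of_unity_powi[OF R])
  finally show ?thesis .
qed

lemma norm_fourier_weight_sum: "(\<Sum>r<R. cmod (fourier_weight R m r)) \<le> 1"
  by (simp add: fourier_weight_def norm_divide norm_power_int)

text \<open>The Fejer kernel \<open>|1 + z + \<cdots> + z\<^sup>N\<^sup>-\<^sup>1|\<^sup>2 / N\<close> at the \<open>R\<close>-th roots of unity, up to the factor \<open>1/R\<close>, in
  expanded form. Expanded, it exhibits the average as a combination of averages with Fourier weights; as a
  square, it is nonnegative.\<close>

definition fejer_weight :: "nat \<Rightarrow> nat \<Rightarrow> nat \<Rightarrow> complex" where
  "fejer_weight R N r = (\<Sum>j<N. \<Sum>l<N. fourier_weight R (int l - int j) r) / N"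

lemma fejer_weight_nonneg: "\<exists>t::real. t \<ge> 0 \<and> fejer_weight R N r = complex_of_real t"
proof -
  define w where "w = root_of_unity R r"
  have w: "cmod w = 1" "w \<noteq> 0" by (auto simp: w_def)
  have cw: "inverse w = cnj w"
  proof -
    have "w * cnj w = 1" using w by (simp add: complex_norm_square[symmetric])
    then show ?thesis using inverse_unique by metis
  qed
  define s where "s = (\<Sum>j<N. w ^ j)"
  have "fourier_weight R (int l - int j) r = w ^ j * cnj (w ^ l) / R" for j l
  proof -
    have "w powi (- (int l - int j)) = w powi int j / w powi int l"
      using w power_int_diff[of w "int j" "int l"] by simp
    then have "w powi (- (int l - int j)) = w ^ j * cnj w ^ l"
      by (simp add: divide_inverse power_inverse[symmetric] cw)
    then show ?thesis by (simp add: fourier_weight_def w_def)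
  qed
  then have "fejer_weight R N r = (\<Sum>j<N. \<Sum>l<N. w ^ j * cnj (w ^ l)) / (of_nat R * of_nat N)"
    by (simp add: fejer_weight_def sum_divide_distrib[symmetric])
  also have "(\<Sum>j<N. \<Sum>l<N. w ^ j * cnj (w ^ l)) = s * cnj s"
    by (simp add: s_def sum_product)
  also have "\<dots> = complex_of_real ((cmod s)\<^sup>2)" using complex_norm_square[of s] by simp
  finally have "fejer_weight R N r = complex_of_real ((cmod s)\<^sup>2 / (real R * real N))" by simp
  then show ?thesis by (intro exI[of _ "(cmod s)\<^sup>2 / (real R * real N)"]) simp
qed

text \<open>The Fourier coefficient \<open>t\<close> counts the pairs \<open>(j, l)\<close> of numbers below \<open>N\<close> with \<open>l - j = d\<close>, divided by
  \<open>N\<close>; all but at most \<open>|d|\<close> of the numbers \<open>j\<close> belong to such a pair.\<close>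

lemma fejer_weight_sum:
  assumes R: "int N + \<bar>d\<bar> < int R" and N: "N > 0"
  shows "\<exists>t::real. (\<Sum>r<R. fejer_weight R N r * root_of_unity R r powi d) = complex_of_real t \<and>
     \<bar>t - 1\<bar> \<le> \<bar>real_of_int d\<bar> / N \<and> (d = 0 \<longrightarrow> t = 1)"
proof -
  define B where "B = {j. j < N \<and> 0 \<le> int j + d \<and> int j + d < int N}"
  have fB: "finite B" "B \<subseteq> {..<N}" by (auto simp: B_def)
  have "(\<Sum>r<R. fejer_weight R N r * root_of_unity R r powi d)
      = (\<Sum>r<R. \<Sum>j<N. \<Sum>l<N. fourier_weight R (int l - int j) r * root_of_unity R r powi d) / N"
    by (simp add: fejer_weight_def sum_divide_distrib sum_distrib_right)
  also have "(\<Sum>r<R. \<Sum>j<N. \<Sum>l<N. fourier_weight R (int l - int j) r * root_of_unity R r powi d)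
      = (\<Sum>j<N. \<Sum>l<N. \<Sum>r<R. fourier_weight R (int l - int j) r * root_of_unity R r powi d)"
    by (subst sum.swap) (intro sum.cong refl sum.swap)
  also have "\<dots> = (\<Sum>j<N. \<Sum>l<N. if d = int l - int j then 1 else 0)"
  proof (intro sum.cong refl fourier_weight_sum)
    fix j l assume "j \<in> {..<N}" "l \<in> {..<N}"
    then show "\<bar>d - (int l - int j)\<bar> < int R" using R by auto
  qed
  also have "\<dots> = (\<Sum>j<N. if j \<in> B then 1 else 0)"
  proof (intro sum.cong refl)
    fix j assume j: "j \<in> {..<N}"
    show "(\<Sum>l<N. if d = int l - int j then 1 else (0::complex)) = (if j \<in> B then 1 else 0)"
    proof (cases "j \<in> B")
      case True
      then have "(\<Sum>l<N. if d = int l - int j then 1 else (0::complex)) = (\<Sum>l<N. if l = nat (int j + d) then 1 else 0)"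
        by (intro sum.cong refl) (auto simp: B_def)
      then show ?thesis using True by (auto simp: B_def nat_less_iff)
    next
      case False
      then have "\<not> (d = int l - int j)" if "l < N" for l using that j by (auto simp: B_def)
      then show ?thesis using False by simp
    qed
  qed
  also have "\<dots> = of_nat (card B)" using fB by (simp add: sum.If_cases Int_absorb1)
  finally have eq: "(\<Sum>r<R. fejer_weight R N r * root_of_unity R r powi d) = complex_of_real (real (card B) / real N)"
    by simp
  have c1: "card B \<le> N" using card_mono[OF _ fB(2)] by simp
  have c2: "N \<le> card B + nat \<bar>d\<bar>"
  proof -
    have "{..<N} \<subseteq> B \<union> (if d \<ge> 0 then {N - nat d..<N} else {..<nat (- d)})"
      by (auto simp: B_def)
    then have "card {..<N} \<le> card (B \<union> (if d \<ge> 0 then {N - nat d..<N} else {..<nat (- d)}))"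
      using fB by (intro card_mono) auto
    also have "\<dots> \<le> card B + card (if d \<ge> 0 then {N - nat d..<N} else {..<nat (- d)})"
      by (rule card_Un_le)
    also have "card (if d \<ge> 0 then {N - nat d..<N} else {..<nat (- d)}) \<le> nat \<bar>d\<bar>" by auto
    finally show ?thesis by simp
  qed
  have "real N \<le> real (card B) + \<bar>real_of_int d\<bar>"
  proof -
    have "real N \<le> real (card B) + real (nat \<bar>d\<bar>)" using c2 by linarith
    then show ?thesis by simp
  qed
  then have "(real N - real (card B)) / N \<le> \<bar>real_of_int d\<bar> / N" by (intro divide_right_mono) auto
  moreover have "\<bar>real (card B) / real N - 1\<bar> = (real N - real (card B)) / N"
  proof -
    have "real (card B) / real N - 1 = - ((real N - real (card B)) / N)" using N by (simp add: field_simps)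
    then show ?thesis using c1 by simp
  qed
  ultimately have "\<bar>real (card B) / real N - 1\<bar> \<le> \<bar>real_of_int d\<bar> / N" by simp
  moreover have "d = 0 \<longrightarrow> real (card B) / real N = 1" using N by (simp add: B_def lessThan_def[symmetric])
  ultimately show ?thesis using eq by blast
qed

text \<open>Nonnegative weights of total mass \<open>1\<close>, whatever \<open>N\<close> is: averages with Fejer weights are contractive.\<close>

lemma norm_fejer_weight_sum:
  assumes "N > 0" "N < R" shows "(\<Sum>r<R. cmod (fejer_weight R N r)) = 1"
proof -
  have "complex_of_real (cmod (fejer_weight R N r)) = fejer_weight R N r" for r
    using fejer_weight_nonneg[of R N r] by auto
  then have "complex_of_real (\<Sum>r<R. cmod (fejer_weight R N r)) = (\<Sum>r<R. fejer_weight R N r)" by simp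
  also have "\<dots> = 1" using fejer_weight_sum[of N 0 R] assms by auto
  finally show ?thesis by (metis of_real_eq_1_iff)
qed

section \<open>Gauge automorphisms and their averages\<close>

locale two_adic_ring =
  fixes A :: "'a cstar_alg" (structure) and U S :: 'a
  assumes ring: "two_adic_ring_algebra A U S"

sublocale two_adic_ring \<subseteq> two_adic A U S
  using ring by (auto simp: two_adic_ring_algebra_def two_adic_def two_adic_axioms_def)

context two_adic_ring
begin

lemma generated: "cstar_generated A {U, S} = carrier A"
  using ring by (simp add: two_adic_ring_algebra_def)

lemma universal:
  assumes "two_adic_pair A V W" shows "\<exists>\<Phi>\<in>star_hom A A. \<Phi> U = V \<and> \<Phi> S = W"
  using ring assms unital_cstar_algebra_axioms unfolding two_adic_ring_algebra_def by blast

lemma homog_sum_dense: "x \<in> carrier A \<Longrightarrow> e > 0 \<Longrightarrow> \<exists>y. homog_sum y \<and> nrm A (x \<ominus> y) < e"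
  using generated generated_subset_homog_sum_closure norm_closureD[of x "{x. homog_sum x}" e] by auto

lemma gauge_pair:
  assumes t: "cmod t = 1" shows "two_adic_pair A U (t \<odot> S)"
proof -
  have tt: "cnj t * t = 1" "t * cnj t = 1" using t by (simp_all add: complex_norm_square[symmetric] mult.commute)
  show ?thesis
    unfolding two_adic_pair_def is_isometry_def
    using unitary range_sum by (simp add: star_smult smult_mult tt SU)
qed

text \<open>The gauge automorphism for \<open>|t| = 1\<close>. It is determined by its values on the generators, so the choice is
  harmless; for other \<open>t\<close> the value is arbitrary.\<close>

definition gauge :: "complex \<Rightarrow> 'a \<Rightarrow> 'a" where
  "gauge t = (SOME \<Phi>. \<Phi> \<in> star_hom A A \<and> \<Phi> U = U \<and> \<Phi> S = t \<odot> S)"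

lemma gauge:
  assumes t: "cmod t = 1"
  shows "gauge t \<in> star_hom A A" "gauge t U = U" "gauge t S = t \<odot> S"
proof -
  have "\<exists>\<Phi>. \<Phi> \<in> star_hom A A \<and> \<Phi> U = U \<and> \<Phi> S = t \<odot> S"
    using universal[OF gauge_pair[OF t]] by blast
  then have "gauge t \<in> star_hom A A \<and> gauge t U = U \<and> gauge t S = t \<odot> S"
    unfolding gauge_def by (rule someI_ex)
  then show "gauge t \<in> star_hom A A" "gauge t U = U" "gauge t S = t \<odot> S" by auto
qed

lemma hom_upow:
  assumes \<Phi>: "\<Phi> \<in> star_hom A A" and U: "\<Phi> U = U"
  shows "\<Phi> (upow k) = upow k"
proof -
  note h = star_hom_simps[OF \<Phi>]
  have "\<Phi> (star A U) = star A U" using h(6)[OF U_closed] U by simp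
  then show ?thesis
    by (induction k rule: int_induct[of _ 0]) (simp_all add: h(2,4) U upow_plus_1 upow_minus1)
qed

lemma gauge_monomial:
  assumes t: "cmod t = 1"
  shows "gauge t (monomial a p q b) = t powi (int p - int q) \<odot> monomial a p q b"
proof -
  note h = star_hom_simps[OF gauge(1)[OF t]]
  have S: "gauge t (S [^] p) = t ^ p \<odot> S [^] p" for p :: nat
    by (induction p) (simp_all add: h(2,4) gauge(3)[OF t] smult_mult mult.commute)
  have T: "gauge t (T [^] q) = cnj t ^ q \<odot> T [^] q"
    using h(6)[of "S [^] q"] S[of q] by (simp add: star_Spow[symmetric] star_smult)
  have "t powi (int p - int q) = t ^ p * cnj t ^ q"
  proof -
    have "t * cnj t = 1" using t by (simp add: complex_norm_square[symmetric])
    then have "inverse t = cnj t" using inverse_unique by metis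
    moreover have "t powi (int p - int q) = t ^ p / t ^ q"
      using t power_int_diff[of t "int p" "int q"] by fastforce
    ultimately show ?thesis by (simp add: divide_inverse power_inverse[symmetric])
  qed
  then show ?thesis
    by (simp add: monomial_def h(2) S T hom_upow[OF gauge(1,2)[OF t]] smult_mult mult.commute)
qed

lemma gauge_homog:
  assumes t: "cmod t = 1"
  shows "homog p q x \<Longrightarrow> gauge t x = t powi (int p - int q) \<odot> x"
proof (induction rule: homog.induct)
  case (mono c a b)
  then show ?case using star_hom_simps(5)[OF gauge(1)[OF t]] by (simp add: gauge_monomial[OF t] smult_smult mult.commute)
next
  case (add x y)
  then show ?case using star_hom_simps(3)[OF gauge(1)[OF t]] by (simp add: homog_closed smult_add_right)
qed

lemma gauge_closed [simp, intro]: "cmod t = 1 \<Longrightarrow> x \<in> carrier A \<Longrightarrow> gauge t x \<in> carrier A"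
  using star_hom_simps(1)[OF gauge(1)] by blast

definition twirl :: "nat \<Rightarrow> (nat \<Rightarrow> complex) \<Rightarrow> 'a \<Rightarrow> 'a" where
  "twirl R k w = (\<Oplus>r\<in>{..<R}. k r \<odot> gauge (root_of_unity R r) w)"

lemma finsum_closed' [simp, intro]:
  fixes R :: nat
  assumes "\<And>r. f r \<in> carrier A" shows "(\<Oplus>r\<in>{..<R}. f r) \<in> carrier A"
  using assms by (intro A.finsum_closed) auto

lemma finsum_lessThan_Suc:
  fixes R :: nat
  assumes "\<And>r. f r \<in> carrier A" shows "(\<Oplus>r\<in>{..<Suc R}. f r) = f R \<oplus> (\<Oplus>r\<in>{..<R}. f r)"
  using assms by (simp add: lessThan_Suc A.finsum_insert)

lemma twirl_closed [simp, intro]: "w \<in> carrier A \<Longrightarrow> twirl R k w \<in> carrier A"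
  by (simp add: twirl_def)

lemma twirl_nrm:
  assumes w: "w \<in> carrier A"
  shows "nrm A (twirl R k w) \<le> (\<Sum>r<R. cmod (k r)) * nrm A w"
proof -
  have fc: "k r \<odot> gauge (root_of_unity R r) w \<in> carrier A" for r using w by simp
  have fn: "nrm A (k r \<odot> gauge (root_of_unity R r) w) \<le> cmod (k r) * nrm A w" for r
    using star_hom_contractive[OF unital_cstar_algebra_axioms unital_cstar_algebra_axioms gauge(1)[OF norm_root_of_unity] w]
      w by (simp add: nrm_smult mult_left_mono)
  have "nrm A (\<Oplus>r\<in>{..<n}. k r \<odot> gauge (root_of_unity R r) w) \<le> (\<Sum>r<n. cmod (k r)) * nrm A w" for n
  proof (induction n)
    case (Suc n)
    have "nrm A (\<Oplus>r\<in>{..<Suc n}. k r \<odot> gauge (root_of_unity R r) w)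
        \<le> nrm A (k n \<odot> gauge (root_of_unity R n) w) + nrm A (\<Oplus>r\<in>{..<n}. k r \<odot> gauge (root_of_unity R r) w)"
      unfolding finsum_lessThan_Suc[OF fc] by (intro nrm_triangle fc finsum_closed')
    then show ?case using Suc fn[of n] by (simp add: distrib_right)
  qed simp
  then show ?thesis by (simp add: twirl_def)
qed

lemma twirl_add:
  assumes "x \<in> carrier A" "y \<in> carrier A"
  shows "twirl R k (x \<oplus> y) = twirl R k x \<oplus> twirl R k y"
proof -
  have "k r \<odot> gauge (root_of_unity R r) (x \<oplus> y) = k r \<odot> gauge (root_of_unity R r) x \<oplus> k r \<odot> gauge (root_of_unity R r) y" for r
    using assms star_hom_simps(3)[OF gauge(1)[OF norm_root_of_unity]] by (simp add: smult_add_right)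
  then show ?thesis using assms unfolding twirl_def by (simp add: A.finsum_addf)
qed

lemma twirl_smult:
  assumes "x \<in> carrier A"
  shows "twirl R k (c \<odot> x) = c \<odot> twirl R k x"
proof -
  have e: "k r \<odot> gauge (root_of_unity R r) (c \<odot> x) = c \<odot> (k r \<odot> gauge (root_of_unity R r) x)" for r
    using assms star_hom_simps(5)[OF gauge(1)[OF norm_root_of_unity]] by (simp add: smult_smult mult.commute)
  have "(\<Oplus>r\<in>{..<n}. c \<odot> (k r \<odot> gauge (root_of_unity R r) x)) = c \<odot> (\<Oplus>r\<in>{..<n}. k r \<odot> gauge (root_of_unity R r) x)" for n
    using assms by (induction n) (simp_all add: finsum_lessThan_Suc smult_add_right)
  then show ?thesis unfolding twirl_def e by simp
qed

lemma twirl_diff: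
  assumes "x \<in> carrier A" "y \<in> carrier A"
  shows "twirl R k (x \<ominus> y) = twirl R k x \<ominus> twirl R k y"
  using twirl_add[of x "(-1) \<odot> y" R k] twirl_smult[of y R k "-1"] assms
  by (simp add: smult_minus1 A.minus_eq)

lemma twirl_weight_sum:
  assumes w: "w \<in> carrier A" and I: "finite I"
  shows "nrm A (twirl R (\<lambda>r. \<Sum>i\<in>I. k i r) w) \<le> (\<Sum>i\<in>I. nrm A (twirl R (k i) w))"
  using I
proof (induction I rule: finite_induct)
  case empty
  have "(\<Sum>r<R. cmod 0) * nrm A w = 0" by simp
  then show ?case using twirl_nrm[OF w, of R "\<lambda>r. 0"] by simp
next
  case (insert i I)
  have "k i r \<odot> x \<oplus> (\<Sum>i\<in>I. k i r) \<odot> x = (\<Sum>i\<in>insert i I. k i r) \<odot> x" if "x \<in> carrier A" for r x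
    using insert that by (simp add: smult_add_left)
  then have "twirl R (\<lambda>r. \<Sum>i\<in>insert i I. k i r) w = twirl R (k i) w \<oplus> twirl R (\<lambda>r. \<Sum>i\<in>I. k i r) w"
    using w unfolding twirl_def by (subst A.finsum_addf[symmetric]) (auto simp del: sum.insert)
  then have "nrm A (twirl R (\<lambda>r. \<Sum>i\<in>insert i I. k i r) w) \<le> nrm A (twirl R (k i) w) + nrm A (twirl R (\<lambda>r. \<Sum>i\<in>I. k i r) w)"
    using nrm_triangle[of "twirl R (k i) w" "twirl R (\<lambda>r. \<Sum>i\<in>I. k i r) w"] w by simp
  then show ?case using insert by simp
qed

lemma twirl_homog:
  assumes x: "homog p q x"
  shows "twirl R k x = (\<Sum>r<R. k r * root_of_unity R r powi (int p - int q)) \<odot> x"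
proof -
  note xc = homog_closed[OF x]
  have "(\<Oplus>r\<in>{..<n}. (k r * root_of_unity R r powi (int p - int q)) \<odot> x)
      = (\<Sum>r<n. k r * root_of_unity R r powi (int p - int q)) \<odot> x" for n
    using xc by (induction n) (simp_all add: finsum_lessThan_Suc smult_add_left A.a_comm)
  then show ?thesis
    using xc unfolding twirl_def gauge_homog[OF norm_root_of_unity x] by (simp add: smult_smult)
qed

section \<open>The commutant of the unitary\<close>

definition commutant :: "'a set" where
  "commutant = {w \<in> carrier A. U \<otimes> w = w \<otimes> U}"

lemma commutant_closed: "w \<in> commutant \<Longrightarrow> w \<in> carrier A"
  by (simp add: commutant_def)

lemma commutant_add: "x \<in> commutant \<Longrightarrow> y \<in> commutant \<Longrightarrow> x \<oplus> y \<in> commutant"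
  by (simp add: commutant_def A.l_distr A.r_distr)

lemma commutant_smult: "x \<in> commutant \<Longrightarrow> c \<odot> x \<in> commutant"
  by (simp add: commutant_def smult_mult)

lemma commutant_mult: "x \<in> commutant \<Longrightarrow> y \<in> commutant \<Longrightarrow> x \<otimes> y \<in> commutant"
  by (simp add: commutant_def) (metis A.m_assoc U_closed)

lemma commutant_upow:
  assumes w: "w \<in> commutant" shows "upow k \<otimes> w = w \<otimes> upow k"
proof -
  have wc: "w \<in> carrier A" and c: "U \<otimes> w = w \<otimes> U" using w by (auto simp: commutant_def)
  have "star A U \<otimes> w = star A U \<otimes> (w \<otimes> U) \<otimes> star A U" using wc by (simp add: A.m_assoc)
  also have "\<dots> = (star A U \<otimes> U) \<otimes> w \<otimes> star A U" unfolding c[symmetric] using wc by (simp add: A.m_assoc del: starU_U)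
  finally have c': "star A U \<otimes> w = w \<otimes> star A U" using wc by simp
  show ?thesis
  proof (induction k rule: int_induct[of _ 0])
    case (step1 i)
    then show ?case using wc c by (simp add: upow_plus_1 A.m_assoc) (simp add: A.m_assoc[symmetric])
  next
    case (step2 i)
    then show ?case using wc c' by (simp add: upow_minus1 A.m_assoc) (simp add: A.m_assoc[symmetric])
  qed (use wc in simp)
qed

lemma commutant_star: assumes w: "w \<in> commutant" shows "star A w \<in> commutant"
proof -
  have wc: "w \<in> carrier A" using w by (simp add: commutant_def)
  have "star A (upow (-1) \<otimes> w) = star A (w \<otimes> upow (-1))" by (simp only: commutant_upow[OF w])
  then show ?thesis using wc by (simp add: star_mult star_star commutant_def)
qed

lemma commutant_gauge:
  assumes t: "cmod t = 1" and w: "w \<in> commutant" shows "gauge t w \<in> commutant"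
proof -
  have wc: "w \<in> carrier A" using w by (simp add: commutant_def)
  have "gauge t (U \<otimes> w) = gauge t (w \<otimes> U)" using w by (simp add: commutant_def)
  then show ?thesis using wc t star_hom_simps(2)[OF gauge(1)[OF t]] gauge(2)[OF t] by (simp add: commutant_def)
qed

lemma commutant_twirl:
  assumes w: "w \<in> commutant" shows "twirl R k w \<in> commutant"
proof -
  have fc: "k r \<odot> gauge (root_of_unity R r) w \<in> commutant" for r
    by (intro commutant_smult commutant_gauge w) simp
  have "(\<Oplus>r\<in>{..<n}. k r \<odot> gauge (root_of_unity R r) w) \<in> commutant" for n
  proof (induction n)
    case 0 then show ?case by (simp add: commutant_def)
  next
    case (Suc n)
    show ?case
      unfolding finsum_lessThan_Suc[OF commutant_closed[OF fc]] by (rule commutant_add[OF fc Suc])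
  qed
  then show ?thesis by (simp add: twirl_def)
qed

text \<open>Conjugation by a power \<open>u\<close> of \<open>U\<close> fixes \<open>e\<close>, so \<open>x\<close> may be replaced by the mean of \<open>x\<close> and \<open>u x u*\<close>
  without losing precision. By \<open>homog_average\<close> the mean has lower bidegree, and at bidegree \<open>(0, 0)\<close>
  only Laurent polynomials in \<open>U\<close> are left.\<close>

lemma commutant_near_homog_diag:
  assumes e: "e \<in> commutant"
  shows "homog p p x \<Longrightarrow> nrm A (e \<ominus> x) \<le> \<eta> \<Longrightarrow> \<exists>f y. laurent f y \<and> nrm A (e \<ominus> y) \<le> \<eta>"
proof (induction p arbitrary: x)
  case 0
  then show ?case using homog_0_laurent by blast
next
  case (Suc p)
  note xc = homog_closed[OF Suc(2)]
  have ec: "e \<in> carrier A" by (rule commutant_closed[OF e])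
  define u where "u = upow (2 ^ p)"
  have u: "u \<in> carrier A" "is_unitary A u" "star A u = upow (- (2 ^ p))"
    by (auto simp: u_def unitary_upow star_upow)
  define x' where "x' = (1/2) \<odot> (x \<oplus> u \<otimes> x \<otimes> star A u)"
  have x': "homog p p x'" using homog_average[OF Suc(2)] by (simp add: x'_def u_def star_upow)
  have eu: "u \<otimes> e \<otimes> star A u = e"
  proof -
    have "u \<otimes> e = e \<otimes> u" unfolding u_def by (rule commutant_upow[OF e])
    then show ?thesis using u ec by (simp add: A.m_assoc is_unitary_def)
  qed
  have "u \<otimes> (e \<ominus> x) \<otimes> star A u = u \<otimes> e \<otimes> star A u \<ominus> u \<otimes> x \<otimes> star A u"
    using u ec xc by (simp add: A.minus_eq A.l_distr A.r_distr A.l_minus A.r_minus)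
  then have n2: "nrm A (e \<ominus> u \<otimes> x \<otimes> star A u) \<le> \<eta>"
    using nrm_unitary_conj[OF u(2), of "e \<ominus> x"] Suc(3) ec xc by (simp add: eu)
  have e2: "e = (1/2) \<odot> (e \<oplus> e)"
    using ec smult_add_left[of e "1/2" "1/2"] by (simp add: smult_add_right)
  have "nrm A ((1/2) \<odot> (e \<oplus> e) \<ominus> x') \<le> \<eta>"
    using nrm_add_diff[of e e x "u \<otimes> x \<otimes> star A u"] ec xc u Suc(3) n2
    by (simp add: x'_def nrm_smult_diff)
  then show ?case using Suc(1)[OF x'] e2 by simp
qed

text \<open>At a point \<open>z\<close> with \<open>z\<^bsup>dj\<^esup> = -1\<close> the hypothesis gives \<open>2 |f(z)| \<le> \<delta>\<close>. Such points come arbitrarily close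
  to any point of the circle when \<open>j\<close> grows, and \<open>f\<close> is continuous.\<close>

lemma laurent_le_of_shifted:
  assumes f: "laurent f y" and d: "d \<noteq> 0" and \<delta>: "\<And>j. nrm A (y \<ominus> upow (d * j) \<otimes> y) \<le> \<delta>"
  shows "nrm A y \<le> \<delta>"
proof (rule laurent_nrm_le[OF f])
  fix z0 :: complex assume z0: "cmod z0 = 1"
  have \<delta>0: "0 \<le> \<delta>" using \<delta>[of 0] laurent_closed[OF f] by simp
  show "cmod (f z0) \<le> \<delta>"
  proof (rule field_le_epsilon)
    fix e :: real assume e: "e > 0"
    have "z0 \<in> sphere 0 1" using z0 by simp
    then have "\<exists>r>0. \<forall>z\<in>sphere 0 1. dist z z0 < r \<longrightarrow> dist (f z) (f z0) < e"
      using laurent_continuous[OF f] e unfolding continuous_on_iff by blast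
    then obtain r where r: "r > 0" "\<And>z. cmod z = 1 \<Longrightarrow> dist z z0 < r \<Longrightarrow> dist (f z) (f z0) < e"
      by auto
    obtain n :: nat where n: "2 * pi / r < n" using reals_Archimedean2 by blast
    have n0: "n > 0"
    proof -
      have "0 < 2 * pi / r" using r(1) by simp
      then have "0 < real n" using n by linarith
      then show ?thesis by simp
    qed
    define K where "K = nat \<bar>d\<bar> * n"
    have K: "K > 0" "n \<le> K" using d n0 by (auto simp: K_def)
    obtain z where z: "cmod z = 1" "z ^ K = -1" "cmod (z - z0) \<le> 2 * pi / K"
      using circle_root_near[OF z0, of "-1" K] K by auto
    have "2 * pi / K \<le> 2 * pi / n" using K n0 by (intro divide_left_mono) auto
    also have "\<dots> < r" using n n0 r(1) by (simp add: field_simps)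
    finally have "dist z z0 < r" using z(3) by (simp add: dist_norm)
    then have "cmod (f z - f z0) < e" using r(2)[OF z(1)] by (simp add: dist_norm)
    moreover have "cmod (f z) \<le> \<delta>"
    proof -
      \<comment> \<open>The sign makes the exponent \<open>d j\<close> equal to the positive number \<open>K\<close>.\<close>
      define j where "j = sgn d * int n"
      have dj: "d * j = int K" using d by (cases "d > 0") (auto simp: j_def K_def)
      have "laurent (\<lambda>z. f z - z powi (d * j) * f z) (y \<ominus> upow (d * j) \<otimes> y)"
        by (intro laurent_diff laurent_mult laurent_upow f)
      then have "cmod (f z - z powi (d * j) * f z) \<le> \<delta>" using laurent_le_nrm[OF _ z(1)] \<delta>[of j] order_trans by blast
      moreover have "f z - z powi (d * j) * f z = 2 * f z" using z(2) by (simp add: dj)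
      ultimately have "2 * cmod (f z) \<le> \<delta>" by (simp add: norm_mult)
      then show ?thesis using norm_ge_zero[of "f z"] by linarith
    qed
    moreover have "cmod (f z0) \<le> cmod (f z) + cmod (f z - f z0)" by norm
    ultimately show "cmod (f z0) \<le> \<delta> + e" by linarith
  qed
qed

text \<open>The bound makes \<open>e\<close>, if its norm is at most a fixed number, as small as one likes when \<open>\<eta>\<close> is. The
  element \<open>e\<close> is almost invariant under multiplication by \<open>U\<^bsup>dj\<^esup>\<close>. As \<open>e\<close> itself is not known to be a
  function of \<open>U\<close>, the argument passes to \<open>e e*\<close>, which lies near bidegree \<open>(p, p)\<close>.\<close>

lemma commutant_near_homog_offdiag:
  assumes e: "e \<in> commutant" and x: "homog p q x" and pq: "p \<noteq> q" and \<eta>: "nrm A (e \<ominus> x) \<le> \<eta>"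
  shows "(nrm A e)\<^sup>2 \<le> \<eta> * (8 * nrm A e + 3 * \<eta>)"
proof -
  have ec: "e \<in> carrier A" by (rule commutant_closed[OF e])
  note xc = homog_closed[OF x]
  define a where "a = nrm A e"
  define d where "d = (2 ^ p - 2 ^ q :: int)"
  have d: "d \<noteq> 0" using pq by (simp add: d_def)
  have a0: "0 \<le> a" "0 \<le> \<eta>" using ec xc \<eta> nrm_nonneg[of e] nrm_nonneg[of "e \<ominus> x"] by (auto simp: a_def)
  \<comment> \<open>Both \<open>x\<close> and its conjugate, which is \<open>x\<close> multiplied by a power of \<open>U\<close>, are within \<open>\<eta>\<close> of \<open>e\<close>.\<close>
  have shift: "nrm A (e \<ominus> upow (d * j) \<otimes> e) \<le> 2 * \<eta>" for j
  proof -
    define u where "u = upow (2 ^ q * j)"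
    have u: "u \<in> carrier A" "is_unitary A u" "star A u = upow (2 ^ q * - j)"
      by (auto simp: u_def unitary_upow star_upow)
    have "u \<otimes> e = e \<otimes> u" unfolding u_def by (rule commutant_upow[OF e])
    then have eu: "u \<otimes> e \<otimes> star A u = e" using u ec by (simp add: A.m_assoc is_unitary_def)
    have xu: "u \<otimes> x \<otimes> star A u = upow (- (d * j)) \<otimes> x"
    proof -
      have "u \<otimes> x \<otimes> star A u = u \<otimes> (x \<otimes> upow (2 ^ q * - j))" using u xc by (simp add: A.m_assoc)
      also have "\<dots> = u \<otimes> upow (2 ^ p * - j) \<otimes> x" unfolding homog_shift[OF x] using u xc by (simp add: A.m_assoc)
      also have "u \<otimes> upow (2 ^ p * - j) = upow (- (d * j))"
        unfolding u_def upow_add[symmetric] by (simp add: d_def algebra_simps)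
      finally show ?thesis .
    qed
    have "u \<otimes> (e \<ominus> x) \<otimes> star A u = e \<ominus> upow (- (d * j)) \<otimes> x"
      using u ec xc xu eu by (simp add: A.minus_eq A.l_distr A.r_distr A.l_minus A.r_minus)
    then have 1: "nrm A (e \<ominus> upow (- (d * j)) \<otimes> x) \<le> \<eta>"
      using nrm_unitary_conj[OF u(2), of "e \<ominus> x"] \<eta> ec xc by simp
    have "upow (d * j) \<otimes> (e \<ominus> upow (- (d * j)) \<otimes> x) = upow (d * j) \<otimes> e \<ominus> x"
      using ec xc by (simp add: A.minus_eq A.r_distr A.r_minus A.m_assoc[symmetric])
    then have "nrm A (upow (d * j) \<otimes> e \<ominus> x) \<le> \<eta>"
      using nrm_unitary_mult[OF unitary_upow, of "e \<ominus> upow (- (d * j)) \<otimes> x" "d * j"] 1 ec xc by simp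
    then show ?thesis
      using nrm_diff_triangle[OF ec xc, of "upow (d * j) \<otimes> e"] nrm_diff_commute[OF xc, of "upow (d * j) \<otimes> e"]
        \<eta> ec by simp
  qed
  define h where "h = e \<otimes> star A e"
  have h: "h \<in> commutant" unfolding h_def by (intro commutant_mult commutant_star e)
  have hc: "h \<in> carrier A" by (rule commutant_closed[OF h])
  have nh: "nrm A h = a\<^sup>2" using cstar_identity[of "star A e"] ec by (simp add: h_def a_def star_star)
  have nx: "nrm A x \<le> a + \<eta>"
    using nrm_diff_ineq[OF xc ec] nrm_diff_commute[OF xc ec] \<eta> by (simp add: a_def)
  have "nrm A (h \<ominus> x \<otimes> star A x) \<le> nrm A (e \<ominus> x) * nrm A (star A e) + nrm A x * nrm A (star A e \<ominus> star A x)"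
    unfolding h_def by (rule nrm_mult_diff) (use ec xc in auto)
  also have "nrm A (star A e \<ominus> star A x) = nrm A (e \<ominus> x)"
    using nrm_star[of "e \<ominus> x"] ec xc by (simp add: star_diff)
  also have "nrm A (e \<ominus> x) * nrm A (star A e) + nrm A x * nrm A (e \<ominus> x) \<le> \<eta> * a + (a + \<eta>) * \<eta>"
    using \<eta> nx a0 ec xc by (intro add_mono mult_mono) (auto simp: a_def nrm_nonneg)
  finally have "nrm A (h \<ominus> x \<otimes> star A x) \<le> \<eta> * (2 * a + \<eta>)" by (simp add: algebra_simps)
  then obtain f y where y: "laurent f y" "nrm A (h \<ominus> y) \<le> \<eta> * (2 * a + \<eta>)"
    using commutant_near_homog_diag[OF h homog_mult[OF x homog_star[OF x]]] by blast
  note yc = laurent_closed[OF y(1)]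
  have yb: "nrm A y \<le> \<eta> * (6 * a + 2 * \<eta>)"
  proof (rule laurent_le_of_shifted[OF y(1) d])
    fix j
    define u where "u = upow (d * j)"
    have u: "u \<in> carrier A" "is_unitary A u" by (auto simp: u_def unitary_upow)
    have "h \<ominus> u \<otimes> h = (e \<ominus> u \<otimes> e) \<otimes> star A e"
      using u ec by (simp add: h_def A.minus_eq A.l_distr A.l_minus A.m_assoc)
    then have "nrm A (h \<ominus> u \<otimes> h) \<le> nrm A (e \<ominus> u \<otimes> e) * a"
      using nrm_mult[of "e \<ominus> u \<otimes> e" "star A e"] u ec by (simp add: a_def)
    also have "\<dots> \<le> 2 * \<eta> * a" using shift[of j] a0 unfolding u_def by (intro mult_right_mono)
    finally have 1: "nrm A (h \<ominus> u \<otimes> h) \<le> 2 * \<eta> * a" .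
    have "u \<otimes> h \<ominus> u \<otimes> y = u \<otimes> (h \<ominus> y)" using u hc yc by (simp add: A.minus_eq A.r_distr A.r_minus)
    then have 2: "nrm A (u \<otimes> h \<ominus> u \<otimes> y) \<le> \<eta> * (2 * a + \<eta>)"
      using nrm_unitary_mult[OF u(2), of "h \<ominus> y"] y(2) hc yc by simp
    have "nrm A (y \<ominus> u \<otimes> y) \<le> nrm A (h \<ominus> y) + nrm A (h \<ominus> u \<otimes> h) + nrm A (u \<otimes> h \<ominus> u \<otimes> y)"
      using nrm_diff_triangle[OF yc hc, of "u \<otimes> y"] nrm_diff_triangle[OF hc, of "u \<otimes> h" "u \<otimes> y"]
        nrm_diff_commute[OF yc hc] u hc yc by simp
    then show "nrm A (y \<ominus> upow (d * j) \<otimes> y) \<le> \<eta> * (6 * a + 2 * \<eta>)"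
      using 1 2 y(2) unfolding u_def[symmetric] by (simp add: algebra_simps)
  qed
  have "a\<^sup>2 \<le> nrm A y + nrm A (h \<ominus> y)" using nrm_diff_ineq[OF hc yc] nh by simp
  then show ?thesis using yb y(2) by (simp add: a_def algebra_simps)
qed

text \<open>For \<open>R\<close> beyond all degrees that occur, the average is the component of degree \<open>m\<close>. It has some
  bidegree \<open>(p, q)\<close> with \<open>p - q = m\<close>, as components of equal degree can be raised to a common bidegree.\<close>

lemma homog_sum_fourier:
  "homog_sum x \<Longrightarrow> \<exists>D. \<forall>m R. D + \<bar>m\<bar> < int R \<longrightarrow> (\<exists>p q. int p - int q = m \<and> homog p q (twirl R (fourier_weight R m) x))"
proof (induction rule: homog_sum.induct)
  case (single p q x)
  have "\<exists>p' q'. int p' - int q' = m \<and> homog p' q' (twirl R (fourier_weight R m) x)"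
    if R: "\<bar>int p - int q\<bar> + \<bar>m\<bar> < int R" for m R
  proof -
    have "\<bar>(int p - int q) - m\<bar> < int R" using R by linarith
    then have tw: "twirl R (fourier_weight R m) x = (if int p - int q = m then 1 else 0) \<odot> x"
      unfolding twirl_homog[OF single] by (simp only: fourier_weight_sum)
    show ?thesis
    proof (cases "int p - int q = m")
      case True then show ?thesis using tw single homog_closed[OF single] by auto
    next
      case False
      then have "twirl R (fourier_weight R m) x = \<zero>" using tw homog_closed[OF single] by simp
      moreover have "int (nat m) - int (nat (- m)) = m" by simp
      ultimately show ?thesis using homog_zero by metis
    qed
  qed
  then show ?case by blast
next
  case (add x y)
  obtain D where D: "\<And>m R. D + \<bar>m\<bar> < int R \<Longrightarrow> \<exists>p q. int p - int q = m \<and> homog p q (twirl R (fourier_weight R m) x)" using add by blast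
  obtain E where E: "\<And>m R. E + \<bar>m\<bar> < int R \<Longrightarrow> \<exists>p q. int p - int q = m \<and> homog p q (twirl R (fourier_weight R m) y)" using add by blast
  have "\<exists>p q. int p - int q = m \<and> homog p q (twirl R (fourier_weight R m) (x \<oplus> y))" if R: "max D E + \<bar>m\<bar> < int R" for m R
  proof -
    have "D + \<bar>m\<bar> < int R" "E + \<bar>m\<bar> < int R"
      using R max.cobounded1[of D E] max.cobounded2[of E D] by linarith+
    then obtain p q p' q' where p: "int p - int q = m" "homog p q (twirl R (fourier_weight R m) x)"
      and p': "int p' - int q' = m" "homog p' q' (twirl R (fourier_weight R m) y)"
      using D E by blast
    have "p' + p = p + p'" "q' + p = q + p'" using p(1) p'(1) by linarith+
    then have My: "homog (p + p') (q + p') (twirl R (fourier_weight R m) y)"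
      using homog_raise[OF p'(2), of p] by metis
    have "homog (p + p') (q + p') (twirl R (fourier_weight R m) (x \<oplus> y))"
      unfolding twirl_add[OF homog_sum_closed[OF add(1)] homog_sum_closed[OF add(2)]]
      by (rule homog.add[OF homog_raise[OF p(2)] My])
    moreover have "int (p + p') - int (q + p') = m" using p(1) by simp
    ultimately show ?thesis by blast
  qed
  then show ?case by blast
qed

lemma homog_sum_fejer:
  "homog_sum x \<Longrightarrow> \<epsilon> > 0 \<Longrightarrow> \<exists>N0>0. \<forall>N\<ge>N0. \<exists>R0. \<forall>R\<ge>R0. nrm A (twirl R (fejer_weight R N) x \<ominus> x) \<le> \<epsilon>"
proof (induction arbitrary: \<epsilon> rule: homog_sum.induct)
  case (single p q x)
  note xc = homog_closed[OF single(1)]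
  define d where "d = int p - int q"
  obtain n :: nat where n: "\<bar>real_of_int d\<bar> * nrm A x / \<epsilon> < n" using reals_Archimedean2 by blast
  have "nrm A (twirl R (fejer_weight R N) x \<ominus> x) \<le> \<epsilon>" if N: "N \<ge> max 1 n" and R: "R \<ge> N + nat \<bar>d\<bar> + 1" for N R
  proof -
    have N0: "N > 0" "int N + \<bar>d\<bar> < int R" using N R by auto
    obtain t where t: "(\<Sum>r<R. fejer_weight R N r * root_of_unity R r powi d) = complex_of_real t"
      "\<bar>t - 1\<bar> \<le> \<bar>real_of_int d\<bar> / N" using fejer_weight_sum[OF N0(2,1)] by blast
    have "twirl R (fejer_weight R N) x \<ominus> x = complex_of_real (t - 1) \<odot> x"
      unfolding twirl_homog[OF single(1)] d_def[symmetric] t(1) using xc by (simp add: smult_diff_left)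
    then have "nrm A (twirl R (fejer_weight R N) x \<ominus> x) = \<bar>t - 1\<bar> * nrm A x"
      using xc by (simp add: nrm_smult del: of_real_diff)
    also have "\<dots> \<le> \<bar>real_of_int d\<bar> / N * nrm A x" using t(2) xc by (intro mult_right_mono) (auto simp: nrm_nonneg)
    also have "\<dots> \<le> \<epsilon>"
    proof -
      have "\<bar>real_of_int d\<bar> * nrm A x \<le> n * \<epsilon>" using n single(2) by (simp add: pos_divide_less_eq)
      also have "\<dots> \<le> real N * \<epsilon>" using N single(2) by (intro mult_right_mono) auto
      finally show ?thesis using N0 by (simp add: field_simps)
    qed
    finally show ?thesis .
  qed
  then show ?case by (intro exI[of _ "max 1 n"]) auto
next
  case (add x y)
  note c = homog_sum_closed[OF add(1)] homog_sum_closed[OF add(2)]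
  have e2: "\<epsilon> / 2 > 0" using add by simp
  obtain N1 where N1: "N1 > 0" "\<forall>N\<ge>N1. \<exists>R0. \<forall>R\<ge>R0. nrm A (twirl R (fejer_weight R N) x \<ominus> x) \<le> \<epsilon> / 2" using add.IH(1)[OF e2] by blast
  obtain N2 where N2: "N2 > 0" "\<forall>N\<ge>N2. \<exists>R0. \<forall>R\<ge>R0. nrm A (twirl R (fejer_weight R N) y \<ominus> y) \<le> \<epsilon> / 2" using add.IH(2)[OF e2] by blast
  have "\<exists>R0. \<forall>R\<ge>R0. nrm A (twirl R (fejer_weight R N) (x \<oplus> y) \<ominus> (x \<oplus> y)) \<le> \<epsilon>" if N: "N \<ge> max N1 N2" for N
  proof -
    obtain R1 where R1: "\<forall>R\<ge>R1. nrm A (twirl R (fejer_weight R N) x \<ominus> x) \<le> \<epsilon> / 2" using N1 N by auto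
    obtain R2 where R2: "\<forall>R\<ge>R2. nrm A (twirl R (fejer_weight R N) y \<ominus> y) \<le> \<epsilon> / 2" using N2 N by auto
    have "nrm A (twirl R (fejer_weight R N) (x \<oplus> y) \<ominus> (x \<oplus> y)) \<le> \<epsilon>" if R: "R \<ge> max R1 R2" for R
    proof -
      have "nrm A (twirl R (fejer_weight R N) (x \<oplus> y) \<ominus> (x \<oplus> y))
          \<le> nrm A (twirl R (fejer_weight R N) x \<ominus> x) + nrm A (twirl R (fejer_weight R N) y \<ominus> y)"
        unfolding twirl_add[OF c] by (rule nrm_add_diff) (use c in auto)
      also have "\<dots> \<le> \<epsilon> / 2 + \<epsilon> / 2" using R1 R2 R by (intro add_mono) auto
      finally show ?thesis by simp
    qed
    then show ?thesis by blast
  qed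
  then show ?case using N1(1) by (intro exI[of _ "max N1 N2"]) auto
qed

lemma twirl_fourier_close:
  assumes w: "w \<in> carrier A" and x: "x \<in> carrier A" and \<eta>: "nrm A (w \<ominus> x) \<le> \<eta>"
  shows "nrm A (twirl R (fourier_weight R m) w \<ominus> twirl R (fourier_weight R m) x) \<le> \<eta>"
proof -
  have "nrm A (twirl R (fourier_weight R m) (w \<ominus> x)) \<le> (\<Sum>r<R. cmod (fourier_weight R m r)) * nrm A (w \<ominus> x)"
    using w x by (intro twirl_nrm) auto
  also have "\<dots> \<le> 1 * nrm A (w \<ominus> x)"
    using w x norm_fourier_weight_sum by (intro mult_right_mono) (auto simp: nrm_nonneg)
  finally show ?thesis using \<eta> twirl_diff[OF w x] by simp
qed

text \<open>The average is an element of the commutant close to one of bidegree \<open>(p, q)\<close> with \<open>p - q = m \<noteq> 0\<close>.\<close>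

lemma commutant_fourier_nonzero:
  assumes w: "w \<in> commutant" and m: "m \<noteq> 0" and \<delta>: "\<delta> > 0"
  shows "\<exists>R0. \<forall>R\<ge>R0. nrm A (twirl R (fourier_weight R m) w) \<le> \<delta>"
proof -
  have wc: "w \<in> carrier A" by (rule commutant_closed[OF w])
  define a where "a = nrm A w"
  have a0: "0 \<le> a" using wc by (simp add: a_def nrm_nonneg)
  \<comment> \<open>Chosen so that the bound \<open>\<eta> (8 a + 3 \<eta>)\<close> of \<open>commutant_near_homog_offdiag\<close> is at most \<open>\<delta>\<^sup>2\<close>.\<close>
  define \<eta> where "\<eta> = min 1 (\<delta>\<^sup>2 / (8 * a + 3))"
  have "\<eta> \<le> \<delta>\<^sup>2 / (8 * a + 3)" by (simp add: \<eta>_def)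
  then have "\<eta> * (8 * a + 3) \<le> \<delta>\<^sup>2" using a0 by (subst (asm) pos_le_divide_eq) auto
  moreover have "0 < \<eta>" "\<eta> \<le> 1" using a0 \<delta> by (auto simp: \<eta>_def)
  ultimately have \<eta>: "0 < \<eta>" "\<eta> \<le> 1" "\<eta> * (8 * a + 3) \<le> \<delta>\<^sup>2" by auto
  obtain x where x: "homog_sum x" "nrm A (w \<ominus> x) < \<eta>" using homog_sum_dense[OF wc \<eta>(1)] by blast
  note xc = homog_sum_closed[OF x(1)]
  obtain D where D: "\<And>m R. D + \<bar>m\<bar> < int R \<Longrightarrow> \<exists>p q. int p - int q = m \<and> homog p q (twirl R (fourier_weight R m) x)"
    using homog_sum_fourier[OF x(1)] by blast
  have "nrm A (twirl R (fourier_weight R m) w) \<le> \<delta>" if R: "R \<ge> nat (D + \<bar>m\<bar> + 1)" for R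
  proof -
    define e where "e = twirl R (fourier_weight R m) w"
    have e: "e \<in> commutant" unfolding e_def by (rule commutant_twirl[OF w])
    have "D + \<bar>m\<bar> < int R" using R by (simp add: nat_le_iff)
    then obtain p q where pq: "int p - int q = m" "homog p q (twirl R (fourier_weight R m) x)" using D by blast
    have "p \<noteq> q" using pq m by auto
    moreover have "nrm A (e \<ominus> twirl R (fourier_weight R m) x) \<le> \<eta>"
      unfolding e_def by (rule twirl_fourier_close[OF wc xc]) (use x in simp)
    ultimately have "(nrm A e)\<^sup>2 \<le> \<eta> * (8 * nrm A e + 3 * \<eta>)"
      using commutant_near_homog_offdiag[OF e pq(2)] by blast
    also have "\<dots> \<le> \<eta> * (8 * a + 3)"
    proof -
      have "nrm A e \<le> (\<Sum>r<R. cmod (fourier_weight R m r)) * nrm A w" unfolding e_def by (rule twirl_nrm[OF wc])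
      also have "\<dots> \<le> 1 * nrm A w" using wc norm_fourier_weight_sum by (intro mult_right_mono) (auto simp: nrm_nonneg)
      finally show ?thesis using \<eta> by (intro mult_left_mono) (auto simp: a_def)
    qed
    also have "\<dots> \<le> \<delta>\<^sup>2" by (rule \<eta>)
    finally have "(nrm A e)\<^sup>2 \<le> \<delta>\<^sup>2" .
    from power2_le_imp_le[OF this] show ?thesis using \<delta> by (simp add: e_def)
  qed
  then show ?thesis by blast
qed

lemma commutant_fourier_zero:
  assumes w: "w \<in> commutant" and \<delta>: "\<delta> > 0"
  shows "\<exists>R0. \<forall>R\<ge>R0. \<exists>f y. laurent f y \<and> nrm A (twirl R (fourier_weight R 0) w \<ominus> y) \<le> \<delta>"
proof -
  have wc: "w \<in> carrier A" by (rule commutant_closed[OF w])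
  obtain x where x: "homog_sum x" "nrm A (w \<ominus> x) < \<delta>" using homog_sum_dense[OF wc \<delta>] by blast
  note xc = homog_sum_closed[OF x(1)]
  obtain D where D: "\<And>m R. D + \<bar>m\<bar> < int R \<Longrightarrow> \<exists>p q. int p - int q = m \<and> homog p q (twirl R (fourier_weight R m) x)"
    using homog_sum_fourier[OF x(1)] by blast
  have "\<exists>f y. laurent f y \<and> nrm A (twirl R (fourier_weight R 0) w \<ominus> y) \<le> \<delta>" if R: "R \<ge> nat (D + 1)" for R
  proof -
    have "D + \<bar>0\<bar> < int R" using R by (simp add: nat_le_iff)
    then obtain p q where pq: "int p - int q = 0" "homog p q (twirl R (fourier_weight R 0) x)" using D by blast
    then have "homog p p (twirl R (fourier_weight R 0) x)" by simp
    moreover have "nrm A (twirl R (fourier_weight R 0) w \<ominus> twirl R (fourier_weight R 0) x) \<le> \<delta>"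
      by (rule twirl_fourier_close[OF wc xc]) (use x in simp)
    ultimately show ?thesis using commutant_near_homog_diag[OF commutant_twirl[OF w]] by blast
  qed
  then show ?thesis by blast
qed

text \<open>\<open>C*(U)\<close> is maximal abelian. Given \<open>w\<close> in the commutant, fix \<open>N\<close> such that the averages \<open>F\<close> of \<open>w\<close> with
  Fejer weights are close to \<open>w\<close> for all large \<open>R\<close>. Apart from the terms of degree \<open>0\<close>, which add up to a
  single average \<open>E\<close> close to \<open>C*(U)\<close>, \<open>F\<close> is a combination of fewer than \<open>N\<^sup>2\<close> averages of nonzero degree, which
  tend to \<open>0\<close> as \<open>R\<close> grows and \<open>N\<close> remains fixed.\<close>

theorem commutant_eq_generated: "commutant = cstar_generated A {U}"
proof
  show "cstar_generated A {U} \<subseteq> commutant"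
  proof
    fix y assume "y \<in> cstar_generated A {U}"
    then obtain f where f: "symbol f y" using generated_iff_symbol by blast
    then show "y \<in> commutant" using symbol_commute[OF symbol_U f] symbol_closed[OF f] by (simp add: commutant_def)
  qed
  show "commutant \<subseteq> cstar_generated A {U}"
  proof
    fix w assume w: "w \<in> commutant"
    have wc: "w \<in> carrier A" by (rule commutant_closed[OF w])
    have "\<exists>y\<in>{y. \<exists>f. laurent f y}. nrm A (w \<ominus> y) < e" if e: "e > 0" for e
    proof -
      define \<eta> where "\<eta> = e / 6"
      have \<eta>: "\<eta> > 0" using e by (simp add: \<eta>_def)
      obtain x where x: "homog_sum x" "nrm A (w \<ominus> x) < \<eta>" using homog_sum_dense[OF wc \<eta>] by blast
      note xc = homog_sum_closed[OF x(1)]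
      obtain N where N: "N > 0" "\<exists>R0. \<forall>R\<ge>R0. nrm A (twirl R (fejer_weight R N) x \<ominus> x) \<le> \<eta>"
        using homog_sum_fejer[OF x(1) \<eta>] by blast
      then obtain R1 where R1: "\<And>R. R \<ge> R1 \<Longrightarrow> nrm A (twirl R (fejer_weight R N) x \<ominus> x) \<le> \<eta>" by blast
      obtain R2 where R2: "\<And>R. R \<ge> R2 \<Longrightarrow> \<exists>f y. laurent f y \<and> nrm A (twirl R (fourier_weight R 0) w \<ominus> y) \<le> \<eta>"
        using commutant_fourier_zero[OF w \<eta>] by blast
      \<comment> \<open>The pairs that contribute the terms of nonzero degree \<open>l - j\<close> to the Fejer weights.\<close>
      define I where "I = {(j, l). j < N \<and> l < N \<and> j \<noteq> l}"
      have fI: "finite I" by (rule finite_subset[of _ "{..<N} \<times> {..<N}"]) (auto simp: I_def)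
      have "\<forall>i\<in>I. \<exists>R0. \<forall>R\<ge>R0. nrm A (twirl R (fourier_weight R (int (snd i) - int (fst i))) w) \<le> \<eta> / N"
        using \<eta> N(1) by (intro ballI commutant_fourier_nonzero w) (auto simp: I_def)
      then obtain R3 where R3: "\<And>i R. i \<in> I \<Longrightarrow> R \<ge> R3 i \<Longrightarrow> nrm A (twirl R (fourier_weight R (int (snd i) - int (fst i))) w) \<le> \<eta> / N"
        by metis
      define R where "R = Max (R3 ` I \<union> {R1, R2, N + 1})"
      have "n \<le> R" if "n \<in> R3 ` I \<union> {R1, R2, N + 1}" for n
        unfolding R_def using that fI by (intro Max_ge) auto
      then have R: "R \<ge> R1" "R \<ge> R2" "R \<ge> N + 1" "\<And>i. i \<in> I \<Longrightarrow> R \<ge> R3 i" by auto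
      define F where "F = twirl R (fejer_weight R N) w"
      define E where "E = twirl R (fourier_weight R 0) w"
      have FE: "F \<in> carrier A" "E \<in> carrier A" using wc by (auto simp: F_def E_def)
      have 1: "nrm A (F \<ominus> twirl R (fejer_weight R N) x) \<le> \<eta>"
      proof -
        have "nrm A (twirl R (fejer_weight R N) (w \<ominus> x)) \<le> (\<Sum>r<R. cmod (fejer_weight R N r)) * nrm A (w \<ominus> x)"
          using wc xc by (intro twirl_nrm) auto
        then show ?thesis using norm_fejer_weight_sum[of N R] N R(3) x twirl_diff[OF wc xc] by (simp add: F_def)
      qed
      have 2: "nrm A (w \<ominus> F) \<le> 3 * \<eta>"
        using nrm_diff_triangle[OF wc xc FE(1)] nrm_diff_triangle[OF xc _ FE(1), of "twirl R (fejer_weight R N) x"]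
          nrm_diff_commute[OF xc, of "twirl R (fejer_weight R N) x"] nrm_diff_commute[OF FE(1), of "twirl R (fejer_weight R N) x"]
          1 R1[OF R(1)] x xc by simp
      have 3: "nrm A (F \<ominus> E) \<le> \<eta>"
      proof -
        define k where "k i r = fourier_weight R (int (snd i) - int (fst i)) r / of_nat N" for i :: "nat \<times> nat" and r
        have split: "fejer_weight R N r = fourier_weight R 0 r + (\<Sum>i\<in>I. k i r)" for r
        proof -
          have "(\<Sum>j<N. \<Sum>l<N. fourier_weight R (int l - int j) r / N) = (\<Sum>i\<in>{..<N} \<times> {..<N}. k i r)"
            by (simp add: sum.cartesian_product k_def case_prod_beta)
          also have "{..<N} \<times> {..<N} = I \<union> (\<lambda>j. (j, j)) ` {..<N}" by (auto simp: I_def)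
          also have "(\<Sum>i\<in>I \<union> (\<lambda>j. (j, j)) ` {..<N}. k i r) = (\<Sum>i\<in>I. k i r) + (\<Sum>i\<in>(\<lambda>j. (j, j)) ` {..<N}. k i r)"
            using fI by (intro sum.union_disjoint) (auto simp: I_def)
          also have "(\<Sum>i\<in>(\<lambda>j. (j, j)) ` {..<N}. k i r) = (\<Sum>j<N. k (j, j) r)"
            by (subst sum.reindex) (auto simp: inj_on_def)
          also have "\<dots> = fourier_weight R 0 r" using N(1) by (simp add: k_def)
          finally show ?thesis by (simp add: fejer_weight_def sum_divide_distrib)
        qed
        have "fejer_weight R N r \<odot> v = fourier_weight R 0 r \<odot> v \<oplus> (\<Sum>i\<in>I. k i r) \<odot> v" if "v \<in> carrier A" for r v
          unfolding split using that by (rule smult_add_left)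
        then have "F = E \<oplus> twirl R (\<lambda>r. \<Sum>i\<in>I. k i r) w"
          using wc unfolding F_def E_def twirl_def by (subst A.finsum_addf[symmetric]) auto
        moreover have "E \<oplus> v \<ominus> E = v" if "v \<in> carrier A" for v using that FE(2) by algebra
        ultimately have "F \<ominus> E = twirl R (\<lambda>r. \<Sum>i\<in>I. k i r) w" using wc by simp
        then have "nrm A (F \<ominus> E) \<le> (\<Sum>i\<in>I. nrm A (twirl R (k i) w))" using twirl_weight_sum[OF wc fI, of R k] by simp
        also have "\<dots> \<le> (\<Sum>i\<in>I. \<eta> / (real N * real N))"
        proof (rule sum_mono)
          fix i assume i: "i \<in> I"
          have "k i r \<odot> v = (1 / of_nat N) \<odot> (fourier_weight R (int (snd i) - int (fst i)) r \<odot> v)" if "v \<in> carrier A" for r v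
            using that by (simp add: smult_smult k_def)
          moreover have "fourier_weight R m r \<odot> gauge (root_of_unity R r) (c \<odot> w) = c \<odot> (fourier_weight R m r \<odot> gauge (root_of_unity R r) w)" for m r c
            using wc star_hom_simps(5)[OF gauge(1)[OF norm_root_of_unity]] by (simp add: smult_smult mult.commute)
          ultimately have "twirl R (k i) w = twirl R (fourier_weight R (int (snd i) - int (fst i))) ((1 / of_nat N) \<odot> w)"
            using wc unfolding twirl_def by simp
          then have "nrm A (twirl R (k i) w) = nrm A (twirl R (fourier_weight R (int (snd i) - int (fst i))) w) / N"
            using wc by (simp add: twirl_smult nrm_smult norm_divide)
          then show "nrm A (twirl R (k i) w) \<le> \<eta> / (real N * real N)"
            using R3[OF i R(4)[OF i]] N(1) by (simp add: field_simps)
        qed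
        also have "\<dots> = card I * (\<eta> / (real N * real N))" by simp
        also have "\<dots> \<le> (real N * real N) * (\<eta> / (real N * real N))"
        proof (rule mult_right_mono)
          have "card I \<le> card ({..<N} \<times> {..<N})" by (rule card_mono) (auto simp: I_def)
          then have "card I \<le> N * N" by (simp add: card_cartesian_product)
          then show "real (card I) \<le> real N * real N" by (metis of_nat_le_iff of_nat_mult)
        qed (use \<eta> in simp)
        also have "\<dots> = \<eta>" using N(1) by simp
        finally show ?thesis .
      qed
      obtain f y where y: "laurent f y" "nrm A (E \<ominus> y) \<le> \<eta>" using R2[OF R(2)] unfolding E_def by blast
      have "nrm A (w \<ominus> y) \<le> 5 * \<eta>"
        using nrm_diff_triangle[OF wc FE(1) laurent_closed[OF y(1)]] nrm_diff_triangle[OF FE laurent_closed[OF y(1)]] 2 3 y(2) by simp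
      then have "nrm A (w \<ominus> y) < e" using e by (simp add: \<eta>_def)
      then show ?thesis using y(1) by blast
    qed
    then have "w \<in> norm_closure {y. \<exists>f. laurent f y}" using wc by (simp add: norm_closure_def)
    then show "w \<in> cstar_generated A {U}" using closure_imp_symbol symbol_generated by blast
  qed
qed

section \<open>Endomorphisms fixing the unitary\<close>

text \<open>The element \<open>W = V S* + U V S* U*\<close>, with \<open>V = \<Lambda>(S)\<close>, maps the range of \<open>S\<close> to that of \<open>V\<close> and the range of
  \<open>U S\<close> to that of \<open>U V\<close>. It commutes with \<open>U\<close>, because \<open>U S* U* = S* U\<close> and \<open>U\<^sup>2 V = V U\<close>, and is
  therefore a function of \<open>U\<close>.\<close>

lemma hom_fixing_U_imp_symbol:
  assumes \<Lambda>: "\<Lambda> \<in> star_hom A A" and U: "\<Lambda> U = U"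
  shows "\<exists>f\<in>circle_maps. \<exists>W. symbol f W \<and> \<Lambda> S = W \<otimes> S"
proof -
  note h = star_hom_simps[OF \<Lambda>]
  define V where "V = \<Lambda> S"
  have V: "V \<in> carrier A" by (simp add: V_def h(1))
  have pV: "two_adic_pair A U V"
  proof -
    have hV: "\<Lambda> (star A S) = star A V" "\<Lambda> (star A U) = star A U"
      using h(6)[OF S_closed] h(6)[OF U_closed] U by (simp_all add: V_def)
    have "star A V \<otimes> V = \<one>"
      using arg_cong[OF TS, of \<Lambda>] h(2)[of T S] h(4) hV by (simp add: V_def)
    moreover have "V \<otimes> U = U \<otimes> U \<otimes> V"
      using arg_cong[OF SU, of \<Lambda>] h(2) U by (simp add: V_def)
    moreover have "V \<otimes> star A V \<oplus> U \<otimes> V \<otimes> star A V \<otimes> star A U = \<one>"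
      using arg_cong[OF range_sum, of \<Lambda>] h(2,3) h(4) hV U by (simp add: V_def)
    ultimately show ?thesis using unitary V by (simp add: two_adic_pair_def is_isometry_def)
  qed
  interpret V: two_adic A U V by unfold_locales (rule pV)
  define W where "W = V \<otimes> T \<oplus> U \<otimes> V \<otimes> T \<otimes> star A U"
  have Wc: "W \<in> carrier A" using V by (simp add: W_def)
  have UU: "star A U \<otimes> (U \<otimes> x) = x" "U \<otimes> (star A U \<otimes> x) = x" if "x \<in> carrier A" for x
    using that by (simp_all add: A.m_assoc[symmetric])
  have WS: "W \<otimes> S = V"
  proof -
    have "W \<otimes> S = V \<otimes> (T \<otimes> S) \<oplus> U \<otimes> V \<otimes> (T \<otimes> (star A U \<otimes> S))"
      using V by (simp add: W_def A.l_distr A.m_assoc)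
    then show ?thesis using V by (simp add: TstarUS)
  qed
  have sW: "star A W = S \<otimes> star A V \<oplus> U \<otimes> S \<otimes> star A V \<otimes> star A U"
    using V by (simp add: W_def star_add star_mult star_star A.m_assoc)
  have WW: "star A W \<otimes> W = \<one>"
  proof -
    have VUV: "star A V \<otimes> (U \<otimes> (V \<otimes> x)) = \<zero>" "star A V \<otimes> (star A U \<otimes> (V \<otimes> x)) = \<zero>"
      if "x \<in> carrier A" for x
    proof -
      have "star A V \<otimes> (U \<otimes> (V \<otimes> x)) = star A V \<otimes> (U \<otimes> V) \<otimes> x" using that V by (simp add: A.m_assoc)
      then show "star A V \<otimes> (U \<otimes> (V \<otimes> x)) = \<zero>" using that by (simp add: V.TUS)
      have "star A V \<otimes> (star A U \<otimes> (V \<otimes> x)) = star A V \<otimes> (star A U \<otimes> V) \<otimes> x" using that V by (simp add: A.m_assoc)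
      then show "star A V \<otimes> (star A U \<otimes> (V \<otimes> x)) = \<zero>" using that by (simp add: V.TstarUS)
    qed
    have "star A W \<otimes> W = S \<otimes> T \<oplus> U \<otimes> S \<otimes> T \<otimes> star A U"
      unfolding sW unfolding W_def using V by (simp add: A.l_distr A.r_distr A.m_assoc VUV UU)
    then show ?thesis by (simp add: range_sum)
  qed
  have UW: "W \<in> commutant"
  proof -
    have TU: "U \<otimes> T \<otimes> star A U = T \<otimes> U"
    proof -
      have "U \<otimes> T \<otimes> star A U = (T \<otimes> upow 2) \<otimes> star A U" using T_upow[of 1] by simp
      also have "\<dots> = T \<otimes> (upow 2 \<otimes> upow (-1))" by (simp add: A.m_assoc)
      also have "upow 2 \<otimes> upow (-1) = U" using upow_add[of 2 "-1"] by simp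
      finally show ?thesis .
    qed
    have "U \<otimes> W = U \<otimes> V \<otimes> T \<oplus> (U \<otimes> U \<otimes> V) \<otimes> T \<otimes> star A U"
      using V by (simp add: W_def A.r_distr A.m_assoc)
    also have "\<dots> = U \<otimes> V \<otimes> T \<oplus> V \<otimes> (U \<otimes> T \<otimes> star A U)"
      using V by (simp add: V.SU[symmetric] A.m_assoc)
    also have "\<dots> = U \<otimes> V \<otimes> T \<oplus> V \<otimes> (T \<otimes> U)" by (simp only: TU)
    also have "\<dots> = W \<otimes> U" using V by (simp add: W_def A.l_distr A.m_assoc A.a_comm)
    finally show ?thesis using Wc by (simp add: commutant_def)
  qed
  then obtain f where f: "symbol f W" using commutant_eq_generated generated_iff_symbol by blast
  define g where "g = restrict f (sphere 0 1)"
  have g: "symbol g W" by (rule symbol_cong[OF f]) (simp add: g_def)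
  have "cmod (g z) = 1" if z: "cmod z = 1" for z
  proof -
    have "symbol (\<lambda>z. cnj (g z) * g z) \<one>" using symbol_mult[OF symbol_star[OF g] g] by (simp add: WW)
    then have "cnj (g z) * g z = 1" using symbol_functions_unique[OF _ symbol_one z] by blast
    then have "complex_of_real ((cmod (g z))\<^sup>2) = 1" using complex_norm_square[of "g z"] by (simp add: mult.commute)
    then have "(cmod (g z))\<^sup>2 = 1" using of_real_eq_1_iff by blast
    then show ?thesis using norm_ge_zero[of "g z"] by (auto simp: power2_eq_1_iff)
  qed
  then have "g \<in> circle_maps"
    using symbol_continuous[OF g] by (auto simp: circle_maps_def g_def)
  then show ?thesis using g WS[symmetric] unfolding V_def by blast
qed

lemma circle_maps_norm: "f \<in> circle_maps \<Longrightarrow> cmod z = 1 \<Longrightarrow> cmod (f z) = 1"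
  by (auto simp: circle_maps_def PiE_def Pi_def)

lemma circle_maps_mult:
  assumes "f \<in> circle_maps" "g \<in> circle_maps" shows "(\<lambda>z\<in>sphere 0 1. f z * g z) \<in> circle_maps"
proof -
  have "continuous_on (sphere 0 1) (\<lambda>z. f z * g z)"
    using assms by (intro continuous_intros) (auto simp: circle_maps_def)
  then have "continuous_on (sphere 0 1) (\<lambda>z\<in>sphere 0 1. f z * g z)"
    by (rule continuous_on_cong[THEN iffD1, rotated -1]) auto
  then show ?thesis using circle_maps_norm assms by (auto simp: circle_maps_def norm_mult)
qed

lemma circle_maps_cnj:
  assumes "f \<in> circle_maps" shows "(\<lambda>z\<in>sphere 0 1. cnj (f z)) \<in> circle_maps"
proof -
  have "continuous_on (sphere 0 1) (\<lambda>z. cnj (f z))"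
    using assms by (intro continuous_intros) (auto simp: circle_maps_def)
  then have "continuous_on (sphere 0 1) (\<lambda>z\<in>sphere 0 1. cnj (f z))"
    by (rule continuous_on_cong[THEN iffD1, rotated -1]) auto
  then show ?thesis using circle_maps_norm assms by (auto simp: circle_maps_def)
qed

lemma circle_maps_one: "(\<lambda>z\<in>sphere 0 1. 1) \<in> circle_maps"
proof -
  have "continuous_on (sphere 0 1) (\<lambda>z\<in>sphere (0::complex) 1. 1 :: complex)"
    by (rule continuous_on_cong[THEN iffD1, rotated -1, OF continuous_on_const]) auto
  then show ?thesis by (auto simp: circle_maps_def)
qed

lemma circle_maps_mult_cnj:
  assumes f: "f \<in> circle_maps" and z: "cmod z = 1" shows "cnj (f z) * f z = 1"
  using complex_norm_square[of "f z"] circle_maps_norm[OF f z] by (simp add: mult.commute)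

lemma symbol_circle_map:
  assumes f: "f \<in> circle_maps" shows "symbol f (functional_calculus A U f)"
proof -
  have fc: "f \<in> carrier CT" using f by (auto simp: circle_maps_def continuous_functions_def PiE_def)
  then obtain y where "symbol f y" using symbol_exists by (auto simp: continuous_functions_def)
  then show ?thesis using functional_calculus_eq[OF fc] by simp
qed

text \<open>As \<open>F = f(U)\<close> is a unitary that commutes with \<open>U\<close>, it carries the relations over from \<open>S\<close> to \<open>F S\<close>.\<close>

lemma circle_map_pair:
  assumes f: "f \<in> circle_maps" and F: "symbol f F"
  shows "two_adic_pair A U (F \<otimes> S)"
proof -
  note Fc = symbol_closed[OF F]
  have 1: "symbol (\<lambda>z. cnj (f z) * f z) \<one>" "symbol (\<lambda>z. f z * cnj (f z)) \<one>"
    by (rule symbol_cong[OF symbol_one], use circle_maps_mult_cnj[OF f] in \<open>simp add: mult.commute\<close>)+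
  have FF: "star A F \<otimes> F = \<one>" "F \<otimes> star A F = \<one>"
    using symbol_unique[OF symbol_mult[OF symbol_star[OF F] F] 1(1)] symbol_unique[OF symbol_mult[OF F symbol_star[OF F]] 1(2)] .
  have UF: "U \<otimes> F = F \<otimes> U" by (rule symbol_commute[OF symbol_U F])
  have UF': "star A U \<otimes> star A F = star A F \<otimes> star A U"
    by (rule symbol_commute[OF symbol_star[OF symbol_U] symbol_star[OF F]])
  have iso: "star A (F \<otimes> S) \<otimes> (F \<otimes> S) = \<one>"
  proof -
    have "star A (F \<otimes> S) \<otimes> (F \<otimes> S) = T \<otimes> (star A F \<otimes> F) \<otimes> S" using Fc by (simp add: star_mult A.m_assoc)
    then show ?thesis by (simp add: FF)
  qed
  have com: "F \<otimes> S \<otimes> U = U \<otimes> U \<otimes> (F \<otimes> S)"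
  proof -
    have "F \<otimes> S \<otimes> U = (F \<otimes> U) \<otimes> U \<otimes> S" using Fc by (simp add: SU A.m_assoc)
    also have "\<dots> = (U \<otimes> F) \<otimes> U \<otimes> S" by (simp only: UF)
    also have "\<dots> = U \<otimes> (F \<otimes> U) \<otimes> S" using Fc by (simp add: A.m_assoc)
    also have "\<dots> = U \<otimes> (U \<otimes> F) \<otimes> S" by (simp only: UF)
    also have "\<dots> = U \<otimes> U \<otimes> (F \<otimes> S)" using Fc by (simp add: A.m_assoc)
    finally show ?thesis .
  qed
  have "F \<otimes> S \<otimes> star A (F \<otimes> S) \<oplus> U \<otimes> (F \<otimes> S) \<otimes> star A (F \<otimes> S) \<otimes> star A U = \<one>"
  proof -
    have "U \<otimes> (F \<otimes> S) \<otimes> star A (F \<otimes> S) \<otimes> star A U = (U \<otimes> F) \<otimes> S \<otimes> T \<otimes> (star A F \<otimes> star A U)"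
      using Fc by (simp add: star_mult A.m_assoc)
    also have "\<dots> = F \<otimes> (U \<otimes> S \<otimes> T \<otimes> star A U) \<otimes> star A F"
      unfolding UF UF'[symmetric] using Fc by (simp add: A.m_assoc)
    finally have "F \<otimes> S \<otimes> star A (F \<otimes> S) \<oplus> U \<otimes> (F \<otimes> S) \<otimes> star A (F \<otimes> S) \<otimes> star A U
        = F \<otimes> (S \<otimes> T) \<otimes> star A F \<oplus> F \<otimes> (U \<otimes> S \<otimes> T \<otimes> star A U) \<otimes> star A F"
      using Fc by (simp add: star_mult A.m_assoc)
    also have "\<dots> = F \<otimes> (S \<otimes> T \<oplus> U \<otimes> S \<otimes> T \<otimes> star A U) \<otimes> star A F"
      using Fc by (simp add: A.l_distr A.r_distr)
    finally show ?thesis using Fc by (simp add: range_sum FF)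
  qed
  then show ?thesis using iso com unitary Fc by (simp add: two_adic_pair_def is_isometry_def)
qed

lemma hom_eqI:
  assumes \<Phi>: "\<Phi> \<in> star_hom A A" and \<Psi>: "\<Psi> \<in> star_hom A A" and U: "\<Phi> U = \<Psi> U" and S: "\<Phi> S = \<Psi> S"
  shows "\<Phi> = \<Psi>"
proof (rule extensionalityI[of _ "carrier A"])
  show "\<Phi> \<in> extensional (carrier A)" "\<Psi> \<in> extensional (carrier A)"
    using \<Phi> \<Psi> star_hom_simps(7) by blast+
  fix x assume "x \<in> carrier A"
  then show "\<Phi> x = \<Psi> x"
    using star_hom_eq_on_generated[OF unital_cstar_algebra_axioms unital_cstar_algebra_axioms \<Phi> \<Psi>, of "{U, S}" x]
      U S generated by auto
qed

lemma id_hom: "(\<lambda>x\<in>carrier A. x) \<in> star_hom A A"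
  by (auto simp: star_hom_def ring_hom_def)

lemma compose_hom:
  assumes \<Phi>: "\<Phi> \<in> star_hom A A" and \<Psi>: "\<Psi> \<in> star_hom A A"
  shows "compose (carrier A) \<Phi> \<Psi> \<in> star_hom A A"
  using star_hom_simps[OF \<Phi>] star_hom_simps[OF \<Psi>]
  by (simp add: star_hom_def ring_hom_def compose_def)

lemma hom_fixes_generated:
  assumes \<Phi>: "\<Phi> \<in> star_hom A A" and U: "\<Phi> U = U" and x: "x \<in> cstar_generated A {U}"
  shows "\<Phi> x = x"
proof -
  have "cstar_generated A {U} \<subseteq> carrier A" using cstar_subalgebra_generated(1)[of "{U}"] by (auto simp: cstar_subalgebra_iff)
  then show ?thesis
    using star_hom_eq_on_generated[OF unital_cstar_algebra_axioms unital_cstar_algebra_axioms \<Phi> id_hom, of "{U}" x] U x by auto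
qed

lemma U_generated: "U \<in> cstar_generated A {U}"
  using cstar_subalgebra_generated(2)[of "{U}"] by simp

lemma fixing_End_iff: "\<Lambda> \<in> fixing_End A (cstar_generated A {U}) \<longleftrightarrow> \<Lambda> \<in> star_hom A A \<and> \<Lambda> U = U"
  using hom_fixes_generated U_generated by (auto simp: fixing_End_def)

lemma circle_hom_exists:
  assumes f: "f \<in> circle_maps"
  shows "\<exists>\<Lambda>. \<Lambda> \<in> star_hom A A \<and> \<Lambda> U = U \<and> \<Lambda> S = functional_calculus A U f \<otimes> S"
  using universal[OF circle_map_pair[OF f symbol_circle_map[OF f]]] by blast

lemma circle_hom_compose:
  assumes f: "f \<in> circle_maps" and g: "g \<in> circle_maps" and fg: "fg \<in> circle_maps"
    and eq: "\<And>z. cmod z = 1 \<Longrightarrow> fg z = f z * g z"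
    and \<Phi>: "\<Phi> \<in> star_hom A A" "\<Phi> U = U" "\<Phi> S = functional_calculus A U f \<otimes> S"
    and \<Psi>: "\<Psi> \<in> star_hom A A" "\<Psi> U = U" "\<Psi> S = functional_calculus A U g \<otimes> S"
  shows "compose (carrier A) \<Phi> \<Psi> S = functional_calculus A U fg \<otimes> S"
proof -
  note F = symbol_circle_map[OF f] and G = symbol_circle_map[OF g]
  have "compose (carrier A) \<Phi> \<Psi> S = \<Phi> (functional_calculus A U g \<otimes> S)" by (simp add: compose_def \<Psi>)
  also have "\<dots> = \<Phi> (functional_calculus A U g) \<otimes> \<Phi> S"
    using star_hom_simps(2)[OF \<Phi>(1)] symbol_closed[OF G] by simp
  also have "\<Phi> (functional_calculus A U g) = functional_calculus A U g"
    by (rule hom_fixes_generated[OF \<Phi>(1,2) symbol_generated[OF G]])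
  also have "functional_calculus A U g \<otimes> \<Phi> S = (functional_calculus A U g \<otimes> functional_calculus A U f) \<otimes> S"
    using symbol_closed[OF F] symbol_closed[OF G] by (simp add: \<Phi> A.m_assoc)
  also have "functional_calculus A U g \<otimes> functional_calculus A U f = functional_calculus A U fg"
    by (rule symbol_unique[OF symbol_cong[OF symbol_mult[OF G F]] symbol_circle_map[OF fg]]) (simp add: eq mult.commute)
  finally show ?thesis .
qed

lemma circle_hom_one: "functional_calculus A U (\<lambda>z\<in>sphere 0 1. 1) = \<one>"
  by (rule symbol_unique[OF symbol_circle_map[OF circle_maps_one] symbol_cong[OF symbol_one]]) simp

lemma circle_hom_inverse:
  assumes f: "f \<in> circle_maps" and g: "g \<in> circle_maps" and eq: "\<And>z. cmod z = 1 \<Longrightarrow> f z * g z = 1"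
    and \<Phi>: "\<Phi> \<in> star_hom A A" "\<Phi> U = U" "\<Phi> S = functional_calculus A U f \<otimes> S"
    and \<Psi>: "\<Psi> \<in> star_hom A A" "\<Psi> U = U" "\<Psi> S = functional_calculus A U g \<otimes> S"
  shows "compose (carrier A) \<Phi> \<Psi> = (\<lambda>x\<in>carrier A. x)"
proof (rule hom_eqI[OF compose_hom[OF \<Phi>(1) \<Psi>(1)] id_hom])
  show "compose (carrier A) \<Phi> \<Psi> U = (\<lambda>x\<in>carrier A. x) U" by (simp add: compose_def \<Phi> \<Psi>)
  show "compose (carrier A) \<Phi> \<Psi> S = (\<lambda>x\<in>carrier A. x) S"
    using circle_hom_compose[OF f g circle_maps_one _ \<Phi> \<Psi>] eq circle_hom_one by simp
qed

lemma circle_hom_bij: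
  assumes f: "f \<in> circle_maps" and \<Phi>: "\<Phi> \<in> star_hom A A" "\<Phi> U = U" "\<Phi> S = functional_calculus A U f \<otimes> S"
  shows "bij_betw \<Phi> (carrier A) (carrier A)"
proof -
  note g = circle_maps_cnj[OF f]
  obtain \<Psi> where \<Psi>: "\<Psi> \<in> star_hom A A" "\<Psi> U = U" "\<Psi> S = functional_calculus A U (\<lambda>z\<in>sphere 0 1. cnj (f z)) \<otimes> S"
    using circle_hom_exists[OF g] by blast
  have "compose (carrier A) \<Phi> \<Psi> = (\<lambda>x\<in>carrier A. x)" "compose (carrier A) \<Psi> \<Phi> = (\<lambda>x\<in>carrier A. x)"
    by (rule circle_hom_inverse[OF f g _ \<Phi> \<Psi>] circle_hom_inverse[OF g f _ \<Psi> \<Phi>],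
        use circle_maps_mult_cnj[OF f] in \<open>simp add: mult.commute\<close>)+
  then have "\<Phi> (\<Psi> x) = x" "\<Psi> (\<Phi> x) = x" if "x \<in> carrier A" for x
    using that by (metis compose_eq restrict_apply')+
  then show ?thesis
    using star_hom_simps(1)[OF \<Phi>(1)] star_hom_simps(1)[OF \<Psi>(1)] by (intro bij_betw_byWitness[of _ \<Psi>]) auto
qed

text \<open>The description that defines \<open>beta\<close> has exactly one solution: existence is the universal property, and
  bijectivity comes from the conjugate function.\<close>

lemma beta:
  assumes f: "f \<in> circle_maps"
  shows "beta A U S f \<in> star_hom A A" "bij_betw (beta A U S f) (carrier A) (carrier A)"
    "beta A U S f U = U" "beta A U S f S = functional_calculus A U f \<otimes> S"
proof -
  obtain \<Phi> where \<Phi>: "\<Phi> \<in> star_hom A A" "\<Phi> U = U" "\<Phi> S = functional_calculus A U f \<otimes> S"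
    using circle_hom_exists[OF f] by blast
  have "beta A U S f = \<Phi>"
    unfolding beta_def
  proof (rule the_equality)
    show "\<Phi> \<in> star_hom A A \<and> bij_betw \<Phi> (carrier A) (carrier A) \<and> \<Phi> U = U \<and> \<Phi> S = functional_calculus A U f \<otimes> S"
      using \<Phi> circle_hom_bij[OF f \<Phi>] by blast
  next
    fix \<Lambda> assume "\<Lambda> \<in> star_hom A A \<and> bij_betw \<Lambda> (carrier A) (carrier A) \<and> \<Lambda> U = U \<and> \<Lambda> S = functional_calculus A U f \<otimes> S"
    then show "\<Lambda> = \<Phi>" using \<Phi> by (intro hom_eqI) auto
  qed
  then show "beta A U S f \<in> star_hom A A" "bij_betw (beta A U S f) (carrier A) (carrier A)"
    "beta A U S f U = U" "beta A U S f S = functional_calculus A U f \<otimes> S"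
    using \<Phi> circle_hom_bij[OF f \<Phi>] by auto
qed

lemma fixing_End_eq: "fixing_End A (cstar_generated A {U}) = beta A U S ` circle_maps"
proof (intro equalityI subsetI)
  fix \<Lambda> assume "\<Lambda> \<in> fixing_End A (cstar_generated A {U})"
  then have \<Lambda>: "\<Lambda> \<in> star_hom A A" "\<Lambda> U = U" by (auto simp: fixing_End_iff)
  obtain f W where f: "f \<in> circle_maps" "symbol f W" "\<Lambda> S = W \<otimes> S"
    using hom_fixing_U_imp_symbol[OF \<Lambda>] by blast
  have "W = functional_calculus A U f" using symbol_unique[OF f(2) symbol_circle_map[OF f(1)]] .
  then have "\<Lambda> = beta A U S f" using \<Lambda> f beta[OF f(1)] by (intro hom_eqI) auto
  then show "\<Lambda> \<in> beta A U S ` circle_maps" using f(1) by blast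
next
  fix \<Lambda> assume "\<Lambda> \<in> beta A U S ` circle_maps"
  then show "\<Lambda> \<in> fixing_End A (cstar_generated A {U})" using beta by (auto simp: fixing_End_iff)
qed

lemma fixing_Aut_eq: "fixing_Aut A (cstar_generated A {U}) = fixing_End A (cstar_generated A {U})"
  using beta(2) by (auto simp: fixing_Aut_def fixing_End_eq)

lemma beta_compose:
  assumes f: "f \<in> circle_maps" and g: "g \<in> circle_maps"
  shows "beta A U S (\<lambda>z\<in>sphere 0 1. f z * g z) = compose (carrier A) (beta A U S f) (beta A U S g)"
proof (rule hom_eqI)
  note fg = circle_maps_mult[OF f g]
  show "beta A U S (\<lambda>z\<in>sphere 0 1. f z * g z) \<in> star_hom A A" by (rule beta[OF fg])
  show "compose (carrier A) (beta A U S f) (beta A U S g) \<in> star_hom A A"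
    by (rule compose_hom[OF beta(1)[OF f] beta(1)[OF g]])
  show "beta A U S (\<lambda>z\<in>sphere 0 1. f z * g z) U = compose (carrier A) (beta A U S f) (beta A U S g) U"
    using beta[OF fg] beta[OF f] beta[OF g] by (simp add: compose_def)
  show "beta A U S (\<lambda>z\<in>sphere 0 1. f z * g z) S = compose (carrier A) (beta A U S f) (beta A U S g) S"
    using circle_hom_compose[OF f g fg _ beta(1,3,4)[OF f] beta(1,3,4)[OF g]] beta(4)[OF fg] by simp
qed

lemma beta_one: "beta A U S (\<lambda>z\<in>sphere 0 1. 1) = (\<lambda>x\<in>carrier A. x)"
  by (rule hom_eqI[OF beta(1)[OF circle_maps_one] id_hom])
    (simp_all add: beta[OF circle_maps_one] circle_hom_one)

text \<open>By the range relation, \<open>F\<close> equals \<open>F S S* + U (F S) S* U*\<close>, an expression in \<open>F S\<close>.\<close>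

lemma beta_inj: "inj_on (beta A U S) circle_maps"
proof (rule inj_onI)
  fix f g assume f: "f \<in> circle_maps" and g: "g \<in> circle_maps" and eq: "beta A U S f = beta A U S g"
  define F G where "F = functional_calculus A U f" and "G = functional_calculus A U g"
  have F: "symbol f F" and G: "symbol g G" using symbol_circle_map f g by (auto simp: F_def G_def)
  note c = symbol_closed[OF F] symbol_closed[OF G]
  have FS: "F \<otimes> S = G \<otimes> S" using beta(4)[OF f] beta(4)[OF g] eq by (simp add: F_def G_def)
  have rec: "H = H \<otimes> S \<otimes> T \<oplus> U \<otimes> (H \<otimes> S) \<otimes> T \<otimes> star A U" if H: "symbol h H" for h H
  proof -
    have Hc: "H \<in> carrier A" and UH: "U \<otimes> H = H \<otimes> U" using symbol_closed[OF H] symbol_commute[OF symbol_U H] by auto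
    have "H = H \<otimes> (S \<otimes> T \<oplus> U \<otimes> S \<otimes> T \<otimes> star A U)" using Hc by (simp add: range_sum)
    also have "\<dots> = H \<otimes> S \<otimes> T \<oplus> (H \<otimes> U) \<otimes> S \<otimes> T \<otimes> star A U" using Hc by (simp add: A.r_distr A.m_assoc)
    also have "\<dots> = H \<otimes> S \<otimes> T \<oplus> U \<otimes> (H \<otimes> S) \<otimes> T \<otimes> star A U"
      unfolding UH[symmetric] using Hc by (simp add: A.m_assoc)
    finally show ?thesis .
  qed
  have "F = G" using rec[OF F] rec[OF G] FS by simp
  then have "f z = g z" if "z \<in> sphere 0 1" for z using symbol_functions_unique[of f F g z] F G that by simp
  then show "f = g" using f g by (intro extensionalityI[of _ "sphere 0 1"]) (auto simp: circle_maps_def PiE_def)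
qed

lemma circle_maps_group: "group circle_maps_group"
proof (rule groupI)
  show "\<one>\<^bsub>circle_maps_group\<^esub> \<in> carrier circle_maps_group"
    using circle_maps_one by (simp add: circle_maps_group_def)
  fix f assume f: "f \<in> carrier circle_maps_group"
  then have fc: "f \<in> circle_maps" by (simp add: circle_maps_group_def)
  have "restrict f (sphere 0 1) = f" using fc by (auto simp: circle_maps_def PiE_def extensional_restrict)
  then show "\<one>\<^bsub>circle_maps_group\<^esub> \<otimes>\<^bsub>circle_maps_group\<^esub> f = f"
    by (simp add: circle_maps_group_def cong: restrict_cong)
  have "(\<lambda>z\<in>sphere 0 1. cnj (f z)) \<otimes>\<^bsub>circle_maps_group\<^esub> f = \<one>\<^bsub>circle_maps_group\<^esub>"
    using circle_maps_mult_cnj[OF fc] by (auto simp: circle_maps_group_def intro!: restrict_ext)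
  then show "\<exists>g\<in>carrier circle_maps_group. g \<otimes>\<^bsub>circle_maps_group\<^esub> f = \<one>\<^bsub>circle_maps_group\<^esub>"
    using circle_maps_cnj[OF fc] by (intro bexI) (auto simp: circle_maps_group_def)
qed (use circle_maps_mult in \<open>auto simp: circle_maps_group_def mult.assoc intro!: restrict_ext\<close>)

lemma beta_iso: "beta A U S \<in> iso circle_maps_group (fixing_End_monoid A (cstar_generated A {U}))"
  using beta_inj beta_compose fixing_End_eq
  by (auto simp: iso_def hom_def bij_betw_def circle_maps_group_def fixing_End_monoid_def)

lemma fixing_End_group: "group (fixing_End_monoid A (cstar_generated A {U}))"
proof (rule groupI)
  let ?G = "fixing_End_monoid A (cstar_generated A {U})"
  have car: "carrier ?G = beta A U S ` circle_maps" by (simp add: fixing_End_monoid_def fixing_End_eq)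
  have mult: "x \<otimes>\<^bsub>?G\<^esub> y = compose (carrier A) x y" for x y by (simp add: fixing_End_monoid_def)
  have one: "\<one>\<^bsub>?G\<^esub> = beta A U S (\<lambda>z\<in>sphere 0 1. 1)" by (simp add: fixing_End_monoid_def beta_one)
  show "\<one>\<^bsub>?G\<^esub> \<in> carrier ?G" using circle_maps_one by (simp add: one car)
  fix x assume x: "x \<in> carrier ?G"
  then obtain f where f: "f \<in> circle_maps" "x = beta A U S f" by (auto simp: car)
  show "\<one>\<^bsub>?G\<^esub> \<otimes>\<^bsub>?G\<^esub> x = x"
    using star_hom_simps(1,7)[OF beta(1)[OF f(1)]]
    by (intro extensionalityI[of _ "carrier A"]) (auto simp: fixing_End_monoid_def compose_def f(2))
  have "beta A U S (\<lambda>z\<in>sphere 0 1. cnj (f z)) \<otimes>\<^bsub>?G\<^esub> x = \<one>\<^bsub>?G\<^esub>"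
  proof -
    have "(\<lambda>z\<in>sphere 0 1. (\<lambda>z\<in>sphere 0 1. cnj (f z)) z * f z) = (\<lambda>z\<in>sphere 0 1. 1)"
      using circle_maps_mult_cnj[OF f(1)] by (intro restrict_ext) simp
    then show ?thesis
      unfolding mult one f(2) beta_compose[OF circle_maps_cnj[OF f(1)] f(1), symmetric] by simp
  qed
  then show "\<exists>y\<in>carrier ?G. y \<otimes>\<^bsub>?G\<^esub> x = \<one>\<^bsub>?G\<^esub>"
    using circle_maps_cnj[OF f(1)] unfolding car by blast
  fix y assume y: "y \<in> carrier ?G"
  then obtain g where g: "g \<in> circle_maps" "y = beta A U S g" by (auto simp: car)
  show "x \<otimes>\<^bsub>?G\<^esub> y \<in> carrier ?G"
    using circle_maps_mult[OF f(1) g(1)] unfolding mult car f(2) g(2) beta_compose[OF f(1) g(1), symmetric] by blast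
  fix z assume z: "z \<in> carrier ?G"
  then obtain h where h: "h \<in> circle_maps" "z = beta A U S h" by (auto simp: car)
  show "x \<otimes>\<^bsub>?G\<^esub> y \<otimes>\<^bsub>?G\<^esub> z = x \<otimes>\<^bsub>?G\<^esub> (y \<otimes>\<^bsub>?G\<^esub> z)"
    unfolding mult by (rule compose_assoc[symmetric]) (use star_hom_simps(1)[OF beta(1)[OF h(1)]] h(2) in auto)
qed

end

theorem theorem6p14:
  fixes A :: "'a cstar_alg" and U S :: 'a
  assumes "two_adic_ring_algebra A U S"
  shows "fixing_End A (cstar_generated A {U}) = fixing_Aut A (cstar_generated A {U}) \<and>
    fixing_Aut A (cstar_generated A {U}) = {beta A U S f | f. f \<in> circle_maps} \<and>
    group (fixing_End_monoid A (cstar_generated A {U})) \<and>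
    fixing_End_monoid A (cstar_generated A {U}) \<cong> circle_maps_group"
proof -
  interpret two_adic_ring A U S by unfold_locales (rule assms)
  have "circle_maps_group \<cong> fixing_End_monoid A (cstar_generated A {U})"
    using beta_iso by (auto simp: is_iso_def)
  then have "fixing_End_monoid A (cstar_generated A {U}) \<cong> circle_maps_group"
    by (rule group.iso_sym[OF circle_maps_group])
  then show ?thesis
    using fixing_Aut_eq fixing_End_eq fixing_End_group by auto
qed

end
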